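(* Let $q$ be a prime power, let $m\ge 4$ be an integer, and let $\eta$ be a non-degenerate Hermitian form on an $m$-dimensional vector space $V$ over $\mathbb{F}_{q^2}$. The line Hermitian Grassmann code defined by $\eta$ is an $[N,K,d_{\min}]$-linear code over $\mathbb{F}_{q^2}$, where $$N=\frac{(q^m+(-1)^{m-1})(q^{m-1}-(-1)^{m-1})(q^{m-2}+(-1)^{m-3})(q^{m-3}-(-1)^{m-3})}{(q^{2}-1)^2(q^{2}+1)},\qquad K=\binom{m}{2},$$ $$d_{\min}=\begin{cases} q^{4m-12}-q^{2m-6} & \text{if } m=4,6,\\ q^{4m-12} & \text{if } m\geq 8 \text{ is even},\\ q^{4m-12}-q^{3m-9} & \text{if } m \text{ is odd}.\end{cases}$$
   Context: Hermitian forms on $V$ are sesquilinear with respect to the automorphism $x\mapsto x^q$ of $\mathbb{F}_{q^2}$. A 2-dimensional subspace $X\le V$ is totally $\eta$-isotropic if $\eta(x,y)=0$ for all $x,y\in X$. The Plücker embedding maps a 2-dimensional subspace $X=\langle v_1,v_2\rangle$ to the point $[v_1\wedge v_2]$ of $\mathrm{PG}(\bigwedge^2 V)$. Let $\Omega=\{[\omega_1],\dots,[\omega_N]\}$ be the set of images of all totally $\eta$-isotropic 2-dimensional subspaces of $V$. The line Hermitian Grassmann code defined by $\eta$ is the projective code of $\Omega$: the linear code of length $N=|\Omega|$ over $\mathbb{F}_{q^2}$ with codewords $(\varphi(\omega_1),\dots,\varphi(\omega_N))$, where $\varphi$ ranges over the linear functionals on $\bigwedge^2V$ (equivalently, a generator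 matrix has as columns coordinate vectors of the $\omega_i$ in the span of $\Omega$). In an $[N,K,d_{\min}]$-code, $N$ is the length, $K$ the dimension and $d_{\min}$ the minimum Hamming distance. *)

theory Defs
  imports
    "HOL-Number_Theory.Prime_Powers"
    "HOL-Library.Function_Algebras"
    "HOL-Library.Cardinality"
begin

section \<open>Hermitian forms and totally isotropic lines\<close>

text \<open>The field is meant to have \<open>q\<^sup>2\<close> elements, so that \<open>x \<mapsto> x ^ q\<close> is its involutory
  automorphism. Forms are linear in the first and semilinear in the second argument.\<close>

definition hermitian_form ::
  "nat \<Rightarrow> ('f::field \<Rightarrow> 'v::ab_group_add \<Rightarrow> 'v) \<Rightarrow> ('v \<Rightarrow> 'v \<Rightarrow> 'f) \<Rightarrow> bool" where
  "hermitian_form q scale \<eta> \<longleftrightarrow>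
     (\<forall>x y z. \<eta> (x + y) z = \<eta> x z + \<eta> y z) \<and>
     (\<forall>x y z. \<eta> x (y + z) = \<eta> x y + \<eta> x z) \<and>
     (\<forall>a x y. \<eta> (scale a x) y = a * \<eta> x y) \<and>
     (\<forall>a x y. \<eta> x (scale a y) = a ^ q * \<eta> x y) \<and>
     (\<forall>x y. \<eta> y x = \<eta> x y ^ q)"

definition nondegenerate :: "('v::zero \<Rightarrow> 'v \<Rightarrow> 'f::zero) \<Rightarrow> bool" where
  "nondegenerate \<eta> \<longleftrightarrow> (\<forall>x. (\<forall>y. \<eta> x y = 0) \<longrightarrow> x = 0)"

definition totally_isotropic :: "('v \<Rightarrow> 'v \<Rightarrow> 'f::zero) \<Rightarrow> 'v set \<Rightarrow> bool" where
  "totally_isotropic \<eta> X \<longleftrightarrow> (\<forall>x\<in>X. \<forall>y\<in>X. \<eta> x y = 0)"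

definition isotropic_lines ::
  "('f::field \<Rightarrow> 'v::ab_group_add \<Rightarrow> 'v) \<Rightarrow> ('v \<Rightarrow> 'v \<Rightarrow> 'f) \<Rightarrow> 'v set set" where
  "isotropic_lines scale \<eta> =
     {X. module.subspace scale X \<and> vector_space.dim scale X = 2 \<and> totally_isotropic \<eta> X}"


section \<open>The exterior square\<close>

definition alternating_bilinear ::
  "('f::field \<Rightarrow> 'v::ab_group_add \<Rightarrow> 'v) \<Rightarrow> ('f \<Rightarrow> 'u::ab_group_add \<Rightarrow> 'u)
     \<Rightarrow> ('v \<Rightarrow> 'v \<Rightarrow> 'u) \<Rightarrow> bool" where
  "alternating_bilinear scaleV scaleU \<beta> \<longleftrightarrow>
     (\<forall>v. Vector_Spaces.linear scaleV scaleU (\<lambda>w. \<beta> v w)) \<and>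
     (\<forall>w. Vector_Spaces.linear scaleV scaleU (\<lambda>v. \<beta> v w)) \<and>
     (\<forall>v. \<beta> v v = 0)"

text \<open>The exterior square \<open>(\<And>\<^sup>2V, \<and>)\<close>, given by its universal property. A definition cannot
  quantify over the type of the target space, so the universal property is required for
  alternating forms only, that is, for maps into the ground field; this implies the one for
  an arbitrary target space, see \<open>universal_property\<close> below. By
  \<open>exterior_square_exists\<close>, for \<open>V\<close> of finite dimension \<open>n\<close> every space of dimension
  \<open>n choose 2\<close> carries such a structure.\<close>

locale exterior_square = V: vector_space scaleV + W: vector_space scaleW
  for scaleV :: "'f::field \<Rightarrow> 'v::ab_group_add \<Rightarrow> 'v"
    and scaleW :: "'f \<Rightarrow> 'w::ab_group_add \<Rightarrow> 'w" +
  fixes wedge :: "'v \<Rightarrow> 'v \<Rightarrow> 'w"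
  assumes wedge_alternating: "alternating_bilinear scaleV scaleW wedge"
    and universal_form: "alternating_bilinear scaleV (*) \<beta> \<Longrightarrow>
      \<exists>!\<phi>. Vector_Spaces.linear scaleW (*) \<phi> \<and> (\<forall>v w. \<phi> (wedge v w) = \<beta> v w)"

lemma vector_space_field: "vector_space ((*) :: 'f::field \<Rightarrow> 'f \<Rightarrow> 'f)"
  by unfold_locales (auto simp: algebra_simps)

lemma functional_separates:
  fixes scale :: "'f::field \<Rightarrow> 'b::ab_group_add \<Rightarrow> 'b"
  assumes "vector_space scale" and "x \<notin> module.span scale S"
  shows "\<exists>\<phi>. Vector_Spaces.linear scale (*) \<phi> \<and> (\<forall>y\<in>S. \<phi> y = 0) \<and> \<phi> x = 1"
proof -
  interpret vector_space scale by fact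
  interpret P: vector_space_pair scale "(*) :: 'f \<Rightarrow> 'f \<Rightarrow> 'f"
    by (simp add: vector_space_pair_def assms vector_space_field)
  obtain B where B: "B \<subseteq> S" "independent B" "S \<subseteq> span B"
    using maximal_independent_subset[of S] by blast
  have "x \<notin> span B" using B assms(2) span_mono by blast
  hence "independent (insert x B)" using B by (simp add: independent_insert)
  from P.linear_independent_extend[OF this, of "\<lambda>y. if y = x then 1 else 0"]
  obtain \<phi> where \<phi>: "Vector_Spaces.linear scale (*) \<phi>"
      "\<forall>y\<in>insert x B. \<phi> y = (if y = x then 1 else 0)" by blast
  have xB: "x \<notin> B" using \<open>x \<notin> span B\<close> span_base by blast
  have "\<phi> y = 0" if "y \<in> S" for y
  proof (rule P.linear_eq_0_on_span[OF \<phi>(1)])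
    show "y \<in> span B" using B(3) that by blast
    show "\<phi> b = 0" if "b \<in> B" for b using \<phi>(2) xB that by auto
  qed
  thus ?thesis using \<phi> by auto
qed

context exterior_square
begin

lemma span_wedge: "W.span {wedge v w | v w. True} = UNIV"
proof (rule ccontr)
  assume "\<not> ?thesis"
  then obtain x where "x \<notin> W.span {wedge v w | v w. True}" by blast
  from functional_separates[OF W.vector_space_axioms this] obtain \<phi> where
    \<phi>: "Vector_Spaces.linear scaleW (*) \<phi>" "\<And>v w. \<phi> (wedge v w) = 0" "\<phi> x = 1" by blast
  interpret P: vector_space_pair scaleV "(*) :: 'f \<Rightarrow> 'f \<Rightarrow> 'f"
    by (simp add: vector_space_pair_def V.vector_space_axioms vector_space_field)
  interpret Q: vector_space_pair scaleW "(*) :: 'f \<Rightarrow> 'f \<Rightarrow> 'f"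
    by (simp add: vector_space_pair_def W.vector_space_axioms vector_space_field)
  have "alternating_bilinear scaleV (*) (\<lambda>v w. 0)"
    by (simp add: alternating_bilinear_def P.linear_zero)
  from universal_form[OF this] have "\<phi> = (\<lambda>_. 0)"
    using \<phi>(1,2) Q.linear_zero by blast
  thus False using \<phi>(3) by simp
qed

theorem universal_property:
  fixes scaleU :: "'f \<Rightarrow> 'u::ab_group_add \<Rightarrow> 'u"
  assumes U: "vector_space scaleU" and \<beta>: "alternating_bilinear scaleV scaleU \<beta>"
  shows "\<exists>!g. Vector_Spaces.linear scaleW scaleU g \<and> (\<forall>v w. g (wedge v w) = \<beta> v w)"
proof -
  interpret U: vector_space scaleU by fact
  interpret P: vector_space_pair scaleW scaleU
    by (simp add: vector_space_pair_def W.vector_space_axioms U)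
  interpret Q: vector_space_pair scaleW "(*) :: 'f \<Rightarrow> 'f \<Rightarrow> 'f"
    by (simp add: vector_space_pair_def W.vector_space_axioms vector_space_field)
  let ?S = "{wedge v w | v w. True}"
  obtain B where B: "B \<subseteq> ?S" "W.independent B" "?S \<subseteq> W.span B"
    using W.maximal_independent_subset[of ?S] by blast
  have spB: "W.span B = UNIV"
    using span_wedge B(3) W.span_mono[of ?S "W.span B"] by (simp add: W.span_span top.extremum_unique)
  define f where "f b = (SOME u. \<exists>v w. wedge v w = b \<and> u = \<beta> v w)" for b
  have f: "\<exists>v w. wedge v w = b \<and> f b = \<beta> v w" if "b \<in> B" for b
    unfolding f_def by (rule someI_ex) (use B(1) that in blast)
  from P.linear_independent_extend[OF B(2)] obtain g where
    g: "Vector_Spaces.linear scaleW scaleU g" "\<forall>b\<in>B. g b = f b" by blast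
  have gw: "g (wedge v w) = \<beta> v w" for v w
  proof (rule ccontr)
    assume ne: "g (wedge v w) \<noteq> \<beta> v w"
    hence "g (wedge v w) - \<beta> v w \<notin> U.span {}" by simp
    from functional_separates[OF U this] obtain \<psi> where
      \<psi>: "Vector_Spaces.linear scaleU (*) \<psi>" "\<psi> (g (wedge v w) - \<beta> v w) = 1" by blast
    interpret psi: Vector_Spaces.linear scaleU "(*)" \<psi> by fact
    have "alternating_bilinear scaleV (*) (\<lambda>v w. \<psi> (\<beta> v w))"
      using \<beta> Vector_Spaces.linear_compose[OF _ \<psi>(1)]
      unfolding alternating_bilinear_def comp_def by (auto simp: psi.zero)
    from universal_form[OF this] obtain \<phi> where
      \<phi>: "Vector_Spaces.linear scaleW (*) \<phi>" "\<And>v w. \<phi> (wedge v w) = \<psi> (\<beta> v w)" by blast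
    have lin: "Vector_Spaces.linear scaleW (*) (\<lambda>x. \<psi> (g x))"
      using Vector_Spaces.linear_compose[OF g(1) \<psi>(1)] by (simp add: comp_def)
    have "\<phi> b = \<psi> (g b)" if "b \<in> B" for b
      using f[OF that] g(2) that \<phi>(2) by metis
    hence "\<phi> (wedge v w) = \<psi> (g (wedge v w))"
      using Q.linear_eq_on_span[OF \<phi>(1) lin, of B] spB by blast
    hence "\<psi> (g (wedge v w) - \<beta> v w) = 0" by (simp add: psi.diff \<phi>(2))
    thus False using \<psi>(2) by simp
  qed
  show ?thesis
  proof (rule ex1I[of _ g])
    show "Vector_Spaces.linear scaleW scaleU g \<and> (\<forall>v w. g (wedge v w) = \<beta> v w)"
      using g(1) gw by simp
  next
    fix h assume h: "Vector_Spaces.linear scaleW scaleU h \<and> (\<forall>v w. h (wedge v w) = \<beta> v w)"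
    have "h x = g x" for x
      by (rule P.linear_eq_on_span[of h g ?S]) (use h g(1) gw span_wedge in auto)
    thus "h = g" by blast
  qed
qed

end

theorem exterior_square_exists:
  fixes scaleV :: "'f::field \<Rightarrow> 'v::ab_group_add \<Rightarrow> 'v"
    and scaleW :: "'f \<Rightarrow> 'w::ab_group_add \<Rightarrow> 'w"
  assumes V: "vector_space scaleV" and W: "vector_space scaleW"
    and B: "finite B" "\<not> module.dependent scaleV B" "module.span scaleV B = UNIV"
    and C: "finite C" "\<not> module.dependent scaleW C" "module.span scaleW C = UNIV"
    and card: "card C = card B choose 2"
  shows "\<exists>wedge. exterior_square scaleV scaleW wedge"
proof -
  interpret V: vector_space scaleV by fact
  interpret W: vector_space scaleW by fact
  interpret VW: vector_space_pair scaleV scaleW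
    by (simp add: vector_space_pair_def V W)
  obtain idx :: "'v \<Rightarrow> nat" where idx: "inj_on idx B"
    using finite_imp_inj_to_nat_seg[OF B(1)] by blast
  define P where "P = {(a, b). a \<in> B \<and> b \<in> B \<and> idx a < idx b}"
  have finP: "finite P" using B(1) by (auto intro: finite_subset[of _ "B \<times> B"] simp: P_def)
  have bij: "bij_betw (\<lambda>(a, b). {a, b}) P {S. S \<subseteq> B \<and> card S = 2}"
    unfolding bij_betw_def
  proof
    show "inj_on (\<lambda>(a, b). {a, b}) P"
      by (auto simp: inj_on_def P_def doubleton_eq_iff)
    show "(\<lambda>(a, b). {a, b}) ` P = {S. S \<subseteq> B \<and> card S = 2}"
    proof (intro equalityI subsetI)
      fix S assume "S \<in> {S. S \<subseteq> B \<and> card S = 2}"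
      then obtain a b where ab: "S = {a, b}" "a \<noteq> b" "a \<in> B" "b \<in> B"
        by (auto simp: card_2_iff)
      hence "idx a \<noteq> idx b" using idx by (auto simp: inj_on_def)
      hence "(a, b) \<in> P \<or> (b, a) \<in> P" using ab by (auto simp: P_def)
      thus "S \<in> (\<lambda>(a, b). {a, b}) ` P" using ab(1) by (force simp: insert_commute)
    qed (auto simp: P_def card_2_iff)
  qed
  have "card P = card C"
    using bij_betw_same_card[OF bij] n_subsets[OF B(1), of 2] card by simp
  then obtain h where h: "bij_betw h P C"
    using finP C(1) finite_same_card_bij by blast
  define r where "r v b = V.representation B v b" for v b
  have rlin: "r (x + y) b = r x b + r y b" "r (scaleV c x) b = c * r x b" for x y c b
    using B by (auto simp: r_def V.representation_add V.representation_scale)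
  have rsum: "(\<Sum>b\<in>B. scaleV (r v b) b) = v" for v
    unfolding r_def by (rule V.sum_representation_eq) (use B in auto)
  define wedge where
    "wedge v w = (\<Sum>p\<in>P. scaleW (r v (fst p) * r w (snd p) - r v (snd p) * r w (fst p)) (h p))"
    for v w
  define k where "k v w p = r v (fst p) * r w (snd p) - r v (snd p) * r w (fst p)"
    for v w and p :: "'v \<times> 'v"
  have wedge_k: "wedge v w = (\<Sum>p\<in>P. scaleW (k v w p) (h p))" for v w
    by (simp add: wedge_def k_def)
  have k: "k v (x + y) p = k v x p + k v y p" "k (x + y) v p = k x v p + k y v p"
    "k v (scaleV c x) p = c * k v x p" "k (scaleV c x) v p = c * k x v p" for v x y c p
    by (simp_all add: k_def rlin algebra_simps)
  have alt: "alternating_bilinear scaleV scaleW wedge"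
    unfolding alternating_bilinear_def
  proof (intro conjI allI)
    show "Vector_Spaces.linear scaleV scaleW (\<lambda>w. wedge v w)" for v
      unfolding Vector_Spaces.linear_iff
      by (simp add: V W wedge_k k W.scale_left_distrib sum.distrib W.scale_sum_right)
    show "Vector_Spaces.linear scaleV scaleW (\<lambda>v. wedge v w)" for w
      unfolding Vector_Spaces.linear_iff
      by (simp add: V W wedge_k k W.scale_left_distrib sum.distrib W.scale_sum_right)
    show "wedge v v = 0" for v by (simp add: wedge_def mult.commute)
  qed
  interpret VF: vector_space_pair scaleV "(*) :: 'f \<Rightarrow> 'f \<Rightarrow> 'f"
    by (simp add: vector_space_pair_def V vector_space_field)
  interpret WF: vector_space_pair scaleW "(*) :: 'f \<Rightarrow> 'f \<Rightarrow> 'f"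
    by (simp add: vector_space_pair_def W vector_space_field)
  have expand: "\<beta> v w = (\<Sum>p\<in>P. (r v (fst p) * r w (snd p) - r v (snd p) * r w (fst p))
      * \<beta> (fst p) (snd p))" if \<beta>: "alternating_bilinear scaleV (*) \<beta>" for \<beta> :: "'v \<Rightarrow> 'v \<Rightarrow> 'f" and v w
  proof -
    have l1: "Vector_Spaces.linear scaleV (*) (\<beta> x)"
      and l2: "Vector_Spaces.linear scaleV (*) (\<lambda>x. \<beta> x y)"
      and a0: "\<beta> x x = 0" for x y
      using \<beta> by (auto simp: alternating_bilinear_def)
    have anti: "\<beta> y x = - \<beta> x y" for x y
    proof -
      have "\<beta> (x + y) (x + y) = \<beta> x y + \<beta> y x"
        by (simp only: VF.linear_add[OF l1] VF.linear_add[OF l2] a0[of x] a0[of y] add_0_left add_0_right add.commute)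
      hence "\<beta> y x + \<beta> x y = 0" by (metis a0 add.commute)
      thus ?thesis by (rule eq_neg_iff_add_eq_0[THEN iffD2])
    qed
    define t where "t = (\<lambda>p. r v (fst p) * r w (snd p) * \<beta> (fst p) (snd p))"
    have "\<beta> v w = \<beta> (\<Sum>a\<in>B. scaleV (r v a) a) (\<Sum>b\<in>B. scaleV (r w b) b)"
      by (simp add: rsum)
    also have "\<dots> = (\<Sum>a\<in>B. r v a * \<beta> a (\<Sum>b\<in>B. scaleV (r w b) b))"
      by (simp add: VF.linear_sum[OF l2] VF.linear_scale[OF l2])
    also have "\<dots> = (\<Sum>a\<in>B. \<Sum>b\<in>B. r v a * (r w b * \<beta> a b))"
      by (simp only: VF.linear_sum[OF l1] VF.linear_scale[OF l1] sum_distrib_left)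
    also have "\<dots> = sum t (B \<times> B)"
      by (simp only: sum.cartesian_product t_def case_prod_unfold mult.assoc fst_conv snd_conv)
    also have "B \<times> B = (P \<union> prod.swap ` P) \<union> (\<lambda>a. (a, a)) ` B"
      using idx by (auto simp: P_def inj_on_def image_iff)
    also have "sum t \<dots> = sum t (P \<union> prod.swap ` P) + sum t ((\<lambda>a. (a, a)) ` B)"
      by (rule sum.union_disjoint) (use finP B(1) in \<open>auto simp: P_def\<close>)
    also have "sum t ((\<lambda>a. (a, a)) ` B) = 0"
      by (rule sum.neutral) (auto simp: t_def a0)
    also have "sum t (P \<union> prod.swap ` P) = sum t P + sum t (prod.swap ` P)"
      by (rule sum.union_disjoint) (use finP in \<open>auto simp: P_def\<close>)
    also have "sum t (prod.swap ` P) = sum (t \<circ> prod.swap) P"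
      by (rule sum.reindex) (auto simp: inj_on_def)
    also have "sum t P + sum (t \<circ> prod.swap) P + 0 = (\<Sum>p\<in>P. t p + t (prod.swap p))"
      by (simp add: sum.distrib)
    also have "\<dots> = (\<Sum>p\<in>P. (r v (fst p) * r w (snd p) - r v (snd p) * r w (fst p))
        * \<beta> (fst p) (snd p))"
    proof (rule sum.cong[OF refl])
      fix p
      show "t p + t (prod.swap p) =
          (r v (fst p) * r w (snd p) - r v (snd p) * r w (fst p)) * \<beta> (fst p) (snd p)"
        using anti[of "snd p" "fst p"] by (simp add: t_def left_diff_distrib)
    qed
    finally show ?thesis .
  qed
  have rB: "r a b = (if b = a then 1 else 0)" if "a \<in> B" for a b
    using V.representation_basis[OF B(2) that] by (simp add: r_def)
  have wedgeP: "wedge (fst p) (snd p) = h p" if p: "p \<in> P" for p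
  proof -
    have "wedge (fst p) (snd p) = (\<Sum>p'\<in>P. scaleW (if p' = p then 1 else 0) (h p'))"
      unfolding wedge_def
    proof (rule sum.cong[OF refl])
      fix p' assume "p' \<in> P"
      hence "r (fst p) (fst p') * r (snd p) (snd p') - r (fst p) (snd p') * r (snd p) (fst p')
          = (if p' = p then 1 else 0)"
        using p by (auto simp: P_def rB split: if_splits)
      thus "scaleW (r (fst p) (fst p') * r (snd p) (snd p') - r (fst p) (snd p') * r (snd p) (fst p'))
          (h p') = scaleW (if p' = p then 1 else 0) (h p')" by simp
    qed
    also have "\<dots> = (\<Sum>p'\<in>P. if p' = p then h p' else 0)"
      by (rule sum.cong) auto
    also have "\<dots> = h p" using p finP by (simp add: sum.delta')
    finally show ?thesis .
  qed
  have "exterior_square scaleV scaleW wedge"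
  proof
    show "alternating_bilinear scaleV scaleW wedge" by fact
  next
    fix \<beta> :: "'v \<Rightarrow> 'v \<Rightarrow> 'f" assume \<beta>: "alternating_bilinear scaleV (*) \<beta>"
    from WF.linear_independent_extend[OF C(2), of "\<lambda>c. case inv_into P h c of (a, b) \<Rightarrow> \<beta> a b"]
    obtain \<phi> where \<phi>: "Vector_Spaces.linear scaleW (*) \<phi>"
        "\<forall>c\<in>C. \<phi> c = (case inv_into P h c of (a, b) \<Rightarrow> \<beta> a b)" by blast
    have \<phi>h: "\<phi> (h p) = \<beta> (fst p) (snd p)" if "p \<in> P" for p
      using that h \<phi>(2) by (auto simp: bij_betw_def case_prod_unfold inv_into_f_f)
    have "\<phi> (wedge v w) = \<beta> v w" for v w
      by (subst expand[OF \<beta>])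
        (simp add: wedge_def WF.linear_sum[OF \<phi>(1)] WF.linear_scale[OF \<phi>(1)] \<phi>h)
    moreover have "\<phi>' = \<phi>" if "Vector_Spaces.linear scaleW (*) \<phi>'"
      "\<forall>v w. \<phi>' (wedge v w) = \<beta> v w" for \<phi>'
    proof
      fix x
      have eq: "\<phi>' c = \<phi> c" if "c \<in> C" for c
      proof -
        obtain p where p: "p \<in> P" "c = h p" using h \<open>c \<in> C\<close> by (auto simp: bij_betw_def)
        thus ?thesis using wedgeP[OF p(1)] \<phi>h[OF p(1)] \<open>\<forall>v w. \<phi>' (wedge v w) = \<beta> v w\<close> by metis
      qed
      show "\<phi>' x = \<phi> x"
        by (rule WF.linear_eq_on_span[OF that(1) \<phi>(1) eq]) (use C(3) in auto)
    qed
    ultimately show "\<exists>!\<phi>. Vector_Spaces.linear scaleW (*) \<phi> \<and> (\<forall>v w. \<phi> (wedge v w) = \<beta> v w)"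
      using \<phi>(1) by blast
  qed
  thus ?thesis by blast
qed


section \<open>The Pluecker embedding\<close>

definition proj_point ::
  "('f::field \<Rightarrow> 'w::ab_group_add \<Rightarrow> 'w) \<Rightarrow> 'w \<Rightarrow> 'w set" where
  "proj_point scale w = module.span scale {w}"

definition isotropic_line_points ::
  "('f::field \<Rightarrow> 'v::ab_group_add \<Rightarrow> 'v) \<Rightarrow> ('f \<Rightarrow> 'w::ab_group_add \<Rightarrow> 'w)
     \<Rightarrow> ('v \<Rightarrow> 'v \<Rightarrow> 'w) \<Rightarrow> ('v \<Rightarrow> 'v \<Rightarrow> 'f) \<Rightarrow> 'w set set" where
  "isotropic_line_points scaleV scaleW wedge \<eta> =
     {proj_point scaleW (wedge v1 v2) | v1 v2. module.span scaleV {v1, v2} \<in> isotropic_lines scaleV \<eta>}"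


section \<open>Linear codes\<close>

text \<open>A word of length \<open>N\<close> is a function on \<open>nat\<close> that vanishes from \<open>N\<close> on;
  its entries are those at \<open>0, \<dots>, N - 1\<close>.\<close>

definition words :: "nat \<Rightarrow> (nat \<Rightarrow> 'f::field) set" where
  "words N = {c. \<forall>i\<ge>N. c i = 0}"

definition word_scale :: "'f::field \<Rightarrow> (nat \<Rightarrow> 'f) \<Rightarrow> nat \<Rightarrow> 'f" where
  "word_scale a c = (\<lambda>i. a * c i)"

lemma vector_space_word_scale: "vector_space word_scale"
  by unfold_locales (auto simp: word_scale_def algebra_simps fun_eq_iff)

lemma subspace_words: "module.subspace word_scale (words N)"
proof -
  interpret vector_space word_scale by (rule vector_space_word_scale)
  show ?thesis by (auto simp: subspace_def words_def word_scale_def)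
qed

definition hamming_distance :: "nat \<Rightarrow> (nat \<Rightarrow> 'f) \<Rightarrow> (nat \<Rightarrow> 'f) \<Rightarrow> nat" where
  "hamming_distance N c c' = card {i. i < N \<and> c i \<noteq> c' i}"

definition min_distance :: "nat \<Rightarrow> (nat \<Rightarrow> 'f) set \<Rightarrow> nat" where
  "min_distance N C = Min {hamming_distance N c c' | c c'. c \<in> C \<and> c' \<in> C \<and> c \<noteq> c'}"

definition linear_code :: "nat \<Rightarrow> nat \<Rightarrow> nat \<Rightarrow> (nat \<Rightarrow> 'f::field) set \<Rightarrow> bool" where
  "linear_code N K d C \<longleftrightarrow>
     C \<subseteq> words N \<and> module.subspace word_scale C \<and>
     vector_space.dim word_scale C = K \<and> min_distance N C = d"

definition projective_code ::
  "('f::field \<Rightarrow> 'w::ab_group_add \<Rightarrow> 'w) \<Rightarrow> nat \<Rightarrow> (nat \<Rightarrow> 'w) \<Rightarrow> (nat \<Rightarrow> 'f) set" where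
  "projective_code scale N \<omega> =
     {(\<lambda>i. if i < N then \<phi> (\<omega> i) else 0) | \<phi>. Vector_Spaces.linear scale (*) \<phi>}"

end

theory Submission
  imports Defs "HOL-Computational_Algebra.Polynomial"
begin

text \<open>
  Codewords are alternating forms \<open>\<beta>\<close>, and each of these is \<open>\<beta> x y = \<eta> y (f x)\<close> for a semilinear map
  \<open>f\<close> with \<open>\<eta> x (f x) = 0\<close>. For an isotropic vector \<open>x\<close>, the number of isotropic \<open>y\<close> orthogonal to
  \<open>x\<close> with \<open>\<beta> x y \<noteq> 0\<close> depends only on whether \<open>f x \<in> \<langle>x\<rangle>\<close> and whether \<open>f x\<close> is isotropic.
  The form \<open>\<theta> x y = \<eta> (f y) (f x)\<close> is Hermitian and represented by the linear map \<open>- f \<circ> f\<close>, so the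
  number of isotropic \<open>x\<close> with \<open>f x\<close> isotropic follows from counting the zeros of every form in the
  pencil of \<open>\<theta>\<close> and \<open>\<eta>\<close>, whose radicals are the eigenspaces of \<open>- f \<circ> f\<close> for eigenvalues fixed by
  \<open>x \<mapsto> x\<^sup>q\<close>. The vectors with \<open>f x \<in> \<langle>x\<rangle>\<close> are counted by Galois descent in the same eigenspaces.
  This gives the weight of \<open>\<beta>\<close> in terms of \<open>dim (ker f)\<close>, \<open>dim (ker f \<inter> range f)\<close> and the dimensions
  of the eigenspaces. As these dimensions add up to at most \<open>m\<close>, the minimum can be read off: it is
  attained by a form of rank two, except for \<open>m = 4\<close> and \<open>m = 6\<close>, where \<open>f \<circ> f = - id\<close> is better.
\<close>

section \<open>Finite fields and the cardinality of subspaces\<close>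

text \<open>Lines are counted through their ordered bases. Each line has |GL_2(q^2)| = (q^4 - 1)(q^4
  - q^2) of them, so the length and every weight, multiplied by this constant, become numbers of
  ordered pairs of isotropic vectors, which can be summed over the first entry. The obstacle is that
  asking for both x and f x to be isotropic intersects two Hermitian varieties, while only a single
  variety has a size given by one radical. A second obstacle is that f is merely semilinear: its
  eigenvectors for a nonzero eigenvalue form in general no subspace over F_{q^2}, so they are
  compared in size with eigenspaces of a linear map. The exceptions m = 4, 6 arise where f is
  bijective and all of V is one eigenspace: in the normalized bound a loss (q^2 + 1)(q^m - 1) then
  stands against a gain q^(2m - 4) - 1, which among even m is large enough only from m = 8 on. That
  the code has the full dimension m choose 2 follows from the positive lower bound: no nonzero form
  vanishes on all isotropic lines.\<close>

lemma card_kernel_image: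
  fixes f :: "'a::ab_group_add \<Rightarrow> 'b::ab_group_add"
  assumes "finite S" "0 \<in> S" "\<And>x y. x \<in> S \<Longrightarrow> y \<in> S \<Longrightarrow> x - y \<in> S"
    and f: "\<And>x y. x \<in> S \<Longrightarrow> y \<in> S \<Longrightarrow> f (x - y) = f x - f y"
  shows "card S = card (f ` S) * card {x \<in> S. f x = 0}"
proof -
  have add: "x + y \<in> S" if "x \<in> S" "y \<in> S" for x y
    using assms(3)[OF that(1) assms(3)[OF assms(2) that(2)]] by simp
  have f0: "f 0 = 0" using f[OF assms(2,2)] by simp
  have fadd: "f (x + y) = f x + f y" if "x \<in> S" "y \<in> S" for x y
    using f[OF that(1) assms(3)[OF assms(2) that(2)]] f[OF assms(2) that(2)] f0 by simp
  have fib: "card {x \<in> S. f x = y} = card {x \<in> S. f x = 0}" if "y \<in> f ` S" for y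
  proof -
    from that obtain x0 where x0: "x0 \<in> S" "y = f x0" by blast
    have "bij_betw (\<lambda>x. x - x0) {x \<in> S. f x = y} {x \<in> S. f x = 0}"
      by (rule bij_betw_byWitness[of _ "\<lambda>x. x + x0"])
        (use x0 add assms(3) f fadd in auto)
    thus ?thesis by (rule bij_betw_same_card)
  qed
  have "card S = (\<Sum>y\<in>f ` S. card {x \<in> S. f x = y})"
    using sum.image_gen[OF assms(1), of "\<lambda>_. 1::nat" f] by simp
  also have "\<dots> = (\<Sum>y\<in>f ` S. card {x \<in> S. f x = 0})" by (rule sum.cong) (auto simp: fib)
  finally show ?thesis by simp
qed

lemma card_span_independent:
  fixes scale :: "'f::{field,finite} \<Rightarrow> 'v::ab_group_add \<Rightarrow> 'v"
  assumes "vector_space scale" and "finite B" and "\<not> module.dependent scale B"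
  shows "finite (module.span scale B) \<and> card (module.span scale B) = CARD('f) ^ card B"
  using assms(2,3)
proof (induction B rule: finite_induct)
  interpret vector_space scale by fact
  case empty
  show ?case by simp
next
  interpret vector_space scale by fact
  case (insert b B)
  have ind: "independent B" and b: "b \<notin> span B"
    using insert.prems insert.hyps by (auto simp: independent_insert)
  have eq: "span (insert b B) = (\<lambda>(c, x). scale c b + x) ` (UNIV \<times> span B)" (is "_ = ?R")
  proof (intro equalityI subsetI)
    fix x assume "x \<in> span (insert b B)"
    then obtain k where "x - scale k b \<in> span B" by (auto simp: span_insert)
    thus "x \<in> ?R" by (intro image_eqI[of _ _ "(k, x - scale k b)"]) auto
  next
    fix x assume "x \<in> ?R"
    then obtain c y where "x = scale c b + y" "y \<in> span B" by auto
    hence "x - scale c b \<in> span B" by simp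
    thus "x \<in> span (insert b B)" by (auto simp: span_insert)
  qed
  have inj: "inj_on (\<lambda>(c, x). scale c b + x) (UNIV \<times> span B)"
  proof (rule inj_onI, clarify)
    fix c x c' x' assume x: "x \<in> span B" "x' \<in> span B" and e: "scale c b + x = scale c' b + x'"
    have "scale (c - c') b = x' - x"
      using e by (simp add: scale_left_diff_distrib algebra_simps)
    hence m: "scale (c - c') b \<in> span B" using x by (simp add: span_diff)
    have "c = c'"
    proof (rule ccontr)
      assume "c \<noteq> c'"
      hence "b = scale (inverse (c - c')) (scale (c - c') b)" by simp
      thus False using b span_scale[OF m, of "inverse (c - c')"] by simp
    qed
    thus "c = c' \<and> x = x'" using e by simp
  qed
  show ?case
    using insert.IH[OF ind] insert.hyps
    by (simp add: eq card_image[OF inj] card_cartesian_product finite_cartesian_product)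
qed

lemma card_subspace:
  fixes scale :: "'f::{field,finite} \<Rightarrow> 'v::ab_group_add \<Rightarrow> 'v"
  assumes "vector_space scale" and "module.subspace scale S" and "finite S"
  shows "card S = CARD('f) ^ vector_space.dim scale S"
proof -
  interpret vector_space scale by fact
  obtain B where B: "B \<subseteq> S" "independent B" "S \<subseteq> span B" "card B = dim S"
    using basis_exists[of S] by blast
  have "span B = S" using B assms(2) by (simp add: span_subspace)
  thus ?thesis
    using card_span_independent[OF assms(1) finite_subset[OF B(1) assms(3)] B(2)] B(4) by simp
qed

lemma hermitian_formD:
  assumes "hermitian_form q scale h"
  shows "h (x + y) z = h x z + h y z" and "h x (y + z) = h x y + h x z"
    and "h (scale a x) y = a * h x y" and "h x (scale a y) = a ^ q * h x y"
  using assms unfolding hermitian_form_def by blast+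

lemma hermitian_form_sym: "hermitian_form q scale h \<Longrightarrow> h y x = h x y ^ q"
  unfolding hermitian_form_def by blast

locale hermitian_space = vector_space scale
  for scale :: "'f::{field,finite} \<Rightarrow> 'v::ab_group_add \<Rightarrow> 'v" +
  fixes q m :: nat and \<eta> :: "'v \<Rightarrow> 'v \<Rightarrow> 'f"
  assumes q2: "2 \<le> q" and card_f: "CARD('f) = q\<^sup>2" and m4: "4 \<le> m" and dimV: "dim UNIV = m"
    and herm: "hermitian_form q scale \<eta>" and nondeg: "nondegenerate \<eta>"
begin

lemma finV [simp, intro]: "finite (S :: 'v set)"
proof -
  obtain B where B: "independent B" "span B = (UNIV::'v set)" "card B = m"
    using basis_exists[of UNIV] dimV by (metis span_UNIV span_subspace subspace_UNIV top_greatest)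
  hence "finite B" using m4 by (metis card.infinite not_numeral_le_zero)
  hence "finite (UNIV :: 'v set)"
    using card_span_independent[OF vector_space_axioms _ B(1)] B(2) by simp
  thus ?thesis by (rule finite_subset[rotated]) simp
qed

lemma card_sub: "subspace S \<Longrightarrow> card S = q ^ (2 * dim S)"
  using card_subspace[OF vector_space_axioms, of S] card_f by (simp add: power_mult)

lemma dim_eqI: "subspace S \<Longrightarrow> card S = q ^ (2 * n) \<Longrightarrow> dim S = n"
  using card_sub[of S] q2 power_inject_exp[of q "2 * dim S" "2 * n"] by simp

lemma cardV: "card (UNIV :: 'v set) = q ^ (2 * m)"
  using card_sub[OF subspace_UNIV] dimV by simp

lemma exists_nz: "\<exists>x y. \<eta> x y \<noteq> 0"
proof (rule ccontr)
  assume "\<not> ?thesis"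
  hence "x = 0" for x :: 'v using nondeg unfolding nondegenerate_def by blast
  hence "(UNIV::'v set) = {0}" by auto
  hence "card (UNIV::'v set) = card {0::'v}" by (rule arg_cong)
  hence "q ^ (2*m) = 1" using cardV by simp
  thus False using q2 m4 by simp
qed

lemma exists_val: "\<exists>x y. \<eta> x y = c"
proof -
  obtain x y where xy: "\<eta> x y \<noteq> 0" using exists_nz by blast
  have "\<eta> (scale (c / \<eta> x y) x) y = c" using xy by (simp add: hermitian_formD(3)[OF herm])
  thus ?thesis by blast
qed

text \<open>Every scalar is a value of the form, and exchanging the arguments twice returns to it.
  In this way the properties of x -> x^q are read off the form.\<close>

lemma cj_cj [simp]: "((a::'f) ^ q) ^ q = a"
  using exists_val[of a] hermitian_form_sym[OF herm] by metis

text \<open>Additivity in the second argument, applied to multiples of a \<open>y\<close> with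
  \<open>\<eta> x y = 1\<close>, becomes additivity of the q-th power by semilinearity.\<close>

lemma cj_add: "(a + b :: 'f) ^ q = a ^ q + b ^ q"
proof -
  obtain x y where xy: "\<eta> x y = 1" using exists_val by blast
  have "\<eta> x (scale (a + b) y) = \<eta> x (scale a y) + \<eta> x (scale b y)"
    by (simp add: hermitian_formD[OF herm] scale_left_distrib)
  thus ?thesis using xy by (simp add: hermitian_formD[OF herm])
qed

lemma cj_0 [simp]: "(0::'f) ^ q = 0" using q2 by simp

lemma cj_minus: "(- a :: 'f) ^ q = - (a ^ q)"
  using cj_add[of a "- a"] by (simp add: eq_neg_iff_add_eq_0 add.commute)

lemma cj_diff: "(a - b :: 'f) ^ q = a ^ q - b ^ q"
  using cj_add[of a "- b"] by (simp add: cj_minus)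

lemma cj_0_iff [simp]: "(a::'f) ^ q = 0 \<longleftrightarrow> a = 0" using q2 by simp

section \<open>The fixed field F_q, with norm and trace from F_{q^2}\<close>

definition Fq :: "'f set" where "Fq = {c. c ^ q = c}"

text \<open>The norm of F_{q^2} over F_q, written as a power so that its fibres are root sets of one
  polynomial. Rescaling a vector by \<open>a\<close> multiplies its form value by
  \<open>nrm a\<close>.\<close>

definition nrm :: "'f \<Rightarrow> 'f" where "nrm a = a ^ (q + 1)"

lemma nrm_Fq: "nrm a \<in> Fq" 
proof -
  have "(a * a ^ q) ^ q = a ^ q * (a ^ q) ^ q" by (rule power_mult_distrib)
  also have "\<dots> = a * a ^ q" by (simp only: cj_cj mult.commute)
  finally have "nrm a ^ q = nrm a" by (simp only: nrm_def power_add power_one_right mult.commute)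
  thus ?thesis by (simp only: Fq_def mem_Collect_eq)
qed

lemma nrm_0_iff [simp]: "nrm a = 0 \<longleftrightarrow> a = 0" by (auto simp: nrm_def)

lemma card_Fq0_le: "card (Fq - {0}) \<le> q - 1"
proof -
  let ?p = "monom 1 (q - 1) - [:1:] :: 'f poly"
  have nz: "?p \<noteq> 0"
  proof
    assume "?p = 0"
    hence "coeff ?p (q - 1) = 0" by simp
    thus False using q2 by (simp add: coeff_pCons split: nat.splits)
  qed
  have "Fq - {0} \<subseteq> {x. poly ?p x = 0}"
  proof
    fix x assume "x \<in> Fq - {0}"
    hence x: "x ^ q = x" "x \<noteq> 0" by (auto simp: Fq_def)
    moreover have "x ^ (q - 1) * x = x ^ q" using q2 power_minus_mult[of q x] by simp
    ultimately have "x ^ (q - 1) * x = 1 * x" "x \<noteq> 0" by simp_all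
    hence "x ^ (q - 1) = 1" by (metis mult_right_cancel)
    thus "x \<in> {x. poly ?p x = 0}" by (simp add: poly_monom)
  qed
  hence "card (Fq - {0}) \<le> card {x. poly ?p x = 0}" by (intro card_mono) auto
  also have "\<dots> \<le> degree ?p" by (rule card_poly_roots_bound[OF nz])
  also have "\<dots> \<le> q - 1" by (rule degree_diff_le) (auto simp: degree_monom_le)
  finally show ?thesis .
qed

lemma card_nrm_le: "card {a. nrm a = c} \<le> q + 1"
proof -
  let ?p = "monom 1 (q + 1) - [:c:] :: 'f poly"
  have nz: "?p \<noteq> 0"
  proof
    assume "?p = 0"
    hence "coeff ?p (q + 1) = 0" by simp
    thus False by simp
  qed
  have "{a. nrm a = c} \<subseteq> {x. poly ?p x = 0}" by (auto simp: nrm_def poly_monom)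
  hence "card {a. nrm a = c} \<le> card {x. poly ?p x = 0}" by (intro card_mono) auto
  also have "\<dots> \<le> degree ?p" by (rule card_poly_roots_bound[OF nz])
  also have "\<dots> \<le> q + 1" by (rule degree_diff_le) (auto simp: degree_monom_le)
  finally show ?thesis .
qed

lemma card_nz: "card (UNIV - {0::'f}) = (q - 1) * (q + 1)"
  using q2 by (simp add: card_Diff_singleton card_f power2_eq_square algebra_simps)

lemma card_nz_sum: "(q - 1) * (q + 1) = (\<Sum>c\<in>Fq - {0}. card {a. nrm a = c})"
proof -
  have "card (UNIV - {0::'f}) = (\<Sum>c\<in>Fq - {0}. card {a \<in> UNIV - {0}. nrm a = c})"
    using sum.group[of "UNIV - {0::'f}" "Fq - {0}" nrm "\<lambda>_. 1::nat"] nrm_Fq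
    by (simp add: image_subset_iff)
  also have "\<dots> = (\<Sum>c\<in>Fq - {0}. card {a. nrm a = c})"
    by (intro sum.cong refl arg_cong[of _ _ card]) auto
  finally show ?thesis by (simp add: card_nz)
qed

text \<open>A squeeze: the norm splits the (q - 1)(q + 1) nonzero scalars into at most q - 1 classes
  of at most q + 1 elements, so both bounds are attained. \<open>card_nrm\<close> is the other half
  of the same argument.\<close>

lemma card_Fq0: "card (Fq - {0}) = q - 1"
proof -
  have "(\<Sum>c\<in>Fq - {0}. card {a. nrm a = c}) \<le> (\<Sum>c\<in>Fq - {0}. q + 1)"
    by (rule sum_mono) (rule card_nrm_le)
  hence "(q - 1) * (q + 1) \<le> card (Fq - {0}) * (q + 1)" using card_nz_sum by simp
  hence "q - 1 \<le> card (Fq - {0})" by (subst (asm) mult_le_cancel2) auto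
  thus ?thesis using card_Fq0_le by simp
qed

lemma card_nrm: assumes "c \<in> Fq" "c \<noteq> 0" shows "card {a. nrm a = c} = q + 1"
proof (rule ccontr)
  assume "\<not> ?thesis"
  hence lt: "card {a. nrm a = c} < q + 1" using card_nrm_le[of c] by linarith
  have "(\<Sum>c\<in>Fq - {0}. card {a. nrm a = c}) < (\<Sum>c\<in>Fq - {0}. q + 1)"
    by (rule sum_strict_mono_ex1) (use lt assms card_nrm_le in auto)
  thus False using card_nz_sum card_Fq0 by simp
qed

lemma Fq_0: "0 \<in> Fq" by (simp add: Fq_def)

lemma card_Fq: "card Fq = q"
  using card_Fq0 q2 Fq_0 by (simp add: card_Diff_singleton)

lemma exists_nrm: "c \<in> Fq \<Longrightarrow> \<exists>a. nrm a = c"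
proof (cases "c = 0")
  case False assume "c \<in> Fq"
  hence "{a. nrm a = c} \<noteq> {}" using card_nrm[of c] False by force
  thus ?thesis by blast
qed (auto intro: exI[of _ 0])

text \<open>Otherwise the polynomial X^q + X of degree q would have q^2 roots. A scalar of nonzero
  trace takes the place of 1/2 in polarization, so that characteristic two needs no separate
  treatment.\<close>

lemma exists_trace: "\<exists>b::'f. b + b ^ q \<noteq> 0"
proof (rule ccontr)
  assume "\<not> ?thesis"
  hence z: "b + b ^ q = 0" for b :: 'f by blast
  let ?p = "monom 1 q + [:0, 1:] :: 'f poly"
  have nz: "?p \<noteq> 0"
  proof
    assume "?p = 0"
    hence "coeff ?p q = 0" by simp
    thus False using q2 by (auto simp: coeff_pCons split: nat.splits)
  qed
  have "{x. poly ?p x = 0} = UNIV" using z by (auto simp: poly_monom add.commute)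
  hence "q\<^sup>2 \<le> degree ?p" using card_poly_roots_bound[OF nz] card_f by simp
  also have "\<dots> \<le> q" by (rule degree_add_le) (use q2 in \<open>auto simp: degree_monom_le\<close>)
  finally show False using q2 by (simp add: power2_eq_square)
qed

end

section \<open>Counting isotropic vectors\<close>

context hermitian_space
begin

lemma dim_0 [simp]: "dim {0} = 0"
  by (rule dim_eqI) (simp_all add: subspace_single_0)

lemma form0:
  assumes "hermitian_form q scale h"
  shows "h 0 x = 0" "h x 0 = 0"
  using hermitian_formD(3)[OF assms, of 0 0 x] hermitian_formD(4)[OF assms, of x 0 0] by simp_all

lemma form_sum:
  assumes "hermitian_form q scale h"
  shows "h (\<Sum>i\<in>A. z i) x = (\<Sum>i\<in>A. h (z i) x)" "h x (\<Sum>i\<in>A. z i) = (\<Sum>i\<in>A. h x (z i))"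
  by (induction A rule: infinite_finite_induct)
    (simp_all add: hermitian_formD[OF assms] form0[OF assms])

lemma form_minus:
  assumes "hermitian_form q scale h"
  shows "h (- y) x = - h y x" "h x (- y) = - h x y"
  using hermitian_formD(1)[OF assms, of y "- y" x] hermitian_formD(2)[OF assms, of x y "- y"]
  by (simp_all add: form0[OF assms] eq_neg_iff_add_eq_0 add.commute)

lemma form_diff:
  assumes "hermitian_form q scale h"
  shows "h (y - z) x = h y x - h z x" "h x (y - z) = h x y - h x z"
  using hermitian_formD(1)[OF assms, of y "- z" x] hermitian_formD(2)[OF assms, of x y "- z"]
  by (simp_all add: form_minus[OF assms])

lemma form_eq_0_sym: "hermitian_form q scale h \<Longrightarrow> h x y = 0 \<longleftrightarrow> h y x = 0"
  using hermitian_form_sym[of q scale h] cj_0_iff by metis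

lemma form_self_Fq: "hermitian_form q scale h \<Longrightarrow> h x x \<in> Fq"
  using hermitian_form_sym[of q scale h x x] by (simp add: Fq_def)

text \<open>Polarization: if \<open>h x y\<close> were nonzero, \<open>x\<close> could be rescaled
  to some \<open>z\<close> with \<open>h z y = b\<close> of nonzero trace, but isotropy of
  \<open>z + y\<close> forces \<open>b + b ^ q = 0\<close>.\<close>

lemma form_eq_0_of_isotropic:
  assumes h: "hermitian_form q scale h" and U: "subspace U" and iso: "\<And>u. u \<in> U \<Longrightarrow> h u u = 0"
    and x: "x \<in> U" and y: "y \<in> U"
  shows "h x y = 0"
proof (rule ccontr)
  assume c: "h x y \<noteq> 0"
  obtain b :: 'f where b: "b + b ^ q \<noteq> 0" using exists_trace by blast
  define z where "z = scale (b / h x y) x"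
  have z: "z \<in> U" using x U by (simp add: z_def subspace_scale)
  have "h (z + y) (z + y) = 0" using iso z y U by (simp add: subspace_add)
  hence "h z y + h y z = 0"
    using iso[OF z] iso[OF y] by (simp add: hermitian_formD[OF h] add.commute)
  moreover have "h z y = b" using c by (simp add: z_def hermitian_formD[OF h])
  ultimately show False using b hermitian_form_sym[OF h, of y z] by simp
qed

lemma dim_kernel:
  fixes \<phi> :: "'v \<Rightarrow> 'f"
  assumes U: "subspace U" and add: "\<And>x y. \<phi> (x + y) = \<phi> x + \<phi> y"
    and sc: "\<And>c x. \<phi> (scale c x) = c * \<phi> x"
  shows "subspace {x \<in> U. \<phi> x = 0}"
    and "x \<in> U \<Longrightarrow> \<phi> x \<noteq> 0 \<Longrightarrow> dim U = dim {x \<in> U. \<phi> x = 0} + 1"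
proof -
  have p0: "\<phi> 0 = 0" using sc[of 0 0] by simp
  show K: "subspace {x \<in> U. \<phi> x = 0}"
    using U by (auto simp: subspace_def add sc p0)
  assume x: "x \<in> U" "\<phi> x \<noteq> 0"
  have diff: "\<phi> (y - z) = \<phi> y - \<phi> z" for y z
    using add[of "y - z" z] by simp
  have im: "\<phi> ` U = UNIV"
  proof -
    have "c \<in> \<phi> ` U" for c
      using x U by (intro image_eqI[of _ _ "scale (c / \<phi> x) x"]) (auto simp: sc subspace_scale)
    thus ?thesis by blast
  qed
  have "card U = card (\<phi> ` U) * card {x \<in> U. \<phi> x = 0}"
    using U by (intro card_kernel_image) (auto simp: subspace_0 subspace_diff diff)
  also have "\<dots> = q ^ (2 * (dim {x \<in> U. \<phi> x = 0} + 1))"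
    using card_sub[OF K] card_f by (simp add: im power2_eq_square)
  finally show "dim U = dim {x \<in> U. \<phi> x = 0} + 1" by (rule dim_eqI[OF U])
qed

definition rad :: "('v \<Rightarrow> 'v \<Rightarrow> 'f) \<Rightarrow> 'v set \<Rightarrow> 'v set" where
  "rad h U = {x \<in> U. \<forall>y\<in>U. h x y = 0}"

text \<open>Induction on the dimension. If all vectors of \<open>U\<close> are isotropic, the
  radical is \<open>U\<close> and the formula is immediate. Otherwise an anisotropic
  \<open>v\<close> splits off: for \<open>y\<close> orthogonal to \<open>v\<close>, the vector
  \<open>y + scale c v\<close> is isotropic iff \<open>c\<close> has norm
  \<open>- h y y / h v v\<close>, which has one solution for isotropic \<open>y\<close> and q + 1
  solutions otherwise. This yields the recursion N(n + 1) = (q + 1) q^(2n) - q N(n).\<close>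

lemma card_isotropic_vectors:
  assumes h: "hermitian_form q scale h"
  shows "subspace U \<Longrightarrow> int q * int (card {x \<in> U. h x x = 0}) =
    int q ^ (2 * dim U) + (int q - 1) * (- int q) ^ (dim U + dim (rad h U))"
proof (induction "dim U" arbitrary: U)
  case (0 U)
  hence "card U = 1" using card_sub[OF 0(2)] by simp
  moreover have "0 \<in> U" using 0 subspace_0 by blast
  ultimately have U: "U = {0}" by (auto simp: card_1_singleton_iff)
  hence "{x \<in> U. h x x = 0} = {0}" "rad h U = {0}" by (auto simp: rad_def form0[OF h])
  moreover have "dim {0} = 0" using 0(1) U by simp
  ultimately show ?case using U by simp
next
  case (Suc n U)
  note U = Suc.prems
  show ?case
  proof (cases "\<forall>u\<in>U. h u u = 0")
    case True
    hence "{x \<in> U. h x x = 0} = U" "rad h U = U"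
      using form_eq_0_of_isotropic[OF h U] by (auto simp: rad_def)
    moreover have "(- int q) ^ (dim U + dim U) = int q ^ (2 * dim U)"
      by (simp flip: mult_2)
    ultimately show ?thesis by (simp add: card_sub[OF U] algebra_simps)
  next
    case False
    then obtain v where v: "v \<in> U" "h v v \<noteq> 0" by blast
    define U' where "U' = {x \<in> U. h x v = 0}"
    have U': "subspace U'" unfolding U'_def
      by (rule dim_kernel(1)[OF U]) (simp_all add: hermitian_formD[OF h])
    have d: "dim U = dim U' + 1" unfolding U'_def
      by (rule dim_kernel(2)[OF U, where \<phi> = "\<lambda>x. h x v" and x = v])
        (simp_all add: hermitian_formD[OF h] v)
    have proj: "y - scale (h y v / h v v) v \<in> U'" if "y \<in> U" for y
      using that v U unfolding U'_def
      by (simp add: subspace_diff subspace_scale form_diff[OF h] hermitian_formD[OF h])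
    have vU': "h y v = 0" "h v y = 0" if "y \<in> U'" for y
      using that form_eq_0_sym[OF h] by (auto simp: U'_def)
    \<comment> \<open>Since \<open>h v v\<close> is nonzero, splitting off \<open>v\<close> leaves
      the radical alone; its dimension is a constant of the recursion.\<close>
    have "rad h U' = rad h U"
    proof (intro equalityI subsetI)
      fix x assume x: "x \<in> rad h U'"
      have "h x y = 0" if "y \<in> U" for y
      proof -
        have "h x (y - scale (h y v / h v v) v) = 0" using x proj[OF that] by (auto simp: rad_def)
        moreover have "h x v = 0" using x by (auto simp: rad_def U'_def)
        ultimately show ?thesis by (simp add: form_diff[OF h] hermitian_formD[OF h])
      qed
      thus "x \<in> rad h U" using x by (auto simp: rad_def U'_def)
    qed (use v in \<open>auto simp: rad_def U'_def\<close>)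
    define Z where "Z = {x \<in> U. h x x = 0}"
    define Z' where "Z' = {x \<in> U'. h x x = 0}"
    define F where "F y = {c. nrm c = - h y y / h v v}" for y
    have val: "h (y + scale c v) (y + scale c v) = h y y + nrm c * h v v" if "y \<in> U'" for y c
      using vU'[OF that] by (simp add: hermitian_formD[OF h] nrm_def)
    have inF: "c \<in> F y \<longleftrightarrow> h (y + scale c v) (y + scale c v) = 0" if "y \<in> U'" for y c
      using v by (simp add: F_def val[OF that] field_simps eq_neg_iff_add_eq_0 add.commute)
    have "bij_betw (\<lambda>(y, c). y + scale c v) (Sigma U' F) Z"
    proof (rule bij_betw_byWitness[of _ "\<lambda>y. (y - scale (h y v / h v v) v, h y v / h v v)"])
      show "\<forall>a\<in>Sigma U' F. (\<lambda>y. (y - scale (h y v / h v v) v, h y v / h v v)) ((\<lambda>(y, c). y + scale c v) a) = a"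
        using v by (auto simp: hermitian_formD[OF h] vU')
      show "(\<lambda>(y, c). y + scale c v) ` Sigma U' F \<subseteq> Z"
      proof clarify
        fix y c assume y: "y \<in> U'" "c \<in> F y"
        hence "y + scale c v \<in> U" using U v by (simp add: U'_def subspace_add subspace_scale)
        thus "y + scale c v \<in> Z" using inF y by (simp add: Z_def)
      qed
      show "(\<lambda>y. (y - scale (h y v / h v v) v, h y v / h v v)) ` Z \<subseteq> Sigma U' F"
      proof clarify
        fix y assume y: "y \<in> Z"
        hence p: "y - scale (h y v / h v v) v \<in> U'" using proj by (simp add: Z_def)
        moreover have "h y v / h v v \<in> F (y - scale (h y v / h v v) v)"
          using y by (simp add: inF[OF p] Z_def)
        ultimately show "y - scale (h y v / h v v) v \<in> U' \<and> h y v / h v v \<in> F (y - scale (h y v / h v v) v)"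
          by simp
      qed
    qed simp
    hence "card Z = card (Sigma U' F)" by (metis bij_betw_same_card)
    also have "\<dots> = (\<Sum>y\<in>U'. card (F y))" by simp
    also have "\<dots> = (\<Sum>y\<in>U'. if h y y = 0 then 1 else q + 1)"
    proof (rule sum.cong[OF refl])
      fix y assume "y \<in> U'"
      show "card (F y) = (if h y y = 0 then 1 else q + 1)"
      proof (cases "h y y = 0")
        case True
        thus ?thesis by (simp add: F_def)
      next
        case False
        have "- h y y / h v v \<in> Fq"
          using form_self_Fq[OF h, of y] form_self_Fq[OF h, of v]
          by (simp add: Fq_def power_divide cj_minus)
        thus ?thesis using False v card_nrm[of "- h y y / h v v"] by (simp add: F_def)
      qed
    qed
    also have "\<dots> = card Z' + (q + 1) * card (U' - Z')"
    proof -
      have "U' = Z' \<union> (U' - Z')" by (auto simp: Z'_def)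
      hence "(\<Sum>y\<in>U'. if h y y = 0 then 1 else q + 1) =
          (\<Sum>y\<in>Z'. if h y y = 0 then 1 else q + 1) + (\<Sum>y\<in>U' - Z'. if h y y = 0 then 1 else q + 1)"
        by (metis (no_types, lifting) Diff_disjoint finV sum.union_disjoint)
      also have "(\<Sum>y\<in>Z'. if h y y = 0 then 1 else q + 1) = (\<Sum>y\<in>Z'. 1)"
        by (rule sum.cong) (auto simp: Z'_def)
      also have "(\<Sum>y\<in>U' - Z'. if h y y = 0 then 1 else q + 1) = (\<Sum>y\<in>U' - Z'. q + 1)"
        by (rule sum.cong) (auto simp: Z'_def)
      finally show ?thesis by simp
    qed
    also have "int \<dots> = (int q + 1) * int (card U') - int q * int (card Z')"
    proof -
      have "card Z' \<le> card U'" by (rule card_mono) (auto simp: Z'_def)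
      moreover have "card (U' - Z') = card U' - card Z'"
        by (rule card_Diff_subset) (auto simp: Z'_def)
      ultimately have "int (card (U' - Z')) = int (card U') - int (card Z')" by simp
      thus ?thesis by (simp only: of_nat_add of_nat_mult of_nat_1) (simp add: algebra_simps)
    qed
    finally have Z: "int (card Z) = (int q + 1) * int (card U') - int q * int (card Z')" .
    have IH: "int q * int (card Z') =
        int q ^ (2 * dim U') + (int q - 1) * (- int q) ^ (dim U' + dim (rad h U))"
      using Suc.hyps(1)[OF _ U'] Suc.hyps(2) d \<open>rad h U' = rad h U\<close> by (simp add: Z'_def)
    have "int q * int (card Z) = (int q * int q + int q) * int q ^ (2 * dim U')
        - int q * (int q ^ (2 * dim U') + (int q - 1) * (- int q) ^ (dim U' + dim (rad h U)))"
      unfolding Z IH by (simp add: card_sub[OF U'] algebra_simps)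
    also have "\<dots> = int q ^ (2 * dim U) + (int q - 1) * (- int q) ^ (dim U + dim (rad h U))"
      by (simp add: d algebra_simps)
    finally show ?thesis by (simp add: Z_def)
  qed
qed

section \<open>Orthonormal bases and orthogonal complements\<close>

definition perp :: "'v set \<Rightarrow> 'v set" where "perp S = {x. \<forall>y\<in>S. \<eta> x y = 0}"

lemmas hD = hermitian_formD[OF herm] and hS = hermitian_form_sym[OF herm]
  and h0 [simp] = form0[OF herm] and hsum = form_sum[OF herm] and hminus = form_minus[OF herm]
  and hdiff = form_diff[OF herm] and hsym0 = form_eq_0_sym[OF herm]

lemma subspace_perp: "subspace (perp S)"
  by (auto simp: perp_def subspace_def hD)

lemma nondegD: "(\<And>y. \<eta> x y = 0) \<Longrightarrow> x = 0"
  using nondeg by (simp add: nondegenerate_def)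

lemma nondegD': "(\<And>y. \<eta> y x = 0) \<Longrightarrow> x = 0"
  using nondegD hsym0 by blast

text \<open>An orthonormal set of maximal size works. As the norm is onto F_q, an anisotropic vector
  of its complement could be normalized and added, so the complement is totally isotropic. The
  defect \<open>x - p x\<close> is then orthogonal to the complement and to all projections, hence
  zero.\<close>

lemma exists_orthonormal_basis: 
  "\<exists>e :: nat \<Rightarrow> 'v. (\<forall>i<m. \<forall>j<m. \<eta> (e i) (e j) = (if i = j then 1 else 0)) \<and>
     (\<forall>x. x = (\<Sum>i<m. scale (\<eta> x (e i)) (e i)))"
proof -
  define P where "P B \<longleftrightarrow> (\<forall>x\<in>B. \<forall>y\<in>B. \<eta> x y = (if x = y then 1 else 0))" for B
  have "P {}" by (simp add: P_def)
  moreover have "card B < Suc (card (UNIV :: 'v set))" for B :: "'v set"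
    by (simp add: card_mono le_imp_less_Suc)
  ultimately obtain B where B: "P B" "\<And>B'. P B' \<Longrightarrow> card B' \<le> card B"
    using ex_has_greatest_nat[of P "{}" card "Suc (card (UNIV :: 'v set))"] by (metis less_imp_le)
  have on: "\<eta> x y = (if x = y then 1 else 0)" if "x \<in> B" "y \<in> B" for x y
    using B(1) that by (simp add: P_def)
  have iso: "\<eta> u u = 0" if u: "u \<in> perp B" for u
  proof (rule ccontr)
    assume nz: "\<eta> u u \<noteq> 0"
    have "inverse (\<eta> u u) \<in> Fq"
      using form_self_Fq[OF herm, of u] by (simp add: Fq_def power_inverse)
    then obtain c where c: "nrm c = inverse (\<eta> u u)" using exists_nrm by blast
    define w where "w = scale c u"
    have "\<eta> w w = nrm c * \<eta> u u" by (simp add: w_def hD nrm_def)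
    hence ww: "\<eta> w w = 1" using c nz by simp
    have wB: "\<eta> w b = 0" "\<eta> b w = 0" if "b \<in> B" for b
      using u that hsym0 by (auto simp: w_def hD perp_def)
    have "w \<notin> B" using ww wB by fastforce
    moreover have "P (insert w B)"
      using ww wB on \<open>w \<notin> B\<close> by (auto simp: P_def)
    ultimately show False using B(2)[of "insert w B"] by simp
  qed
  have z: "\<eta> x y = 0" if "x \<in> perp B" "y \<in> perp B" for x y
    by (rule form_eq_0_of_isotropic[OF herm subspace_perp iso that])
  define p where "p x = (\<Sum>b\<in>B. scale (\<eta> x b) b)" for x
  have pB: "\<eta> (p x) b = \<eta> x b" if "b \<in> B" for x b
  proof -
    have "\<eta> (p x) b = (\<Sum>b'\<in>B. if b' = b then \<eta> x b' else 0)"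
      unfolding p_def hsum by (rule sum.cong) (auto simp: hD on that)
    thus ?thesis using that by (simp add: sum.delta)
  qed
  have perp: "x - p x \<in> perp B" for x by (simp add: perp_def hdiff pB)
  have pz: "\<eta> u (p y) = 0" if "u \<in> perp B" for u y
    using that unfolding p_def hsum by (intro sum.neutral) (auto simp: hD perp_def)
  have x: "x = p x" for x
  proof -
    have "\<eta> (x - p x) y = 0" for y
      using z[OF perp perp, of x y] pz[OF perp, of x y] by (simp add: hdiff(2))
    hence "x - p x = 0" by (rule nondegD)
    thus ?thesis by simp
  qed
  have "x \<in> span B" for x
    by (subst x, unfold p_def) (intro span_sum span_scale span_base)
  hence "span B = UNIV" by blast
  moreover have "independent B"
  proof
    assume "dependent B"
    then obtain u v where uv: "v \<in> B" "u v \<noteq> 0" "(\<Sum>b\<in>B. scale (u b) b) = 0"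
      using dependent_finite[of B] by auto
    have "0 = \<eta> (\<Sum>b\<in>B. scale (u b) b) v" by (simp add: uv)
    also have "\<dots> = (\<Sum>b\<in>B. if b = v then u b else 0)"
      unfolding hsum by (rule sum.cong) (auto simp: hD on uv)
    also have "\<dots> = u v" using uv by (simp add: sum.delta)
    finally show False using uv by simp
  qed
  ultimately have "card B = m" using dimV dim_eq_card[of B UNIV] by simp
  then obtain e :: "nat \<Rightarrow> 'v" where e: "bij_betw e {..<m} B"
    using ex_bij_betw_nat_finite[of B] by (auto simp: atLeast0LessThan)
  have "\<eta> (e i) (e j) = (if i = j then 1 else 0)" if "i < m" "j < m" for i j
    using e that on[of "e i" "e j"] by (auto simp: bij_betw_def inj_on_def)
  moreover have "x = (\<Sum>i<m. scale (\<eta> x (e i)) (e i))" for x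
    using x[of x] sum.reindex_bij_betw[OF e, of "\<lambda>b. scale (\<eta> x b) b"] by (simp add: p_def)
  ultimately show ?thesis by blast
qed

lemma perp_span: "perp (span S) = perp S"
proof (intro equalityI subsetI)
  fix x assume x: "x \<in> perp S"
  have "\<eta> x y = 0" if "y \<in> span S" for y
    using that by (induction rule: span_induct_alt) (use x in \<open>auto simp: hD perp_def\<close>)
  thus "x \<in> perp (span S)" by (simp add: perp_def)
qed (auto simp: perp_def span_base)

lemma dim_perp_insert: "dim (perp S) \<le> dim (perp (insert t S)) + 1"
proof -
  have eq: "perp (insert t S) = {x \<in> perp S. \<eta> x t = 0}" by (auto simp: perp_def)
  show ?thesis
  proof (cases "\<exists>x\<in>perp S. \<eta> x t \<noteq> 0")
    case True
    then obtain x where "x \<in> perp S" "\<eta> x t \<noteq> 0" by blast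
    thus ?thesis unfolding eq
      using dim_kernel(2)[OF subspace_perp, of "\<lambda>x. \<eta> x t" x S] by (simp add: hD)
  next
    case False
    hence "{x \<in> perp S. \<eta> x t = 0} = perp S" by blast
    thus ?thesis unfolding eq by simp
  qed
qed

lemma dim_perp_Un: "dim (perp S) \<le> dim (perp (S \<union> T)) + card T"
proof -
  have "finite T" by simp
  thus ?thesis
  proof (induction T rule: finite_induct)
    case (insert t T)
    thus ?case using dim_perp_insert[of "S \<union> T" t] by simp
  qed simp
qed

text \<open>A squeeze: extending \<open>S\<close> to a basis leads from dimension m at the empty set
  down to 0 in m steps that each lose at most one, so every step loses exactly one.\<close>

lemma dim_perp_independent: assumes "independent S" shows "dim (perp S) + card S = m"
proof -
  obtain B where B: "S \<subseteq> B" "independent B" "UNIV \<subseteq> span B"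
    using maximal_independent_subset_extend[of S UNIV] assms by auto
  hence "span B = UNIV" by blast
  hence cB: "card B = m" using dimV dim_eq_card[of B UNIV] B by simp
  have "perp {} = UNIV" by (simp add: perp_def)
  hence 1: "m \<le> dim (perp S) + card S" using dim_perp_Un[of "{}" S] dimV by simp
  have "perp B = perp UNIV" using perp_span[of B] B by (simp add: top.extremum_unique)
  also have "\<dots> = {0}" using nondegD by (auto simp: perp_def)
  finally have "dim (perp B) = 0" by simp
  moreover have "S \<union> (B - S) = B" using B by auto
  moreover have "card (B - S) = card B - card S" using B by (simp add: card_Diff_subset)
  moreover have "card S \<le> card B" using B by (simp add: card_mono)
  ultimately have "dim (perp S) + card S \<le> m" using dim_perp_Un[of S "B - S"] cB by simp
  thus ?thesis using 1 by simp
qed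

lemma dim_perp: assumes "subspace U" shows "dim (perp U) + dim U = m"
proof -
  obtain B where B: "B \<subseteq> U" "independent B" "U \<subseteq> span B" "card B = dim U"
    using basis_exists[of U] by blast
  have "span B = U" using B assms by (simp add: span_subspace)
  thus ?thesis using dim_perp_independent[OF B(2)] perp_span[of B] B by simp
qed

lemma subspace_eqI: "subspace A \<Longrightarrow> subspace B \<Longrightarrow> A \<subseteq> B \<Longrightarrow> dim A = dim B \<Longrightarrow> A = B"
  by (rule card_subset_eq) (simp_all add: card_sub)

lemma perp_perp: assumes "subspace U" shows "perp (perp U) = U"
proof (rule subspace_eqI[symmetric])
  show "U \<subseteq> perp (perp U)" using hsym0 by (auto simp: perp_def)
  show "dim U = dim (perp (perp U))"
    using dim_perp[OF assms] dim_perp[OF subspace_perp, of U] by simp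
qed (simp_all add: assms subspace_perp)

lemma rad_eta: "rad \<eta> U = U \<inter> perp U" by (auto simp: rad_def perp_def)

end

section \<open>Isotropic pairs and the pencil of an alternating form\<close>

lemma span_pair_iff:
  fixes scale :: "'f::field \<Rightarrow> 'v::ab_group_add \<Rightarrow> 'v"
  assumes "vector_space scale"
  shows "z \<in> module.span scale {x, y} \<longleftrightarrow> (\<exists>a b. z = scale a x + scale b y)"
proof -
  interpret vector_space scale by fact
  have "z \<in> span {x, y} \<longleftrightarrow> (\<exists>a b. z - scale a x = scale b y)"
    by (auto simp: span_insert)
  thus ?thesis by (simp add: diff_eq_eq add.commute)
qed

context hermitian_space
begin

definition iso :: "'v set" where "iso = {x. \<eta> x x = 0}"

lemma perp_UNIV: "perp UNIV = {0}"
  using nondegD by (auto simp: perp_def)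

lemma card_iso: "int q * int (card iso) = int q ^ (2 * m) + (int q - 1) * (- int q) ^ m"
proof -
  have "rad \<eta> UNIV = {0}" by (simp add: rad_eta perp_UNIV)
  thus ?thesis using card_isotropic_vectors[OF herm subspace_UNIV] by (simp add: dimV iso_def)
qed

lemma card_Diff_int:
  "A \<subseteq> (C :: 'v set) \<Longrightarrow> int (card (C - A)) = int (card C) - int (card A)"
  using card_mono[OF finV, of A C] by (simp add: card_Diff_subset of_nat_diff)

lemma zero_iso: "0 \<in> iso" by (simp add: iso_def)

lemma card_iso0: "int (card (iso - {0})) = int (card iso) - 1"
proof -
  have "card iso \<ge> 1" using zero_iso by (metis One_nat_def Suc_leI card_gt_0_iff empty_iff finV)
  thus ?thesis using zero_iso by (simp add: card_Diff_singleton of_nat_diff)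
qed

lemma independent_pair_iff: "x \<noteq> 0 \<Longrightarrow> z \<notin> span {x} \<Longrightarrow> independent {x, z}"
  using independent_insert[of z "{x}"] by (auto simp: insert_commute independent_insert)

lemma dim_span1: "x \<noteq> 0 \<Longrightarrow> dim (span {x}) = 1"
  using dim_span_eq_card_independent[of "{x}"] by (simp add: independent_insert)

lemma dim_span2: assumes "x \<noteq> 0" "z \<notin> span {x}" shows "dim (span {x, z}) = 2"
proof -
  have "x \<noteq> z" using assms by (auto simp: span_base)
  thus ?thesis using dim_span_eq_card_independent[OF independent_pair_iff[OF assms]] by simp
qed

text \<open>The powers of \<open>q\<close> on the left-hand sides below keep truncated differences out of the exponents
  on the right.\<close>

lemma card_iso_perp:
  assumes x: "x \<in> iso" "x \<noteq> 0"
  shows "int q ^ 3 * int (card (iso \<inter> perp {x})) = int q ^ (2 * m) + (int q)\<^sup>2 * (int q - 1) * (- int q) ^ m"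
proof -
  let ?U = "perp {x}"
  have pp: "perp ?U = span {x}" using perp_perp[of "span {x}"] perp_span[of "{x}"] by simp
  have "span {x} \<subseteq> ?U" using x subspace_perp[of "{x}"]
    by (intro span_minimal) (auto simp: perp_def iso_def)
  hence "rad \<eta> ?U = span {x}" by (auto simp: rad_eta pp)
  hence r: "dim (rad \<eta> ?U) = 1" using dim_span1[OF x(2)] by simp
  have "dim ?U + 1 = m" using dim_perp[of "span {x}"] dim_span1[OF x(2)] perp_span[of "{x}"] by simp
  then obtain n where n: "m = Suc n" "dim ?U = n" by simp
  have "int q * int (card {y \<in> ?U. \<eta> y y = 0}) = int q ^ (2 * n) + (int q - 1) * (- int q) ^ m"
    using card_isotropic_vectors[OF herm subspace_perp, of "{x}"] by (simp add: r n)
  moreover have "{y \<in> ?U. \<eta> y y = 0} = iso \<inter> ?U" by (auto simp: iso_def)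
  ultimately have "int q * int (card (iso \<inter> ?U)) = int q ^ (2 * n) + (int q - 1) * (- int q) ^ m"
    by simp
  hence "(int q)\<^sup>2 * (int q * int (card (iso \<inter> ?U))) =
      (int q)\<^sup>2 * (int q ^ (2 * n) + (int q - 1) * (- int q) ^ m)" by simp
  thus ?thesis by (simp add: n(1) power2_eq_square power3_eq_cube algebra_simps)
qed

text \<open>The radical of \<open>\<eta>\<close> on \<open>perp {x, z}\<close> is the intersection
  with \<open>span {x, z}\<close>: the whole plane if \<open>z\<close> is isotropic, only
  \<open>span {x}\<close> otherwise. With \<open>z = f x\<close> this is how the isotropy of
  \<open>f x\<close> enters the weight.\<close>

lemma card_iso_perp2:
  assumes x: "x \<in> iso" "x \<noteq> 0" and z: "z \<notin> span {x}" "\<eta> z x = 0"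
  shows "int q ^ 5 * int (card (iso \<inter> perp {x, z})) = int q ^ (2 * m) +
    int q ^ 4 * (int q - 1) * (- int q) ^ (if z \<in> iso then m else m - 1)"
proof -
  let ?U = "perp {x, z}"
  have xz: "\<eta> x x = 0" "\<eta> x z = 0" "\<eta> z x = 0" using x z hsym0 by (auto simp: iso_def)
  have pp: "perp ?U = span {x, z}" using perp_perp[of "span {x, z}"] perp_span[of "{x, z}"] by simp
  have r: "dim (rad \<eta> ?U) = (if z \<in> iso then 2 else 1)"
  proof (cases "z \<in> iso")
    case True
    hence "span {x, z} \<subseteq> ?U" using xz subspace_perp[of "{x, z}"]
      by (intro span_minimal) (auto simp: perp_def iso_def)
    hence "rad \<eta> ?U = span {x, z}" by (auto simp: rad_eta pp)
    thus ?thesis using True dim_span2[OF x(2) z(1)] by simp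
  next
    case False
    have "?U \<inter> span {x, z} = span {x}"
    proof (intro equalityI subsetI)
      fix y assume y: "y \<in> ?U \<inter> span {x, z}"
      then obtain a b where ab: "y = scale a x + scale b z"
        using span_pair_iff[OF vector_space_axioms] by blast
      have "\<eta> y z = 0" using y by (simp add: perp_def)
      hence "b * \<eta> z z = 0" using xz by (simp add: ab hD)
      hence "b = 0" using False by (simp add: iso_def)
      thus "y \<in> span {x}" by (simp add: ab span_base span_scale)
    next
      fix y assume "y \<in> span {x}"
      then obtain a where "y = scale a x" by (auto simp: span_singleton)
      thus "y \<in> ?U \<inter> span {x, z}" using xz by (simp add: perp_def hD span_base span_scale)
    qed
    thus ?thesis using False dim_span1[OF x(2)] by (simp add: rad_eta pp)
  qed
  have "dim ?U + 2 = m"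
    using dim_perp[of "span {x, z}"] dim_span2[OF x(2) z(1)] perp_span[of "{x, z}"] by simp
  then obtain n where n: "m = Suc (Suc n)" "dim ?U = n" by simp
  have "int q * int (card {y \<in> ?U. \<eta> y y = 0}) =
      int q ^ (2 * n) + (int q - 1) * (- int q) ^ (if z \<in> iso then m else m - 1)"
    using card_isotropic_vectors[OF herm subspace_perp, of "{x, z}"] by (simp add: r n)
  moreover have "{y \<in> ?U. \<eta> y y = 0} = iso \<inter> ?U" by (auto simp: iso_def)
  ultimately have "int q ^ 4 * (int q * int (card (iso \<inter> ?U))) =
      int q ^ 4 * (int q ^ (2 * n) + (int q - 1) * (- int q) ^ (if z \<in> iso then m else m - 1))"
    by simp
  moreover have "int q ^ 4 * int q ^ (2 * n) = int q ^ (2 * m)"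
    unfolding n(1) power_add[symmetric] by (rule arg_cong[of _ _ "power (int q)"]) simp
  moreover have "int q ^ 4 * int q = int q ^ 5" by (simp add: eval_nat_numeral)
  ultimately show ?thesis by (simp only: distrib_left mult.assoc[symmetric])
qed

lemma card_Sigma_int: "finite A \<Longrightarrow> int (card (Sigma A (F :: 'v \<Rightarrow> 'v set))) = (\<Sum>x\<in>A. int (card (F x)))"
  by simp

text \<open>The pairs are the ordered bases of the totally isotropic lines. Once \<open>x\<close> is
  chosen, the number of possible \<open>y\<close> is that of the isotropic vectors of
  \<open>perp {x}\<close> minus the q^2 vectors of \<open>span {x}\<close>, and it does not depend
  on \<open>x\<close>.\<close>

lemma card_isotropic_pairs:
  "int q ^ 4 * int (card {(x, y). x \<in> iso \<and> y \<in> iso \<and> \<eta> y x = 0 \<and> x \<noteq> 0 \<and> y \<notin> span {x}}) =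
   (int q ^ (2 * m) + (int q - 1) * (- int q) ^ m - int q) *
   (int q ^ (2 * m) + (int q)\<^sup>2 * (int q - 1) * (- int q) ^ m - int q ^ 5)"
proof -
  let ?A = "int q ^ (2 * m) + (int q)\<^sup>2 * (int q - 1) * (- int q) ^ m - int q ^ 5"
  have eq: "{(x, y). x \<in> iso \<and> y \<in> iso \<and> \<eta> y x = 0 \<and> x \<noteq> 0 \<and> y \<notin> span {x}} =
      Sigma (iso - {0}) (\<lambda>x. iso \<inter> perp {x} - span {x})"
    by (auto simp: perp_def)
  have c: "int q ^ 3 * int (card (iso \<inter> perp {x} - span {x})) = ?A" if x: "x \<in> iso - {0}" for x
  proof -
    have sub: "span {x} \<subseteq> iso \<inter> perp {x}"
      using x by (auto simp: iso_def perp_def span_singleton hD)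
    have "card (span {x}) = q\<^sup>2" using card_sub[of "span {x}"] dim_span1[of x] x by simp
    hence "int (card (iso \<inter> perp {x} - span {x})) = int (card (iso \<inter> perp {x})) - (int q)\<^sup>2"
      using card_Diff_int[OF sub] by simp
    moreover have "int q ^ 3 * (int q)\<^sup>2 = int q ^ 5" by (simp add: eval_nat_numeral)
    ultimately show ?thesis using card_iso_perp[of x] x by (simp add: right_diff_distrib)
  qed
  have "int q ^ 4 * int (card {(x, y). x \<in> iso \<and> y \<in> iso \<and> \<eta> y x = 0 \<and> x \<noteq> 0 \<and> y \<notin> span {x}}) =
      int q * (\<Sum>x\<in>iso - {0}. int q ^ 3 * int (card (iso \<inter> perp {x} - span {x})))"
    unfolding eq card_Sigma_int[OF finV] sum_distrib_left
    by (rule sum.cong) (auto simp: eval_nat_numeral mult.assoc)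
  also have "\<dots> = int q * (\<Sum>x\<in>iso - {0}. ?A)"
    by (intro arg_cong[of _ _ "\<lambda>s. int q * s"] sum.cong refl c)
  also have "\<dots> = (int q * int (card iso) - int q) * ?A"
    unfolding sum_constant card_iso0 by (simp only: algebra_simps)
  finally show ?thesis by (simp only: card_iso)
qed

end

text \<open>As \<open>\<eta>\<close> is semilinear in its second argument, \<open>f\<close> has to
  be semilinear for \<open>\<eta> y (f x)\<close> to be bilinear in x and y; the last assumption
  makes this form alternating.\<close>

locale alternating_map = hermitian_space +
  fixes f :: "'b \<Rightarrow> 'b"
  assumes f_add: "f (x + y) = f x + f y" and f_scale: "f (scale c x) = scale (c ^ q) (f x)"
    and f_alt: "\<eta> x (f x) = 0"
begin

lemma f_anti: "\<eta> y (f x) = - \<eta> x (f y)"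
proof -
  have "\<eta> (x + y) (f (x + y)) = \<eta> x (f y) + \<eta> y (f x)"
    unfolding f_add hD f_alt by simp
  thus ?thesis using f_alt[of "x + y"] by (simp add: eq_neg_iff_add_eq_0 add.commute)
qed

lemma f_0 [simp]: "f 0 = 0" using f_scale[of 0 0] by simp

lemma f_minus: "f (- x) = - f x"
  using f_add[of x "- x"] by (simp add: eq_neg_iff_add_eq_0 add.commute)

lemma f_diff: "f (x - y) = f x - f y"
  using f_add[of x "- y"] by (simp add: f_minus)

text \<open>The arguments are exchanged on the right because \<open>f\<close> is semilinear: only so
  is \<open>\<theta>\<close> linear in its first argument, like \<open>\<eta>\<close>.\<close>

definition \<theta> :: "'b \<Rightarrow> 'b \<Rightarrow> 'a" where "\<theta> x y = \<eta> (f y) (f x)"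

lemma \<theta>_eq: "\<theta> x y = - \<eta> x (f (f y))"
  unfolding \<theta>_def by (rule f_anti)

text \<open>The sign comes from \<open>\<theta>_eq\<close>: with respect to \<open>\<eta>\<close>,
  the form \<open>\<theta>\<close> is represented by the linear map
  \<open>- f \<circ> f\<close>.\<close>

definition E :: "'a \<Rightarrow> 'b set" where "E c = {x. - f (f x) = scale c x}"

definition d :: "'a \<Rightarrow> nat" where "d c = dim (E c)"

lemma subspace_E: "subspace (E c)"
proof (rule subspaceI)
  fix a x assume "x \<in> E c"
  hence "scale a (- f (f x)) = scale a (scale c x)" by (simp add: E_def)
  thus "scale a x \<in> E c" by (simp add: E_def f_scale mult.commute)
next
  fix x y assume "x \<in> E c" "y \<in> E c"
  hence "- f (f x) + - f (f y) = scale c x + scale c y" by (simp add: E_def)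
  thus "x + y \<in> E c" by (simp add: E_def f_add scale_right_distrib)
qed (simp add: E_def)

lemma pencil_form:
  assumes "c \<in> Fq" shows "hermitian_form q scale (\<lambda>x y. \<theta> x y - c * \<eta> x y)"
proof -
  have c: "c ^ q = c" using assms by (simp add: Fq_def)
  have sym: "\<theta> y x - c * \<eta> y x = (\<theta> x y - c * \<eta> x y) ^ q" for x y
    unfolding cj_diff power_mult_distrib c \<theta>_def hS[symmetric] by (rule refl)
  show ?thesis unfolding hermitian_form_def
    by (intro conjI allI sym) (simp_all add: \<theta>_def f_add f_scale hD algebra_simps)
qed

text \<open>Hermitian symmetry moves \<open>x\<close> into the second argument, and there the
  condition says that \<open>- f (f x) - scale c x\<close> is orthogonal to every vector. Both the
  symmetry and pulling \<open>c\<close> inside rely on \<open>c ^ q = c\<close>.\<close>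

lemma rad_pencil:
  assumes "c \<in> Fq" shows "rad (\<lambda>x y. \<theta> x y - c * \<eta> x y) UNIV = E c"
proof -
  have c: "c ^ q = c" using assms by (simp add: Fq_def)
  have "(\<forall>y. \<theta> x y - c * \<eta> x y = 0) \<longleftrightarrow> (\<forall>y. \<eta> y (- f (f x) - scale c x) = 0)" for x
  proof -
    have "\<theta> x y - c * \<eta> x y = 0 \<longleftrightarrow> \<theta> y x - c * \<eta> y x = 0" for y
      by (rule form_eq_0_sym[OF pencil_form[OF assms]])
    moreover have "\<theta> y x - c * \<eta> y x = \<eta> y (- f (f x) - scale c x)" for y
      unfolding \<theta>_eq by (simp add: hdiff hminus hD c)
    ultimately show ?thesis by (simp only:)
  qed
  moreover have "(\<forall>y. \<eta> y z = 0) \<longleftrightarrow> z = 0" for z using nondegD' by auto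
  ultimately show ?thesis by (auto simp: rad_def E_def)
qed

lemma card_pencil_member:
  assumes "c \<in> Fq"
  shows "int q * int (card {x. \<theta> x x = c * \<eta> x x}) =
    int q ^ (2 * m) + (int q - 1) * (- int q) ^ (m + d c)"
  using card_isotropic_vectors[OF pencil_form[OF assms] subspace_UNIV]
  by (simp add: dimV d_def rad_pencil[OF assms])

definition B :: "'b set" where "B = {x \<in> iso. f x \<notin> iso}"

text \<open>Double count of the incidences of vectors with members of the pencil. An isotropic
  \<open>x\<close> lies on all q members if \<open>f x\<close> is isotropic and on none if not; an
  anisotropic \<open>x\<close> lies on exactly one, given by the quotient of its two form
  values.\<close>

lemma pencil_count:
  "(\<Sum>c\<in>Fq. card {x. \<theta> x x = c * \<eta> x x}) = q * card (iso - B) + card (- iso)"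
proof -
  let ?k = "\<lambda>x. if x \<in> iso - B then q else if x \<in> iso then 0 else 1"
  have "(\<Sum>c\<in>Fq. card {x \<in> UNIV. \<theta> x x = c * \<eta> x x}) = sum ?k UNIV"
  proof (rule sum_multicount_gen)
    show "\<forall>x\<in>UNIV. card {c \<in> Fq. \<theta> x x = c * \<eta> x x} = ?k x"
    proof
      fix x
      have B: "x \<in> B \<longleftrightarrow> x \<in> iso \<and> \<theta> x x \<noteq> 0" by (auto simp: B_def iso_def \<theta>_def)
      show "card {c \<in> Fq. \<theta> x x = c * \<eta> x x} = ?k x"
      proof (cases "x \<in> iso")
        case True
        hence "\<eta> x x = 0" by (simp add: iso_def)
        thus ?thesis using True card_Fq by (auto simp: B)
      next
        case False
        hence nz: "\<eta> x x \<noteq> 0" by (simp add: iso_def)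
        have "\<theta> x x / \<eta> x x \<in> Fq"
          using form_self_Fq[OF herm, of x] form_self_Fq[OF herm, of "f x"]
          by (simp add: Fq_def power_divide \<theta>_def)
        hence "{c \<in> Fq. \<theta> x x = c * \<eta> x x} = {\<theta> x x / \<eta> x x}" using nz by (auto simp: field_simps)
        thus ?thesis using False by simp
      qed
    qed
  qed simp_all
  also have "sum ?k UNIV = sum ?k (iso - B) + sum ?k (- (iso - B))"
    using sum.union_disjoint[of "iso - B" "- (iso - B)" ?k] by (simp only: finV Compl_disjoint Compl_partition)
  also have "sum ?k (iso - B) = q * card (iso - B)" by (simp add: mult.commute)
  also have "sum ?k (- (iso - B)) = sum ?k (- iso)"
    by (rule sum.mono_neutral_right) auto
  also have "sum ?k (- iso) = (\<Sum>x\<in>- iso. 1)" by (rule sum.cong) auto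
  finally show ?thesis by simp
qed

text \<open>With the sizes from \<open>card_pencil_member\<close>, \<open>pencil_count\<close> is a
  linear equation whose only unknown is the size of \<open>B\<close>.\<close>

lemma card_B:
  "(int q)\<^sup>2 * int (card B) =
    (int q - 1) * (int q ^ (2 * m) + (int q - 1) * (- int q) ^ m - (- int q) ^ m * (\<Sum>c\<in>Fq. (- int q) ^ d c))"
proof -
  have Bi: "B \<subseteq> iso" by (auto simp: B_def)
  have 1: "int (card (iso - B)) = int (card iso) - int (card B)"
    by (rule card_Diff_int[OF Bi])
  have 2: "int (card (- iso)) = int q ^ (2 * m) - int (card iso)"
    using card_Diff_int[of iso UNIV] by (simp add: Compl_eq_Diff_UNIV cardV)
  have "(\<Sum>c\<in>Fq. int q * int (card {x. \<theta> x x = c * \<eta> x x})) =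
      (\<Sum>c\<in>Fq. int q ^ (2 * m) + (int q - 1) * (- int q) ^ (m + d c))"
    by (rule sum.cong[OF refl]) (rule card_pencil_member)
  also have "\<dots> = int q * int q ^ (2 * m) + (int q - 1) * (- int q) ^ m * (\<Sum>c\<in>Fq. (- int q) ^ d c)"
    by (simp add: sum.distrib card_Fq sum_distrib_left power_add mult.assoc)
  also have "(\<Sum>c\<in>Fq. int q * int (card {x. \<theta> x x = c * \<eta> x x})) =
      int q * int (\<Sum>c\<in>Fq. card {x. \<theta> x x = c * \<eta> x x})"
    by (simp add: sum_distrib_left)
  also have "\<dots> = int q * (int q * (int (card iso) - int (card B)) + int q ^ (2 * m) - int (card iso))"
    unfolding pencil_count by (simp add: 1 2)
  finally have "(int q)\<^sup>2 * int (card B) = (int q - 1) * (int q * int (card iso))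
      - (int q - 1) * (- int q) ^ m * (\<Sum>c\<in>Fq. (- int q) ^ d c)"
    by (simp add: power2_eq_square algebra_simps)
  thus ?thesis unfolding card_iso by (simp add: algebra_simps)
qed

end

section \<open>Eigenspaces and the weight formula\<close>

context hermitian_space
begin

lemma dim_mono: assumes "subspace S" "subspace T" "S \<subseteq> T" shows "dim S \<le> dim T"
  using card_mono[OF finV assms(3)] q2 by (simp add: card_sub assms)

end

context alternating_map
begin

text \<open>For nonzero \<open>a\<close>, a nonzero vector of this set stays in it only under
  scalars from \<open>Fq\<close>, because \<open>f\<close> is semilinear. The set is therefore
  treated as an additive group and measured by its cardinality.\<close>

definition K :: "'a \<Rightarrow> 'b set" where "K a = {x. f x = scale a x}"

lemma K_diff: "x \<in> K a \<Longrightarrow> y \<in> K a \<Longrightarrow> x - y \<in> K a"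
  by (simp add: K_def f_diff scale_right_diff_distrib)

lemma K_0: "0 \<in> K a" by (simp add: K_def)

lemma f_f_K: "x \<in> K a \<Longrightarrow> - f (f x) = scale (- nrm a) x"
  by (simp add: K_def f_scale nrm_def mult.commute)

lemma K_subset_E: "K a \<subseteq> E (- nrm a)"
  using f_f_K by (auto simp: E_def)

lemma K_iso: assumes "a \<noteq> 0" "x \<in> K a" shows "x \<in> iso"
proof -
  have "a ^ q * \<eta> x x = 0" using f_alt[of x] assms by (simp add: K_def hD)
  thus ?thesis using assms by (simp add: iso_def)
qed

lemma exists_not_Fq: "\<exists>w. w \<notin> Fq"
proof (rule ccontr)
  assume "\<not> ?thesis"
  hence "Fq = UNIV" by blast
  hence "q = q\<^sup>2" using card_Fq card_f by simp
  thus False using q2 by (simp add: power2_eq_square)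
qed

text \<open>For \<open>w\<close> outside \<open>Fq\<close>, multiplication by \<open>w\<close> moves
  every nonzero vector of \<open>K a\<close> out of \<open>K a\<close>. Hence the pairs of vectors
  of \<open>K a\<close> embed into the eigenspace by \<open>x + scale w y\<close>.\<close>

lemma card_K_sq_le: assumes "a \<noteq> 0" shows "(card (K a))\<^sup>2 \<le> card (E (- nrm a))"
proof -
  obtain w where w: "w \<notin> Fq" using exists_not_Fq by blast
  have z: "y = 0" if "x \<in> K a" "y \<in> K a" "x + scale w y = 0" for x y
  proof -
    have x: "x = - scale w y" using that(3) by (simp add: eq_neg_iff_add_eq_0)
    have "f x = - scale (w ^ q) (f y)" by (simp add: x f_minus f_scale)
    hence "scale a x = - scale (w ^ q) (scale a y)" using that by (simp add: K_def)
    hence "scale (a * w) y = scale (w ^ q * a) y" by (simp add: x)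
    hence "a * w = w ^ q * a \<or> y = 0" by (simp only: scale_cancel_right)
    thus ?thesis using w assms by (auto simp: Fq_def mult.commute)
  qed
  have "inj_on (\<lambda>(x, y). x + scale w y) (K a \<times> K a)"
  proof (rule inj_onI, clarify)
    fix x y x' y' assume x: "x \<in> K a" "y \<in> K a" "x' \<in> K a" "y' \<in> K a"
      and e: "x + scale w y = x' + scale w y'"
    have "(x - x') + scale w (y - y') = (x + scale w y) - (x' + scale w y')"
      by (simp add: scale_right_diff_distrib)
    hence "(x - x') + scale w (y - y') = 0" by (simp add: e)
    hence "y - y' = 0" using z[of "x - x'" "y - y'"] x by (simp add: K_diff)
    thus "x = x' \<and> y = y'" using e by simp
  qed
  moreover have "(\<lambda>(x, y). x + scale w y) ` (K a \<times> K a) \<subseteq> E (- nrm a)"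
    using K_subset_E[of a] subspace_E[of "- nrm a"]
    by (auto intro!: subspace_add subspace_scale)
  ultimately have "card (K a \<times> K a) \<le> card (E (- nrm a))"
    by (intro card_inj_on_le) auto
  thus ?thesis by (simp add: card_cartesian_product power2_eq_square)
qed

text \<open>Galois descent: on the eigenspace the map \<open>x \<mapsto> f x + a\<^sup>q x\<close> takes values in
  \<open>K a\<close> and has kernel inside \<open>K (- a\<^sup>q)\<close>, and both of these are at most of square root size.\<close>

lemma card_K: assumes "a \<noteq> 0" shows "card (K a) = q ^ d (- nrm a)"
proof -
  let ?E = "E (- nrm a)" and ?b = "- (a ^ q)"
  have nb: "nrm ?b = nrm a"
    by (simp add: nrm_def cj_minus mult.commute)
  define p where "p x = f x + scale (a ^ q) x" for x
  have pK: "p x \<in> K a" if "x \<in> ?E" for x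
  proof -
    have "f (f x) = scale (nrm a) x" using that by (simp add: E_def)
    thus ?thesis by (simp add: K_def p_def f_add f_scale scale_right_distrib nrm_def add.commute)
  qed
  have "card ?E = card (p ` ?E) * card {x \<in> ?E. p x = 0}"
    using subspace_E[of "- nrm a"]
    by (intro card_kernel_image)
      (auto simp: subspace_0 subspace_diff p_def f_diff scale_right_diff_distrib)
  also have "\<dots> \<le> card (K a) * card (K ?b)"
  proof (intro mult_mono card_mono)
    show "{x \<in> ?E. p x = 0} \<subseteq> K ?b" by (auto simp: p_def K_def eq_neg_iff_add_eq_0)
  qed (use pK in auto)
  finally have le: "card ?E \<le> card (K a) * card (K ?b)" .
  \<comment> \<open>As \<open>?b\<close> has the same norm as \<open>a\<close>, \<open>K ?b\<close>
    is at most of square root size in the same eigenspace. Cancelling one factor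
    \<open>card ?E\<close> then leaves the inequality opposite to
    \<open>card_K_sq_le\<close>.\<close>
  have "(card ?E)\<^sup>2 \<le> (card (K a) * card (K ?b))\<^sup>2" using le by (simp add: power_mono)
  also have "\<dots> \<le> (card (K a))\<^sup>2 * card ?E"
    using card_K_sq_le[of ?b] assms by (simp add: nb power_mult_distrib)
  finally have "card ?E * card ?E \<le> (card (K a))\<^sup>2 * card ?E" by (simp add: power2_eq_square)
  moreover have "card ?E > 0" using subspace_0[OF subspace_E] by (auto simp: card_gt_0_iff)
  ultimately have "card ?E \<le> (card (K a))\<^sup>2" by simp
  hence "(card (K a))\<^sup>2 = card ?E" using card_K_sq_le[OF assms] by simp
  also have "\<dots> = (q ^ d (- nrm a))\<^sup>2"
    using card_sub[OF subspace_E, of "- nrm a"] by (simp add: d_def power_mult[symmetric] mult.commute)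
  finally show ?thesis by simp
qed

section \<open>Kernel, total dimension of the eigenspaces, parity of the rank\<close>

definition ker :: "'b set" where "ker = {x. f x = 0}"

lemma subspace_ker: "subspace ker"
  by (auto simp: subspace_def ker_def f_add f_scale)

text \<open>By \<open>f_anti\<close> the range is orthogonal to the kernel, and both sides have
  q^(2m) / q^(2r) elements, where r is the dimension of the kernel.\<close>

lemma perp_ker: "perp ker = range f"
proof (rule card_subset_eq[symmetric])
  show "range f \<subseteq> perp ker"
  proof clarify
    fix x
    have "\<eta> y (f x) = 0" if "y \<in> ker" for y using f_anti[of y x] that by (simp add: ker_def)
    thus "f x \<in> perp ker" using hsym0 by (simp add: perp_def)
  qed
  have "card (UNIV :: 'b set) = card (range f) * card {x \<in> UNIV. f x = 0}"
    by (rule card_kernel_image) (auto simp: f_diff)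
  hence "q ^ (2 * m) = card (range f) * q ^ (2 * dim ker)"
    using card_sub[OF subspace_ker] by (simp add: cardV ker_def)
  moreover have "q ^ (2 * m) = card (perp ker) * q ^ (2 * dim ker)"
    using dim_perp[OF subspace_ker] card_sub[OF subspace_perp, of ker]
    by (simp add: power_add[symmetric] flip: distrib_left)
  ultimately show "card (range f) = card (perp ker)" using q2 by simp
qed simp

definition r :: nat where "r = dim ker"

text \<open>By \<open>perp_ker\<close>, the radical of the kernel is
  \<open>ker \<inter> range f\<close>.\<close>

definition t :: nat where "t = dim (rad \<eta> ker)"

lemma subspace_rad_ker: "subspace (rad \<eta> ker)"
  unfolding rad_eta by (intro subspace_inter subspace_ker subspace_perp)

text \<open>\<open>f\<close> maps \<open>E 0\<close>, the kernel of \<open>f \<circ> f\<close>, onto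
  \<open>ker \<inter> range f\<close>, and the kernel of this restriction is all of
  \<open>ker\<close>.\<close>

lemma d_0: "d 0 = r + t"
  unfolding d_def
proof (rule dim_eqI[OF subspace_E])
  have "f ` E 0 = rad \<eta> ker"
    unfolding rad_eta perp_ker by (auto simp: E_def ker_def)
  moreover have "card (E 0) = card (f ` E 0) * card {x \<in> E 0. f x = 0}"
    using subspace_E[of 0]
    by (intro card_kernel_image) (auto simp: subspace_0 subspace_diff f_diff)
  moreover have "{x \<in> E 0. f x = 0} = ker" by (auto simp: E_def ker_def)
  ultimately show "card (E 0) = q ^ (2 * (r + t))"
    using card_sub[OF subspace_rad_ker] card_sub[OF subspace_ker]
    by (simp add: r_def t_def power_add mult.commute)
qed

lemma card_iso_ker: "int q * int (card (iso \<inter> ker)) = int q ^ (2 * r) + (int q - 1) * (- int q) ^ (r + t)"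
proof -
  have "{x \<in> ker. \<eta> x x = 0} = iso \<inter> ker" by (auto simp: iso_def)
  thus ?thesis using card_isotropic_vectors[OF herm subspace_ker] by (simp add: r_def t_def)
qed

lemma g_sum: "- f (f (\<Sum>i\<in>I. x i)) = (\<Sum>i\<in>I. - f (f (x i)))"
  by (induction I rule: infinite_finite_induct) (simp_all add: f_add)

lemma eigenvectors_independent:
  assumes "finite I" "\<And>c. c \<in> I \<Longrightarrow> x c \<in> E c" "(\<Sum>c\<in>I. x c) = 0" "c \<in> I"
  shows "x c = 0"
  using assms
proof (induction I arbitrary: x c rule: finite_induct)
  case (insert b I)
  have "- f (f (\<Sum>c\<in>insert b I. x c)) - scale b (\<Sum>c\<in>insert b I. x c) =
      (\<Sum>c\<in>insert b I. scale (c - b) (x c))"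
    unfolding g_sum scale_sum_right sum_subtractf[symmetric]
    using insert.prems(1) by (intro sum.cong refl) (simp add: E_def scale_left_diff_distrib)
  hence s: "(\<Sum>c\<in>I. scale (c - b) (x c)) = 0"
    using insert.hyps insert.prems(2) by simp
  have "scale (c - b) (x c) = 0" if "c \<in> I" for c
    by (rule insert.IH[of "\<lambda>c. scale (c - b) (x c)", OF _ s that])
      (use insert.prems(1) subspace_E in \<open>auto intro: subspace_scale\<close>)
  hence z: "x c = 0" if "c \<in> I" for c using that insert.hyps by auto
  hence "x b = 0" using insert.prems(2) insert.hyps by simp
  thus ?case using z insert.prems(3) by blast
qed simp

text \<open>Independence of eigenvectors makes summation injective on the product of the
  eigenspaces, so that product is no larger than V. This is the constraint under which the weight is
  minimized.\<close>

lemma sum_d_le: "(\<Sum>c\<in>Fq. d c) \<le> m"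
proof -
  let ?P = "PiE Fq E"
  have "inj_on (\<lambda>x. \<Sum>c\<in>Fq. x c) ?P"
  proof (rule inj_onI)
    fix x y assume x: "x \<in> ?P" "y \<in> ?P" and e: "(\<Sum>c\<in>Fq. x c) = (\<Sum>c\<in>Fq. y c)"
    have "x c - y c = 0" if "c \<in> Fq" for c
      by (rule eigenvectors_independent[of Fq "\<lambda>c. x c - y c", OF _ _ _ that])
        (use x e subspace_E in \<open>auto intro!: subspace_diff simp: sum_subtractf\<close>)
    thus "x = y" using x by (intro PiE_ext[of x Fq E y]) auto
  qed
  hence "card ?P \<le> card (UNIV :: 'b set)"
    by (intro card_inj_on_le) auto
  moreover have "card ?P = (\<Prod>c\<in>Fq. card (E c))" by (rule card_PiE) simp
  moreover have "\<dots> = q ^ (2 * (\<Sum>c\<in>Fq. d c))"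
    using card_sub[OF subspace_E] by (simp add: d_def power_sum sum_distrib_left)
  ultimately have "q ^ (2 * (\<Sum>c\<in>Fq. d c)) \<le> q ^ (2 * m)" by (simp add: cardV)
  thus ?thesis using q2 by simp
qed

text \<open>Alternating forms have even rank: if \<open>u\<close> and \<open>v\<close> pair
  nontrivially, their common orthogonal space inside \<open>U\<close> has codimension two and the
  same radical, and the induction continues there.\<close>

lemma even_rank: "subspace U \<Longrightarrow> even (dim U - dim {x \<in> U. \<forall>y\<in>U. \<eta> y (f x) = 0})"
proof (induction "dim U" arbitrary: U rule: less_induct)
  case (less U)
  note U = less.prems
  let ?R = "\<lambda>U. {x \<in> U. \<forall>y\<in>U. \<eta> y (f x) = 0}"
  show ?case
  proof (cases "\<forall>x\<in>U. \<forall>y\<in>U. \<eta> y (f x) = 0")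
    case True
    hence "?R U = U" by auto
    thus ?thesis by simp
  next
    case False
    then obtain u v where uv: "u \<in> U" "v \<in> U" "\<eta> v (f u) \<noteq> 0" by blast
    define U1 where "U1 = {x \<in> U. \<eta> x (f u) = 0}"
    define U2 where "U2 = {x \<in> U1. \<eta> x (f v) = 0}"
    have U1: "subspace U1" unfolding U1_def by (rule dim_kernel(1)[OF U]) (simp_all add: hD)
    have U2: "subspace U2" unfolding U2_def by (rule dim_kernel(1)[OF U1]) (simp_all add: hD)
    have d1: "dim U = dim U1 + 1" unfolding U1_def
      by (rule dim_kernel(2)[OF U, where \<phi> = "\<lambda>x. \<eta> x (f u)" and x = v]) (simp_all add: hD uv)
    have "u \<in> U1" using uv by (simp add: U1_def f_alt)
    moreover have vu: "\<eta> u (f v) = - \<eta> v (f u)" by (rule f_anti)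
    ultimately have d2: "dim U1 = dim U2 + 1" unfolding U2_def
      by (intro dim_kernel(2)[OF U1, where \<phi> = "\<lambda>x. \<eta> x (f v)" and x = u]) (simp_all add: hD uv)
    have "?R U2 = ?R U"
    proof (intro equalityI subsetI)
      fix x assume x: "x \<in> ?R U2"
      have xuv: "\<eta> u (f x) = 0" "\<eta> v (f x) = 0"
        using x f_anti[of u x] f_anti[of v x] by (auto simp: U2_def U1_def)
      have "\<eta> y (f x) = 0" if y: "y \<in> U" for y
      proof -
        \<comment> \<open>These coefficients remove from \<open>y\<close> its components along the
          hyperbolic pair \<open>u\<close>, \<open>v\<close>, so that the remainder lies in
          \<open>U2\<close>.\<close>
        define a b where "a = - \<eta> y (f v) / \<eta> v (f u)" and "b = \<eta> y (f u) / \<eta> v (f u)"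
        have "y - scale a u - scale b v \<in> U2"
          using U uv y by (simp add: U2_def U1_def subspace_add subspace_diff subspace_scale hdiff hD f_alt
              a_def b_def vu)
        hence "\<eta> (y - scale a u - scale b v) (f x) = 0" using x by blast
        thus ?thesis by (simp add: hdiff hD xuv)
      qed
      thus "x \<in> ?R U" using x by (auto simp: U2_def U1_def)
    next
      fix x assume x: "x \<in> ?R U"
      hence "\<eta> x (f u) = 0" "\<eta> x (f v) = 0"
        using f_anti[of x u] f_anti[of x v] uv by auto
      thus "x \<in> ?R U2" using x by (auto simp: U2_def U1_def)
    qed
    moreover have "even (dim U2 - dim (?R U2))" using d1 d2 by (intro less.hyps U2) simp
    moreover have "subspace (?R U2)"
      using U2 by (auto simp: subspace_def f_add f_scale hD)
    hence "dim (?R U2) \<le> dim U2" using U2 by (intro dim_mono) auto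
    ultimately show ?thesis using d1 d2 by simp
  qed
qed

lemma r_le: "r \<le> m"
  using dim_perp[OF subspace_ker] by (simp add: r_def)

lemma t_le_r: "t \<le> r"
proof -
  have "rad \<eta> ker \<subseteq> ker" by (auto simp: rad_def)
  thus ?thesis unfolding t_def r_def by (intro dim_mono subspace_rad_ker subspace_ker)
qed

lemma even_m_r: "even (m - r)"
proof -
  have "{x \<in> UNIV. \<forall>y\<in>UNIV. \<eta> y (f x) = 0} = ker" using nondegD' by (auto simp: ker_def)
  thus ?thesis using even_rank[OF subspace_UNIV] by (simp add: dimV r_def)
qed

section \<open>The weight formula\<close>

definition C :: "'b set" where "C = {x \<in> iso - {0}. f x \<in> span {x}}"

definition S1 :: int where "S1 = (\<Sum>c\<in>Fq - {0}. int q ^ d c - 1)"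

text \<open>A nonzero vector determines its eigenvalue \<open>a\<close>, so the sets
  \<open>D a\<close> are disjoint. For nonzero \<open>a\<close> all eigenvectors are isotropic and
  there are \<open>q ^ d (- nrm a) - 1\<close> of them; each nonzero \<open>c\<close> of
  \<open>Fq\<close> equals \<open>- nrm a\<close> for q + 1 values of \<open>a\<close>. Eigenvalue 0
  contributes the isotropic vectors of the kernel.\<close>

lemma card_C: "int (card C) = int (card (iso \<inter> ker)) - 1 + (int q + 1) * S1"
proof -
  define D where "D a = {x \<in> iso - {0}. f x = scale a x}" for a
  have "C = (\<Union>a\<in>UNIV. D a)" by (auto simp: C_def D_def span_singleton)
  hence "card C = (\<Sum>a\<in>UNIV. card (D a))"
    by (simp only:) (intro card_UN_disjoint, auto simp: D_def)
  hence "int (card C) = (\<Sum>a\<in>UNIV. int (card (D a)))" by simp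
  also have "\<dots> = int (card (D 0)) + (\<Sum>a\<in>UNIV - {0}. int (card (D a)))"
    by (rule sum.remove) auto
  also have "(\<Sum>a\<in>UNIV - {0}. int (card (D a))) = (\<Sum>a\<in>UNIV - {0}. int q ^ d (- nrm a) - 1)"
  proof (rule sum.cong[OF refl])
    fix a :: 'a assume a: "a \<in> UNIV - {0}"
    hence "D a = K a - {0}" using K_iso[of a] by (auto simp: D_def K_def)
    thus "int (card (D a)) = int q ^ d (- nrm a) - 1"
      using card_Diff_int[of "{0}" "K a"] K_0[of a] card_K[of a] a by simp
  qed
  also have "\<dots> = (\<Sum>c\<in>Fq - {0}. \<Sum>a | a \<in> UNIV - {0} \<and> - nrm a = c. int q ^ d (- nrm a) - 1)"
  proof (rule sum.group[symmetric])
    show "(\<lambda>a. - nrm a) ` (UNIV - {0}) \<subseteq> Fq - {0}"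
      using nrm_Fq by (auto simp: Fq_def cj_minus)
  qed auto
  also have "\<dots> = (\<Sum>c\<in>Fq - {0}. (int q + 1) * (int q ^ d c - 1))"
  proof (rule sum.cong[OF refl])
    fix c assume c: "c \<in> Fq - {0}"
    have "{a. a \<in> UNIV - {0} \<and> - nrm a = c} = {a. nrm a = - c}"
      using c by (auto simp: nrm_def)
    moreover have "card {a. nrm a = - c} = q + 1"
      using c by (intro card_nrm) (auto simp: Fq_def cj_minus)
    moreover have "(\<Sum>a | a \<in> UNIV - {0} \<and> - nrm a = c. int q ^ d (- nrm a) - 1) =
        (\<Sum>a | a \<in> UNIV - {0} \<and> - nrm a = c. int q ^ d c - 1)"
      by (rule sum.cong) auto
    ultimately show "(\<Sum>a | a \<in> UNIV - {0} \<and> - nrm a = c. int q ^ d (- nrm a) - 1) =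
        (int q + 1) * (int q ^ d c - 1)" by simp
  qed
  also have "\<dots> = (int q + 1) * S1" by (simp only: S1_def sum_distrib_left)
  also have "D 0 = iso \<inter> ker - {0}" by (auto simp: D_def ker_def)
  also have "int (card \<dots>) = int (card (iso \<inter> ker)) - 1"
    using card_Diff_int[of "{0}" "iso \<inter> ker"] zero_iso by (simp add: ker_def)
  finally show ?thesis .
qed

definition w :: "'b \<Rightarrow> nat" where "w x = card {y \<in> iso. \<eta> y x = 0 \<and> \<eta> y (f x) \<noteq> 0}"

lemma w_C: "x \<in> C \<Longrightarrow> w x = 0"
  by (auto simp: w_def C_def span_singleton hD)

text \<open>The vectors counted by \<open>w x\<close> are the isotropic ones in
  \<open>perp {x}\<close> that leave \<open>perp {x, f x}\<close>. Since \<open>f x\<close> is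
  always orthogonal to \<open>x\<close>, the counts \<open>card_iso_perp\<close> and
  \<open>card_iso_perp2\<close> apply.\<close>

lemma w_not_C:
  assumes x: "x \<in> iso - {0}" "x \<notin> C"
  shows "int q ^ 5 * int (w x) =
    ((int q)\<^sup>2 - 1) * (int q ^ (2 * m) - (if x \<in> B then (- int q) ^ (m + 3) else 0))"
proof -
  have z: "f x \<notin> span {x}" using x by (simp add: C_def)
  have zx: "\<eta> (f x) x = 0" using f_alt[of x] hsym0 by blast
  have sub: "iso \<inter> perp {x, f x} \<subseteq> iso \<inter> perp {x}" by (auto simp: perp_def)
  have "{y \<in> iso. \<eta> y x = 0 \<and> \<eta> y (f x) \<noteq> 0} = iso \<inter> perp {x} - iso \<inter> perp {x, f x}"
    by (auto simp: perp_def)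
  hence "int (w x) = int (card (iso \<inter> perp {x})) - int (card (iso \<inter> perp {x, f x}))"
    using card_Diff_int[OF sub] by (simp only: w_def)
  hence "int q ^ 5 * int (w x) = (int q)\<^sup>2 * (int q ^ 3 * int (card (iso \<inter> perp {x}))) -
      int q ^ 5 * int (card (iso \<inter> perp {x, f x}))"
    unfolding mult.assoc[symmetric] power_add[symmetric] by (simp add: right_diff_distrib)
  also have "\<dots> = (int q)\<^sup>2 * (int q ^ (2 * m) + (int q)\<^sup>2 * (int q - 1) * (- int q) ^ m) -
      (int q ^ (2 * m) + int q ^ 4 * (int q - 1) * (- int q) ^ (if f x \<in> iso then m else m - 1))"
    using card_iso_perp[of x] card_iso_perp2[OF _ _ z zx] x by simp
  also have "\<dots> = ((int q)\<^sup>2 - 1) * (int q ^ (2 * m) - (if x \<in> B then (- int q) ^ (m + 3) else 0))"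
  proof (cases "f x \<in> iso")
    case True
    hence "x \<notin> B" by (simp add: B_def)
    thus ?thesis using True by (simp add: algebra_simps eval_nat_numeral)
  next
    case False
    hence B: "x \<in> B" using x by (simp add: B_def)
    obtain n where n: "m = Suc n" using m4 by (cases m) auto
    have "(- int q) ^ m = - int q * (- int q) ^ n" "(- int q) ^ (m + 3) = int q ^ 4 * (- int q) ^ n"
      unfolding n by (simp_all add: eval_nat_numeral)
    thus ?thesis using B False by (simp add: n algebra_simps eval_nat_numeral)
  qed
  finally show ?thesis .
qed

definition pairs :: "('b \<times> 'b) set" where
  "pairs = {(x, y). x \<in> iso \<and> y \<in> iso \<and> \<eta> y x = 0 \<and> \<eta> y (f x) \<noteq> 0}"

lemma B_C: "B \<subseteq> iso - {0} - C"
  using zero_iso by (auto simp: B_def C_def iso_def span_singleton hD)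

text \<open>Subtracting 1 makes trivial eigenspaces contribute nothing, and the q - 1 ones
  subtracted altogether cancel the term \<open>(int q - 1) * (- int q) ^ m\<close> in
  \<open>card_B\<close>.\<close>

definition S2 :: int where "S2 = (\<Sum>c\<in>Fq - {0}. (- int q) ^ d c - 1)"

lemma card_pairs_BC:
  "int q ^ 5 * int (card pairs) = ((int q)\<^sup>2 - 1) *
    (int q ^ (2 * m) * (int (card iso) - 1 - int (card C)) - (- int q) ^ (m + 3) * int (card B))"
proof -
  let ?I = "iso - {0}" and ?w = "\<lambda>x. int q ^ 5 * int (w x)"
  have "pairs = Sigma ?I (\<lambda>x. {y \<in> iso. \<eta> y x = 0 \<and> \<eta> y (f x) \<noteq> 0})"
    by (auto simp: pairs_def)
  hence "int q ^ 5 * int (card pairs) = sum ?w ?I"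
    by (simp add: sum_distrib_left w_def)
  also have "\<dots> = sum ?w (?I - C)"
    by (rule sum.mono_neutral_right) (auto simp: w_C)
  also have "\<dots> = (\<Sum>x\<in>?I - C. ((int q)\<^sup>2 - 1) * (int q ^ (2 * m) - (if x \<in> B then (- int q) ^ (m + 3) else 0)))"
    by (rule sum.cong[OF refl]) (rule w_not_C, auto)
  also have "\<dots> = ((int q)\<^sup>2 - 1) * (int q ^ (2 * m) * int (card (?I - C)) -
      (\<Sum>x\<in>?I - C. if x \<in> B then (- int q) ^ (m + 3) else 0))"
    by (simp add: sum_distrib_left[symmetric] sum_subtractf)
  also have "(\<Sum>x\<in>?I - C. if x \<in> B then (- int q) ^ (m + 3) else 0) = (\<Sum>x\<in>B. (- int q) ^ (m + 3))"
    using B_C by (intro sum.mono_neutral_cong_right) auto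
  also have "int (card (?I - C)) = int (card iso) - 1 - int (card C)"
    using card_Diff_int[of C ?I] card_iso0 by (auto simp: C_def)
  finally show ?thesis by simp
qed

text \<open>The eigenvalue 0 is taken out of the sum over \<open>Fq\<close> by means of
  \<open>d_0\<close>. So \<open>r\<close> and \<open>t\<close> carry the influence of the kernel,
  while \<open>S1\<close> and \<open>S2\<close> carry that of the nonzero eigenvalues.\<close>

theorem card_pairs:
  "int q ^ 6 * int (card pairs) = ((int q)\<^sup>2 - 1) *
    (int q ^ (4 * m) - int q ^ (2 * m + 2 * r)
     + (int q - 1) * ((int q)\<^sup>2 + 1) * ((- int q) ^ (3 * m) - int q ^ (2 * m) * (- int q) ^ (r + t))
     - int q ^ (2 * m) * (int q * (int q + 1) * S1 + (int q)\<^sup>2 * (int q - 1) * S2))"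
proof -
  let ?X = "(- int q) ^ m" and ?Y = "(- int q) ^ (r + t)"
  have XX: "?X * ?X = int q ^ (2 * m)" by (simp add: power_mult_distrib[symmetric] power_mult power2_eq_square)
  have e4: "int q ^ (4 * m) = int q ^ (2 * m) * int q ^ (2 * m)" by (simp add: power_add[symmetric])
  have e3: "(- int q) ^ (3 * m) = int q ^ (2 * m) * ?X"
    unfolding XX[symmetric] power_add[symmetric] by (rule arg_cong[of _ _ "power (- int q)"]) simp
  have er: "int q ^ (2 * m + 2 * r) = int q ^ (2 * m) * int q ^ (2 * r)" by (rule power_add)
  have "(\<Sum>c\<in>Fq. (- int q) ^ d c) = ?Y + (\<Sum>c\<in>Fq - {0}. (- int q) ^ d c)"
    using sum.remove[of Fq 0 "\<lambda>c. (- int q) ^ d c"] Fq_0 by (simp add: d_0)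
  moreover have "S2 = (\<Sum>c\<in>Fq - {0}. (- int q) ^ d c) - (int q - 1)"
    unfolding S2_def sum_subtractf using card_Fq0 q2 by (simp add: of_nat_diff)
  ultimately have sd: "(\<Sum>c\<in>Fq. (- int q) ^ d c) = ?Y + S2 + (int q - 1)" by simp
  have B: "(int q)\<^sup>2 * int (card B) = (int q - 1) * (int q ^ (2 * m) - ?X * (?Y + S2))"
    unfolding card_B sd by (simp add: algebra_simps)
  have "int q ^ 6 * int (card pairs) = int q * (int q ^ 5 * int (card pairs))"
    by (simp add: eval_nat_numeral)
  also have "\<dots> = ((int q)\<^sup>2 - 1) *
    (int q ^ (2 * m) * (int q * int (card iso) - int q - int q * int (card C)) + (int q)\<^sup>2 * ?X * ((int q)\<^sup>2 * int (card B)))"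
    unfolding card_pairs_BC by (simp add: algebra_simps eval_nat_numeral)
  also have "int q * int (card C) = int q ^ (2 * r) + (int q - 1) * ?Y - int q + int q * (int q + 1) * S1"
    unfolding card_C using card_iso_ker by (simp add: algebra_simps)
  also have "int q * int (card iso) = int q ^ (2 * m) + (int q - 1) * ?X" by (rule card_iso)
  also note B
  also have "(int q)\<^sup>2 * ?X * ((int q - 1) * (int q ^ (2 * m) - ?X * (?Y + S2))) =
     (int q)\<^sup>2 * (int q - 1) * (int q ^ (2 * m) * ?X - int q ^ (2 * m) * (?Y + S2))"
    unfolding XX[symmetric] by (simp add: algebra_simps)
  finally show ?thesis unfolding e4 e3 er by (simp add: algebra_simps power2_eq_square)
qed

end

section \<open>The lower bound\<close>

text \<open>Because (x - 1)(y - 1) is nonnegative for x, y at least 1, the sum is largest when a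
  single eigenvalue takes up the whole available dimension.\<close>

lemma sum_power_minus_one_le:
  fixes a :: int and g :: "'a \<Rightarrow> nat"
  assumes "1 \<le> a" "finite I"
  shows "(\<Sum>c\<in>I. a ^ g c - 1) \<le> a ^ (\<Sum>c\<in>I. g c) - 1"
  using assms(2)
proof (induction I rule: finite_induct)
  case (insert b I)
  let ?x = "a ^ g b" and ?y = "a ^ (\<Sum>c\<in>I. g c)"
  have "1 \<le> ?x" "1 \<le> ?y" using assms(1) by (simp_all add: one_le_power)
  hence "0 \<le> (?x - 1) * (?y - 1)" by simp
  thus ?case using insert by (simp add: power_add algebra_simps)
qed simp

text \<open>Here \<open>a\<close> is q, and \<open>u\<close> is the dimension m - r - t left to the
  nonzero eigenvalues. As r + t is at least 2, the kernel term is at least (a - 1) a^(r + t) (a^u -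
  1), which already exceeds the eigenvalue term \<open>a * S\<close>.\<close>

lemma even_case_bound:
  fixes a S :: int
  assumes a: "2 \<le> a" and r: "2 \<le> r + t" and S: "S \<le> a ^ u - 1" and k: "1 \<le> k" and u: "t + u = 2 * k"
  shows "0 \<le> a ^ (2 * r) * (a ^ (4 * k - 4) - 1)
    + (a\<^sup>2 + 1) * ((a - 1) * (a ^ (r + 2 * k) - (- 1) ^ t * a ^ (r + t)) - a * S)"
proof -
  have a1: "1 \<le> a ^ n" for n using a by (simp add: one_le_power)
  have "a ^ 1 \<le> a ^ (r + t)" using a r by (intro power_increasing) auto
  hence "1 * a \<le> (a - 1) * a ^ (r + t)"
    using a by (intro mult_mono) auto
  hence "a * (a ^ u - 1) \<le> (a - 1) * a ^ (r + t) * (a ^ u - 1)"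
    using a1[of u] by (intro mult_right_mono) auto
  moreover have "a * S \<le> a * (a ^ u - 1)" using a S by (intro mult_left_mono) auto
  moreover have "(a - 1) * a ^ (r + t) * (a ^ u - 1) \<le>
      (a - 1) * (a ^ (r + 2 * k) - (- 1) ^ t * a ^ (r + t))"
  proof -
    have "a ^ (r + 2 * k) = a ^ (r + t) * a ^ u" by (simp add: u[symmetric] power_add)
    moreover have "(- 1) ^ t * a ^ (r + t) \<le> 1 * a ^ (r + t)"
      using a1[of "r + t"] by (intro mult_right_mono) (auto simp: minus_one_power_iff)
    ultimately have "a ^ (r + t) * (a ^ u - 1) \<le> a ^ (r + 2 * k) - (- 1) ^ t * a ^ (r + t)"
      by (simp add: right_diff_distrib)
    thus ?thesis using a by (simp add: mult.assoc mult_left_mono)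
  qed
  ultimately have "0 \<le> (a - 1) * (a ^ (r + 2 * k) - (- 1) ^ t * a ^ (r + t)) - a * S" by linarith
  thus ?thesis using a a1[of "4 * k - 4"] by simp
qed

text \<open>The sign of the kernel term depends on the parity of \<open>t\<close>. For even
  \<open>t\<close> both powers are positive and suffice unless r = 1. For odd \<open>t\<close> they
  partly cancel and u is odd; if u = 1 they cancel completely, which is why one-dimensional
  eigenspaces must contribute nothing positive.\<close>

lemma odd_case_bound:
  fixes a S :: int
  assumes a: "2 \<le> a" and r: "odd r" "t \<le> r" and S: "S \<le> a ^ u - 1" and k: "1 \<le> k" and u: "t + u = 2 * k"
    and S1: "u = 1 \<Longrightarrow> S \<le> 0" and m: "4 \<le> r + 2 * k"
  shows "0 \<le> a ^ (2 * r) * (a ^ (4 * k - 4) - 1)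
    + (a\<^sup>2 + 1) * ((a - 1) * (a ^ (r + 2 * k - 1) + (- 1) ^ t * a ^ (r + t)) - a * S)"
proof -
  have a1: "1 \<le> a ^ n" for n using a by (simp add: one_le_power)
  have inc: "i \<le> j \<Longrightarrow> a ^ i \<le> a ^ j" for i j using a by (intro power_increasing) auto
  have le1: "1 * x \<le> (a - 1) * x" if "0 \<le> x" for x using a that by (intro mult_right_mono) auto
  have first: "0 \<le> a ^ (2 * r) * (a ^ (4 * k - 4) - 1)" using a a1[of "4 * k - 4"] by simp
  have aS: "a * S \<le> a ^ (u + 1) - a"
    using mult_left_mono[OF S, of a] a by (simp add: right_diff_distrib mult.commute)
  have dist: "?thesis" if "a * S \<le> (a - 1) * (a ^ (r + 2 * k - 1) + (- 1) ^ t * a ^ (r + t))"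
    using first that by simp
  show ?thesis
  proof (cases "even t")
    case True
    show ?thesis
    proof (cases "r = 1")
      case False
      hence "3 \<le> r" using r(1) by (cases r; cases "r - 1"; cases "r - 2") auto
      hence "a ^ (u + 1) \<le> a ^ (r + 2 * k - 1)" using u by (intro inc) auto
      hence "a * S \<le> a ^ (r + 2 * k - 1) + a ^ (r + t)" using aS a a1[of "r + t"] by linarith
      also have "\<dots> = 1 * (a ^ (r + 2 * k - 1) + a ^ (r + t))" by simp
      also have "\<dots> \<le> (a - 1) * (a ^ (r + 2 * k - 1) + a ^ (r + t))"
        using a by (intro le1) simp
      finally show ?thesis using True by (intro dist) simp
    next
      case r1: True
      hence t: "t = 0" using True r(2) by (cases t; cases "t - 1") auto
      obtain j where j: "k = Suc (Suc j)" using m r1 by (cases k; cases "k - 1") auto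
      \<comment> \<open>Here the leading term is indispensable. In terms of \<open>Y\<close> the
        bound factors as a^2 (Y - 1)(Y - a^2), which is zero for k = 2, that is for r + 2k =
        5.\<close>
      define Y where "Y = a ^ (2 * j + 2)"
      have Y: "a\<^sup>2 \<le> Y" unfolding Y_def by (intro inc) simp
      have e1: "a ^ (4 * k - 4) = Y * Y" unfolding Y_def power_add[symmetric]
        by (rule arg_cong[of _ _ "power a"]) (simp add: j)
      have e2: "a ^ (r + 2 * k - 1) = a\<^sup>2 * Y" unfolding Y_def power_add[symmetric]
        by (rule arg_cong[of _ _ "power a"]) (simp add: j r1)
      have e3: "a ^ (u + 1) = a * a\<^sup>2 * Y"
        using u by (simp add: Y_def j t power2_eq_square mult.assoc power_add)
      have "0 \<le> a\<^sup>2 * ((Y - 1) * (Y - a\<^sup>2))" using Y a1[of "2 * j + 2"] by (simp add: Y_def)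
      also have "\<dots> = a ^ (2 * r) * (Y * Y - 1) + (a\<^sup>2 + 1) * ((a - 1) * (a\<^sup>2 * Y + a) - (a * a\<^sup>2 * Y - a))"
        by (simp add: r1 algebra_simps power2_eq_square)
      also have "\<dots> \<le> a ^ (2 * r) * (Y * Y - 1) + (a\<^sup>2 + 1) * ((a - 1) * (a\<^sup>2 * Y + a) - a * S)"
        using aS unfolding e3 by (intro add_left_mono mult_left_mono) auto
      finally show ?thesis unfolding e1 e2 by (simp add: t r1)
    qed
  next
    case odd: False
    hence t1: "1 \<le> t" by (cases t) auto
    have "odd u" using odd u by presburger
    have r1: "1 \<le> r" using t1 r by simp
    have Z: "a ^ (r + 2 * k - 1) = a ^ (r + t) * a ^ (u - 1)"
    proof -
      have "r + 2 * k - 1 = (r + t) + (u - 1)" using u \<open>odd u\<close> by (cases u) auto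
      thus ?thesis by (simp only: power_add)
    qed
    have B: "a ^ (r + 2 * k - 1) + (- 1) ^ t * a ^ (r + t) = a ^ (r + t) * (a ^ (u - 1) - 1)"
      unfolding Z using odd by (simp add: right_diff_distrib)
    show ?thesis
    proof (cases "u = 1")
      case True
      have "a * S \<le> 0" using S1[OF True] a by (simp add: mult_le_0_iff)
      hence "(a\<^sup>2 + 1) * (a * S) \<le> 0" by (rule mult_nonneg_nonpos[rotated]) simp
      thus ?thesis unfolding B using first True by simp
    next
      case False
      then obtain v where v: "u = Suc (Suc (Suc v))" using \<open>odd u\<close>
        by (cases u; cases "u - 1"; cases "u - 2") auto
      \<comment> \<open>The facts \<open>1\<close> and \<open>2\<close> below extract from the
        leading term and from the kernel term a lower bound that falls short of a^(v + 4) = a^(u +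
        1) by a smaller power. By \<open>3\<close> both together cover \<open>a * S\<close>.\<close>
      have x: "a ^ (4 * k - 4) = a ^ (4 * k - 8) * a ^ 4"
        using u v t1 by (simp add: power_add[symmetric])
      have "a ^ (4 * k - 8) * (a ^ 4 - 1) \<le> a ^ (4 * k - 4) - 1"
        unfolding x right_diff_distrib using a1[of "4 * k - 8"] by linarith
      hence "a ^ (2 * r) * a ^ (4 * k - 8) * (a ^ 4 - 1) \<le> a ^ (2 * r) * (a ^ (4 * k - 4) - 1)"
        unfolding mult.assoc using a by (intro mult_left_mono) auto
      moreover have "a ^ (v + 2) \<le> a ^ (2 * r) * a ^ (4 * k - 8)"
        unfolding power_add[symmetric] using u v t1 r1 by (intro inc) simp
      hence "a ^ (v + 2) * (a ^ 4 - 1) \<le> a ^ (2 * r) * a ^ (4 * k - 8) * (a ^ 4 - 1)"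
        using a1[of 4] by (intro mult_right_mono) auto
      moreover have "a ^ (v + 2) * (a ^ 4 - 1) = (a\<^sup>2 + 1) * (a ^ (v + 4) - a ^ (v + 2))"
        by (simp add: algebra_simps eval_nat_numeral)
      ultimately have 1: "(a\<^sup>2 + 1) * (a ^ (v + 4) - a ^ (v + 2)) \<le> a ^ (2 * r) * (a ^ (4 * k - 4) - 1)"
        by linarith
      have "a\<^sup>2 * (a ^ (v + 2) - 1) \<le> a ^ (r + t) * (a ^ (u - 1) - 1)"
        using t1 r1 a a1[of "v + 2"] by (intro mult_mono inc) (auto simp: v)
      hence "a ^ (v + 4) - a\<^sup>2 \<le> 1 * (a ^ (r + t) * (a ^ (u - 1) - 1))"
        by (simp add: algebra_simps eval_nat_numeral)
      also have "\<dots> \<le> (a - 1) * (a ^ (r + t) * (a ^ (u - 1) - 1))"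
        using a a1[of "u - 1"] by (intro le1) simp
      finally have 2: "a ^ (v + 4) - a\<^sup>2 \<le> (a - 1) * (a ^ (r + t) * (a ^ (u - 1) - 1))" .
      have 3: "a ^ (v + 2) + a\<^sup>2 \<le> a ^ (v + 4)"
      proof -
        have "a\<^sup>2 \<le> a ^ (v + 2)" by (intro inc) simp
        moreover have "2 * a ^ (v + 2) \<le> a\<^sup>2 * a ^ (v + 2)"
          using a mult_mono[of 2 a 1 a] a1[of "v + 2"]
          by (intro mult_right_mono) (auto simp: power2_eq_square)
        ultimately show ?thesis by (simp add: eval_nat_numeral)
      qed
      have "a * S \<le> a ^ (v + 4) - a" using aS by (simp add: v eval_nat_numeral)
      hence "0 \<le> (a ^ (v + 4) - a ^ (v + 2)) + ((a - 1) * (a ^ (r + t) * (a ^ (u - 1) - 1)) - a * S)"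
        using 2 3 a by linarith
      hence "0 \<le> (a\<^sup>2 + 1) * ((a ^ (v + 4) - a ^ (v + 2)) + ((a - 1) * (a ^ (r + t) * (a ^ (u - 1) - 1)) - a * S))"
        by simp
      thus ?thesis unfolding B using 1 by (simp add: distrib_left)
    qed
  qed
qed

definition dmin :: "nat \<Rightarrow> nat \<Rightarrow> nat" where
  "dmin q m = (if m = 4 \<or> m = 6 then q ^ (4 * m - 12) - q ^ (2 * m - 6)
            else if even m then q ^ (4 * m - 12)
            else q ^ (4 * m - 12) - q ^ (3 * m - 9))"

lemma dmin_int:
  assumes "2 \<le> q" "4 \<le> m"
  shows "int q ^ 8 * int (dmin q m) =
    int q ^ (4 * m - 4) - (if m = 4 \<or> m = 6 then int q ^ (2 * m + 2) else if even m then 0 else int q ^ (3 * m - 1))"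
proof -
  have "q ^ (2 * m - 6) \<le> q ^ (4 * m - 12)" "q ^ (3 * m - 9) \<le> q ^ (4 * m - 12)"
    using assms by (auto intro!: power_increasing)
  hence "int (dmin q m) = int q ^ (4 * m - 12) - (if m = 4 \<or> m = 6 then int q ^ (2 * m - 6)
      else if even m then 0 else int q ^ (3 * m - 9))"
    by (auto simp: dmin_def of_nat_diff)
  moreover have "int q ^ 8 * int q ^ (4 * m - 12) = int q ^ (4 * m - 4)"
    "int q ^ 8 * int q ^ (2 * m - 6) = int q ^ (2 * m + 2)"
    "int q ^ 8 * int q ^ (3 * m - 9) = int q ^ (3 * m - 1)"
    unfolding power_add[symmetric] using assms by (auto intro!: arg_cong[of _ _ "power (int q)"])
  ultimately show ?thesis by (simp add: right_diff_distrib)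
qed

text \<open>The common factor a^(2m) is divided out, and \<open>key\<close> is what remains to be
  shown. There \<open>sb\<close> is the amount, in the same normalization, by which
  \<open>dmin\<close> stays below q^(4m - 12).\<close>

lemma main_bound:
  fixes X S :: int and q m r t u k :: nat
  defines "a \<equiv> int q"
  assumes q: "2 \<le> q" and m4: "4 \<le> m" and m: "m = r + 2 * k" and k: "1 \<le> k" and t: "t \<le> r" and u: "t + u = 2 * k"
    and S: "S \<le> a ^ u - 1" and S1: "u = 1 \<Longrightarrow> S \<le> 0" and X: "X \<le> a * (a\<^sup>2 + 1) * S"
  shows "a ^ 8 * (a ^ 4 - 1) * int (dmin q m) \<le>
    a ^ (4 * m) - a ^ (2 * m + 2 * r)
     + (a - 1) * (a\<^sup>2 + 1) * ((- a) ^ (3 * m) - a ^ (2 * m) * (- a) ^ (r + t)) - a ^ (2 * m) * X"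
proof -
  let ?P = "a ^ (2 * m)"
  have a: "2 \<le> a" using q by (simp add: a_def)
  have a1: "1 \<le> a ^ n" for n using a by (simp add: one_le_power)
  have P: "0 \<le> ?P" using a by simp
  have ea: "a ^ (4 * m - 4) = ?P * (a ^ (2 * r) * a ^ (4 * k - 4))"
    unfolding power_add[symmetric] by (rule arg_cong[of _ _ "power a"]) (use m k in simp)
  have eb: "a ^ (4 * m) = a ^ 4 * a ^ (4 * m - 4)"
    unfolding power_add[symmetric] by (rule arg_cong[of _ _ "power a"]) (use m4 in simp)
  have ec: "a ^ (2 * m + 2 * r) = ?P * a ^ (2 * r)" by (rule power_add)
  have ed: "(- a) ^ (3 * m) = ?P * (- a) ^ (r + 2 * k)"
  proof -
    have "(- a) ^ (3 * m) = (- a) ^ (2 * m) * (- a) ^ m"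
      unfolding power_add[symmetric] by (rule arg_cong[of _ _ "power (- a)"]) simp
    thus ?thesis by (simp add: m)
  qed
  have PX: "?P * X \<le> ?P * (a * (a\<^sup>2 + 1) * S)" using X P by (rule mult_left_mono)
  define sub where "sub = (if m = 4 \<or> m = 6 then a ^ (2 * m + 2) else if even m then 0 else a ^ (3 * m - 1))"
  have lhs: "a ^ 8 * (a ^ 4 - 1) * int (dmin q m) = (a ^ 4 - 1) * (a ^ (4 * m - 4) - sub)"
    using dmin_int[OF q m4] by (simp add: a_def sub_def mult.assoc mult.left_commute)
  obtain sb where sb: "sub = ?P * sb" "sb = (if m = 4 \<or> m = 6 then a\<^sup>2 else if even m then 0 else a ^ (r + 2 * k - 1))"
  proof -
    have "a ^ (3 * m - 1) = ?P * a ^ (r + 2 * k - 1)"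
      unfolding power_add[symmetric] by (rule arg_cong[of _ _ "power a"]) (use m k in simp)
    moreover have "a ^ (2 * m + 2) = ?P * a\<^sup>2" by (rule power_add)
    ultimately show ?thesis using that by (simp add: sub_def)
  qed
  have key: "0 \<le> a ^ (2 * r) * (a ^ (4 * k - 4) - 1) + (a ^ 4 - 1) * sb
     + (a\<^sup>2 + 1) * ((a - 1) * ((- a) ^ (r + 2 * k) - (- a) ^ (r + t)) - a * S)"
  proof (cases "even r")
    case True
    have neg: "(- a) ^ (r + 2 * k) = a ^ (r + 2 * k)" "(- a) ^ (r + t) = (- 1) ^ t * a ^ (r + t)"
      using True by (auto simp: power_minus[of a] power_add)
    have "0 \<le> (a ^ 4 - 1) * sb" using a a1[of 4] True by (simp add: sb m)
    show ?thesis
    proof (cases "r = 0")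
      case False
      hence "2 \<le> r + t" using True by (cases r; cases "r - 1") auto
      thus ?thesis unfolding neg
        using even_case_bound[OF a _ S k u] \<open>0 \<le> (a ^ 4 - 1) * sb\<close> by fastforce
    next
      \<comment> \<open>The map is bijective, so no kernel makes up for the eigenvalue term, and the
        loss can reach (a^2 + 1)(a^(2k) - 1). From k = 4 on the leading power covers it. For k = 2
        and k = 3 it does not, and the correction \<open>sb = a\<^sup>2\<close> restores exact
        equality: this singles out m = 4 and m = 6.\<close>
      case r0: True
      hence t0: "t = 0" "u = 2 * k" using t u by auto
      have "a * S \<le> a * (a ^ (2 * k) - 1)" using S t0 a by (intro mult_left_mono) auto
      hence "(a\<^sup>2 + 1) * ((a - 1) * (a ^ (2 * k) - 1) - a * (a ^ (2 * k) - 1)) \<le>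
          (a\<^sup>2 + 1) * ((a - 1) * (a ^ (2 * k) - 1) - a * S)"
        by (intro mult_left_mono) auto
      moreover have "(a\<^sup>2 + 1) * ((a - 1) * (a ^ (2 * k) - 1) - a * (a ^ (2 * k) - 1)) =
          - ((a\<^sup>2 + 1) * (a ^ (2 * k) - 1))"
        by (simp add: algebra_simps)
      moreover have "(a\<^sup>2 + 1) * (a ^ (2 * k) - 1) \<le> (a ^ (4 * k - 4) - 1) + (a ^ 4 - 1) * sb"
      proof -
        have "k = 2 \<or> k = 3 \<or> 4 \<le> k" using m m4 r0 by auto
        thus ?thesis
        proof (elim disjE)
          assume "k = 2"
          thus ?thesis using r0 m by (simp add: sb algebra_simps eval_nat_numeral)
        next
          assume "k = 3"
          thus ?thesis using r0 m by (simp add: sb algebra_simps eval_nat_numeral)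
        next
          assume "4 \<le> k"
          then obtain j where j: "k = 4 + j" using le_Suc_ex by blast
          have "(a\<^sup>2 + 1) * a ^ (2 * k) \<le> (a\<^sup>2 * a\<^sup>2) * a ^ (2 * k)"
          proof (rule mult_right_mono)
            have "4 \<le> a\<^sup>2" using a mult_mono[of 2 a 2 a] by (simp add: power2_eq_square)
            hence "4 * a\<^sup>2 \<le> a\<^sup>2 * a\<^sup>2" by (intro mult_right_mono) auto
            thus "a\<^sup>2 + 1 \<le> a\<^sup>2 * a\<^sup>2" using \<open>4 \<le> a\<^sup>2\<close> by linarith
          qed (use a in simp)
          also have "\<dots> = a ^ (2 * k + 4)" by (simp add: power_add eval_nat_numeral)
          also have "\<dots> \<le> a ^ (4 * k - 4)" using a by (intro power_increasing) (auto simp: j)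
          finally have "(a\<^sup>2 + 1) * a ^ (2 * k) \<le> a ^ (4 * k - 4)" .
          moreover have "(a\<^sup>2 + 1) * (a ^ (2 * k) - 1) = (a\<^sup>2 + 1) * a ^ (2 * k) - a\<^sup>2 - 1"
            by (simp add: algebra_simps)
          ultimately show ?thesis using \<open>0 \<le> (a ^ 4 - 1) * sb\<close> zero_le_power2[of a] by linarith
        qed
      qed
      ultimately have "0 \<le> (a ^ (4 * k - 4) - 1) + (a ^ 4 - 1) * sb +
          (a\<^sup>2 + 1) * ((a - 1) * (a ^ (2 * k) - 1) - a * S)" by linarith
      thus ?thesis by (simp add: r0 t0)
    qed
  next
    case False
    have om: "odd m" using False m by simp
    have neg: "(- a) ^ (r + 2 * k) = - (a ^ (r + 2 * k))" "(- a) ^ (r + t) = - ((- 1) ^ t * a ^ (r + t))"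
      using False by (auto simp: power_minus[of a] power_add)
    have sb': "sb = a ^ (r + 2 * k - 1)" using om sb by auto
    have z: "a ^ (r + 2 * k) = a * a ^ (r + 2 * k - 1)" using k by (simp flip: power_Suc)
    have "0 \<le> a ^ (2 * r) * (a ^ (4 * k - 4) - 1)
        + (a\<^sup>2 + 1) * ((a - 1) * (a ^ (r + 2 * k - 1) + (- 1) ^ t * a ^ (r + t)) - a * S)"
      using odd_case_bound[OF a False t S k u S1] m m4 by simp
    \<comment> \<open>As a^4 - 1 = (a^2 + 1)(a - 1)(a + 1), the correction for odd m outweighs the
      negative power and leaves one positive copy of a^(r + 2k - 1).\<close>
    also have "\<dots> = a ^ (2 * r) * (a ^ (4 * k - 4) - 1) + (a ^ 4 - 1) * a ^ (r + 2 * k - 1)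
        + (a\<^sup>2 + 1) * ((a - 1) * (- (a * a ^ (r + 2 * k - 1)) - - ((- 1) ^ t * a ^ (r + t))) - a * S)"
      by (simp add: algebra_simps eval_nat_numeral)
    finally show ?thesis unfolding neg sb' z .
  qed
  hence "0 \<le> ?P * (a ^ (2 * r) * (a ^ (4 * k - 4) - 1) + (a ^ 4 - 1) * sb
     + (a\<^sup>2 + 1) * ((a - 1) * ((- a) ^ (r + 2 * k) - (- a) ^ (r + t)) - a * S))"
    using P by simp
  thus ?thesis unfolding lhs eb ec ed sb ea using PX by (simp add: algebra_simps)
qed

context alternating_map
begin

text \<open>Since (-q)^n is at most q^n, the two sums merge with the total coefficient q(q + 1) +
  q^2(q - 1) = q(q^2 + 1).\<close>

lemma eigen_terms_bound:
  assumes u: "r + t + u = m"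
  shows "\<exists>S. int q * (int q + 1) * S1 + (int q)\<^sup>2 * (int q - 1) * S2 \<le> int q * ((int q)\<^sup>2 + 1) * S \<and>
    S \<le> int q ^ u - 1 \<and> (u = 1 \<longrightarrow> S \<le> 0)"
proof -
  let ?a = "int q"
  \<comment> \<open>The case n = 1 is set to zero because the two contributions of a one-dimensional
    eigenspace add up to - q (q + 1)(q - 1)^2. This gives the clause for u = 1.\<close>
  define s where "s n = (if n = 1 then 0 else ?a ^ n - 1)" for n
  have a: "2 \<le> ?a" using q2 by simp
  have le: "?a * (?a + 1) * (?a ^ n - 1) + ?a\<^sup>2 * (?a - 1) * ((- ?a) ^ n - 1) \<le> ?a * (?a\<^sup>2 + 1) * s n" for n
  proof (cases "n = 1")
    case True
    have "0 \<le> ?a * ((?a + 1) * ((?a - 1) * (?a - 1)))" using a by simp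
    thus ?thesis using True by (simp add: s_def algebra_simps power2_eq_square)
  next
    case False
    have "(- ?a) ^ n \<le> ?a ^ n" by (cases "even n") (auto simp: power_minus_odd)
    hence "?a\<^sup>2 * (?a - 1) * ((- ?a) ^ n - 1) \<le> ?a\<^sup>2 * (?a - 1) * (?a ^ n - 1)"
      using a by (intro mult_left_mono) auto
    thus ?thesis using False by (simp add: s_def algebra_simps power2_eq_square)
  qed
  have dsum: "(\<Sum>c\<in>Fq - {0}. d c) \<le> u"
    using sum_d_le sum.remove[of Fq 0 d] Fq_0 u by (simp add: d_0)
  let ?S = "\<Sum>c\<in>Fq - {0}. s (d c)"
  show ?thesis
  proof (intro exI[of _ ?S] conjI impI)
    show "?a * (?a + 1) * S1 + ?a\<^sup>2 * (?a - 1) * S2 \<le> ?a * (?a\<^sup>2 + 1) * ?S"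
      unfolding S1_def S2_def sum_distrib_left sum.distrib[symmetric] by (rule sum_mono) (rule le)
    have "?S \<le> (\<Sum>c\<in>Fq - {0}. ?a ^ d c - 1)" using a by (intro sum_mono) (auto simp: s_def)
    also have "\<dots> \<le> ?a ^ (\<Sum>c\<in>Fq - {0}. d c) - 1"
      using a by (intro sum_power_minus_one_le) auto
    also have "\<dots> \<le> ?a ^ u - 1" using power_increasing[OF dsum, of ?a] a by linarith
    finally show "?S \<le> ?a ^ u - 1" .
    assume "u = 1"
    have "s (d c) = 0" if "c \<in> Fq - {0}" for c
    proof -
      have "d c \<le> 1" using member_le_sum[of c "Fq - {0}" d] that dsum \<open>u = 1\<close> by simp
      thus ?thesis by (cases "d c") (auto simp: s_def)
    qed
    thus "?S \<le> 0" by simp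
  qed
qed

text \<open>The factor after \<open>dmin q m\<close> is |GL_2(q^2)|, the number of ordered bases of
  a line. The shape m = r + 2k with k positive comes from the even rank and from \<open>f\<close>
  being nonzero.\<close>

lemma card_pairs_ge:
  assumes "\<exists>x. f x \<noteq> 0"
  shows "dmin q m * (q\<^sup>2 * (q\<^sup>2 - 1) * (q ^ 4 - 1)) \<le> card pairs"
proof -
  let ?a = "int q"
  have "r \<noteq> m"
  proof
    assume "r = m"
    hence "ker = UNIV" using subspace_eqI[OF subspace_ker subspace_UNIV] dimV by (simp add: r_def)
    thus False using assms by (auto simp: ker_def)
  qed
  obtain k where k: "m - r = 2 * k" using even_m_r by (elim evenE)
  have m: "m = r + 2 * k" and k1: "1 \<le> k" using k r_le \<open>r \<noteq> m\<close> by auto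
  have "r + t \<le> m" using sum_d_le member_le_sum[of 0 Fq d] Fq_0 by (simp add: d_0)
  then obtain u where u: "r + t + u = m" using le_Suc_ex by metis
  obtain S where S: "?a * (?a + 1) * S1 + ?a\<^sup>2 * (?a - 1) * S2 \<le> ?a * (?a\<^sup>2 + 1) * S"
    "S \<le> ?a ^ u - 1" "u = 1 \<longrightarrow> S \<le> 0"
    using eigen_terms_bound[OF u] by (elim exE conjE)
  have a: "2 \<le> ?a" using q2 by simp
  have "?a ^ 8 * (?a ^ 4 - 1) * int (dmin q m) \<le>
    ?a ^ (4 * m) - ?a ^ (2 * m + 2 * r)
     + (?a - 1) * (?a\<^sup>2 + 1) * ((- ?a) ^ (3 * m) - ?a ^ (2 * m) * (- ?a) ^ (r + t))
     - ?a ^ (2 * m) * (?a * (?a + 1) * S1 + ?a\<^sup>2 * (?a - 1) * S2)" (is "_ \<le> ?M")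
    using m u by (intro main_bound[OF q2 m4 m k1 t_le_r _ S(2) S(3)[rule_format] S(1)]) auto
  hence "(?a\<^sup>2 - 1) * (?a ^ 8 * (?a ^ 4 - 1) * int (dmin q m)) \<le> (?a\<^sup>2 - 1) * ?M"
    using a by (intro mult_left_mono) (auto simp: one_le_power)
  also have "\<dots> = ?a ^ 6 * int (card pairs)" by (rule card_pairs[symmetric])
  also have "(?a\<^sup>2 - 1) * (?a ^ 8 * (?a ^ 4 - 1) * int (dmin q m)) =
      ?a ^ 6 * (int (dmin q m) * (?a\<^sup>2 * (?a\<^sup>2 - 1) * (?a ^ 4 - 1)))"
    by (simp add: algebra_simps eval_nat_numeral)
  finally have "int (dmin q m) * (?a\<^sup>2 * (?a\<^sup>2 - 1) * (?a ^ 4 - 1)) \<le> int (card pairs)"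
    using a by (simp add: mult_le_cancel_left)
  moreover have "int (q\<^sup>2 - 1) = ?a\<^sup>2 - 1" "int (q ^ 4 - 1) = ?a ^ 4 - 1"
    using q2 by (simp_all add: of_nat_diff one_le_power)
  ultimately show ?thesis by (metis (no_types, lifting) of_nat_le_iff of_nat_mult of_nat_power)
qed

lemma card_pairs_eqI:
  assumes "int q ^ 8 * (int q ^ 4 - 1) * int (dmin q m) =
    int q ^ (4 * m) - int q ^ (2 * m + 2 * r)
     + (int q - 1) * ((int q)\<^sup>2 + 1) * ((- int q) ^ (3 * m) - int q ^ (2 * m) * (- int q) ^ (r + t))
     - int q ^ (2 * m) * (int q * (int q + 1) * S1 + (int q)\<^sup>2 * (int q - 1) * S2)"
  shows "card pairs = dmin q m * (q\<^sup>2 * (q\<^sup>2 - 1) * (q ^ 4 - 1))"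
proof -
  let ?a = "int q"
  have a: "2 \<le> ?a" using q2 by simp
  have "?a ^ 6 * int (card pairs) = (?a\<^sup>2 - 1) * (?a ^ 8 * (?a ^ 4 - 1) * int (dmin q m))"
    unfolding card_pairs assms ..
  also have "\<dots> = ?a ^ 6 * (int (dmin q m) * (?a\<^sup>2 * (?a\<^sup>2 - 1) * (?a ^ 4 - 1)))"
    by (simp add: algebra_simps eval_nat_numeral)
  finally have "int (card pairs) = int (dmin q m) * (?a\<^sup>2 * (?a\<^sup>2 - 1) * (?a ^ 4 - 1))"
    using a by simp
  moreover have "int (q\<^sup>2 - 1) = ?a\<^sup>2 - 1" "int (q ^ 4 - 1) = ?a ^ 4 - 1"
    using q2 by (simp_all add: of_nat_diff one_le_power)
  ultimately show ?thesis by (metis (no_types, lifting) of_nat_eq_iff of_nat_mult of_nat_power)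
qed

end

section \<open>Forms attaining the bound\<close>

lemma sum_lessThan_double:
  fixes h :: "nat \<Rightarrow> 'a::comm_monoid_add"
  shows "(\<Sum>i<2 * k. h i) = (\<Sum>j<k. h (2 * j) + h (2 * j + 1))"
  by (induction k) (simp_all add: add.assoc)

context hermitian_space
begin

definition attains_min :: "('v \<Rightarrow> 'v) \<Rightarrow> bool" where
  "attains_min f \<longleftrightarrow> alternating_map scale q m \<eta> f \<and> (\<exists>x. f x \<noteq> 0) \<and>
     card {(x, y). x \<in> iso \<and> y \<in> iso \<and> \<eta> y x = 0 \<and> \<eta> y (f x) \<noteq> 0} =
       dmin q m * (q\<^sup>2 * (q\<^sup>2 - 1) * (q ^ 4 - 1))"

text \<open>The form is the wedge of the functionals \<open>\<eta> x u\<close> and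
  \<open>\<eta> x v\<close>. Its \<open>- f \<circ> f\<close> is nilpotent, so only the exponent r +
  t matters: it is m for isotropic \<open>v\<close> and m - 1 otherwise. The parity of m decides
  which of the two makes the signed term in the weight formula smaller.\<close>

lemma rank_two_attains_min:
  assumes u: "u \<noteq> 0" "v \<notin> span {u}" "\<eta> u u = 0" "\<eta> v u = 0"
    and par: "if even m then m \<noteq> 4 \<and> m \<noteq> 6 \<and> \<eta> v v = 0 else \<eta> v v \<noteq> 0"
  shows "\<exists>f. attains_min f"
proof -
  have uv: "\<eta> u v = 0" using u hsym0 by blast
  define f where "f x = scale (\<eta> x u ^ q) v - scale (\<eta> x v ^ q) u" for x
  interpret f: alternating_map scale q m \<eta> f
  proof
    show "f (x + y) = f x + f y" for x y
      by (simp add: f_def hD cj_add scale_left_distrib)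
    show "f (scale c x) = scale (c ^ q) (f x)" for c x
      by (simp add: f_def hD power_mult_distrib scale_right_diff_distrib)
    show "\<eta> x (f x) = 0" for x by (simp add: f_def hdiff hD mult.commute)
  qed
  have f0: "f x = 0 \<longleftrightarrow> \<eta> x u = 0 \<and> \<eta> x v = 0" for x
  proof
    assume "f x = 0"
    hence e: "scale (\<eta> x u ^ q) v = scale (\<eta> x v ^ q) u" by (simp add: f_def)
    have 1: "\<eta> x u = 0"
    proof (rule ccontr)
      assume nz: "\<eta> x u \<noteq> 0"
      hence "v = scale (inverse (\<eta> x u ^ q)) (scale (\<eta> x u ^ q) v)" by simp
      hence "v = scale (inverse (\<eta> x u ^ q) * \<eta> x v ^ q) u" unfolding e by simp
      thus False using u(2) span_scale[OF span_base[of u "{u}"]] by (metis insertI1)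
    qed
    thus "\<eta> x u = 0 \<and> \<eta> x v = 0" using e u(1) by simp
  qed (simp add: f_def)
  have ker: "f.ker = perp (span {u, v})" unfolding f.ker_def perp_span by (auto simp: perp_def f0)
  have r: "f.r + 2 = m"
    using dim_perp[of "span {u, v}"] dim_span2[OF u(1,2)] by (simp add: f.r_def ker)
  let ?b = "\<eta> v v"
  have b: "?b ^ q = ?b" using form_self_Fq[OF herm, of v] by (simp add: Fq_def)
  have fu: "f u = 0" by (simp add: f0 u uv)
  have fv: "f v = - scale ?b u" by (simp add: f_def u b)
  have ff: "- f (f x) = scale (\<eta> x u * ?b) u" for x
  proof -
    have "f (f x) = scale (\<eta> x u) (f v) - scale (\<eta> x v) (f u)"
      by (subst (2) f_def) (simp add: f.f_diff f.f_scale)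
    thus ?thesis by (simp add: fu fv)
  qed
  have d: "f.d c = 0" if "c \<noteq> 0" for c
  proof -
    have "x = 0" if x: "scale (\<eta> x u * ?b) u = scale c x" for x
    proof -
      have "scale (inverse c) (scale (\<eta> x u * ?b) u) = scale (inverse c) (scale c x)" by (simp only: x)
      hence xx: "x = scale (inverse c * (\<eta> x u * ?b)) u" using \<open>c \<noteq> 0\<close> by simp
      have "\<eta> x u = 0" by (subst xx) (simp add: hD u)
      thus ?thesis using xx by simp
    qed
    hence "f.E c = {0}" by (auto simp: f.E_def ff)
    thus ?thesis by (simp add: f.d_def)
  qed
  have S: "f.S1 = 0" "f.S2 = 0" by (simp_all add: f.S1_def f.S2_def d)
  let ?a = "int q"
  have e: "2 * m + 2 * f.r = 4 * m - 4" "4 * m = 4 + (4 * m - 4)" using r m4 by auto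
  have e': "?a ^ (4 * m) = ?a ^ 4 * ?a ^ (4 * m - 4)" using e(2) by (metis power_add)
  have "card f.pairs = dmin q m * (q\<^sup>2 * (q\<^sup>2 - 1) * (q ^ 4 - 1))"
  proof (rule f.card_pairs_eqI, unfold S)
    have lhs: "?a ^ 8 * (?a ^ 4 - 1) * int (dmin q m) = (?a ^ 4 - 1) * (?a ^ 8 * int (dmin q m))" by simp
    show "?a ^ 8 * (?a ^ 4 - 1) * int (dmin q m) = ?a ^ (4 * m) - ?a ^ (2 * m + 2 * f.r)
      + (?a - 1) * (?a\<^sup>2 + 1) * ((- ?a) ^ (3 * m) - ?a ^ (2 * m) * (- ?a) ^ (f.r + f.t))
      - ?a ^ (2 * m) * (?a * (?a + 1) * 0 + ?a\<^sup>2 * (?a - 1) * 0)"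
    proof (cases "even m")
      case True
      hence "?b = 0" using par by simp
      hence "f.E 0 = UNIV" by (simp add: f.E_def ff)
      hence "f.r + f.t = m" using f.d_0 dimV by (simp add: f.d_def)
      moreover have "(- ?a) ^ (3 * m) = ?a ^ (2 * m) * (- ?a) ^ m"
      proof -
        have "(- ?a) ^ (3 * m) = (- ?a) ^ (2 * m) * (- ?a) ^ m"
          unfolding power_add[symmetric] by (rule arg_cong[of _ _ "power (- ?a)"]) simp
        thus ?thesis by simp
      qed
      ultimately show ?thesis using True par
        unfolding lhs dmin_int[OF q2 m4] e(1) e' by (simp add: algebra_simps)
    next
      case False
      hence "?b \<noteq> 0" using par by simp
      hence "f.E 0 = perp (span {u})" using u(1) unfolding perp_span
        by (auto simp: f.E_def ff perp_def)
      hence "f.d 0 + 1 = m" using dim_perp[of "span {u}"] dim_span1[OF u(1)] by (simp add: f.d_def)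
      hence rt: "f.r + f.t = m - 1" using f.d_0 by simp
      have "(- ?a) ^ (3 * m) = - (?a ^ (3 * m))" "(- ?a) ^ (m - 1) = ?a ^ (m - 1)"
        using False by (auto simp: power_minus_odd)
      moreover have "?a ^ (3 * m) = ?a * ?a ^ (3 * m - 1)" using m4 by (simp flip: power_Suc)
      moreover have "?a ^ (2 * m) * ?a ^ (m - 1) = ?a ^ (3 * m - 1)"
        unfolding power_add[symmetric] by (rule arg_cong[of _ _ "power ?a"]) (use m4 in simp)
      moreover have "m \<noteq> 4" "m \<noteq> 6" using False by auto
      ultimately show ?thesis using False
        unfolding lhs dmin_int[OF q2 m4] e(1) e' rt by (simp add: algebra_simps eval_nat_numeral)
    qed
  qed
  moreover have "\<exists>x. f x \<noteq> 0"
  proof (rule ccontr)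
    assume "\<not> ?thesis"
    hence "\<eta> x u = 0" for x using f0 by blast
    thus False using nondegD' u(1) by blast
  qed
  ultimately have "attains_min f"
    unfolding attains_min_def f.pairs_def using f.alternating_map_axioms by blast
  thus ?thesis by blast
qed

text \<open>The map sends e_{2j} to e_{2j+1} and e_{2j+1} to - e_{2j}, so the form is the standard
  symplectic one in an orthonormal basis. Then \<open>- f \<circ> f\<close> is the identity and V is
  the eigenspace for 1, which is the case of equality for r = 0 in
  \<open>main_bound\<close>.\<close>

lemma symplectic_attains_min:
  assumes m: "m = 4 \<or> m = 6"
  shows "\<exists>f. attains_min f"
proof -
  obtain e where on: "\<And>i j. i < m \<Longrightarrow> j < m \<Longrightarrow> \<eta> (e i) (e j) = (if i = j then 1 else 0)"
    and ex: "\<And>x. x = (\<Sum>i<m. scale (\<eta> x (e i)) (e i))"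
    using exists_orthonormal_basis by metis
  obtain k where k: "m = 2 * k" using m by auto
  define s :: "nat \<Rightarrow> 'f" where "s i = (if even i then 1 else - 1)" for i
  define \<sigma> :: "nat \<Rightarrow> nat" where "\<sigma> i = (if even i then i + 1 else i - 1)" for i
  have sq: "s i ^ q = s i" for i by (simp add: s_def cj_minus)
  have \<sigma>: "\<sigma> i < m" "\<sigma> (\<sigma> i) = i" "s i * s (\<sigma> i) = - 1" if "i < m" for i
    using that k by (auto simp: \<sigma>_def s_def elim!: evenE oddE)
  define f where "f x = (\<Sum>i<m. scale (s i * \<eta> x (e i) ^ q) (e (\<sigma> i)))" for x
  interpret f: alternating_map scale q m \<eta> f
  proof
    show "f (x + y) = f x + f y" for x y
      by (simp add: f_def hD cj_add distrib_left scale_left_distrib sum.distrib)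
    show "f (scale c x) = scale (c ^ q) (f x)" for c x
      by (simp add: f_def hD power_mult_distrib scale_sum_right mult.left_commute)
    fix x
    have "\<eta> x (f x) = (\<Sum>i<2 * k. s i * \<eta> x (e i) * \<eta> x (e (\<sigma> i)))"
      by (simp add: f_def hsum hD power_mult_distrib sq k)
    also have "\<dots> = 0"
      unfolding sum_lessThan_double by (rule sum.neutral) (simp add: s_def \<sigma>_def mult.commute)
    finally show "\<eta> x (f x) = 0" .
  qed
  have fe: "f (e j) = scale (s j) (e (\<sigma> j))" if "j < m" for j
  proof -
    have "f (e j) = (\<Sum>i<m. if i = j then scale (s i) (e (\<sigma> i)) else 0)"
      unfolding f_def by (rule sum.cong) (use that on in auto)
    thus ?thesis using that by (simp add: sum.delta)
  qed
  have fsum: "f (\<Sum>i\<in>I. z i) = (\<Sum>i\<in>I. f (z i))" for I and z :: "nat \<Rightarrow> 'v"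
    by (induction I rule: infinite_finite_induct) (simp_all add: f.f_add)
  have ff: "f (f x) = - x" for x
  proof -
    have "f (f x) = (\<Sum>i<m. f (scale (s i * \<eta> x (e i) ^ q) (e (\<sigma> i))))"
      by (subst (2) f_def) (rule fsum)
    also have "\<dots> = (\<Sum>i<m. - scale (\<eta> x (e i)) (e i))"
    proof (rule sum.cong[OF refl])
      fix i assume "i \<in> {..<m}"
      hence i: "i < m" by simp
      have "f (scale (s i * \<eta> x (e i) ^ q) (e (\<sigma> i))) = scale ((s i * s (\<sigma> i)) * \<eta> x (e i)) (e i)"
        using \<sigma>(1,2)[OF i] by (simp add: f.f_scale fe power_mult_distrib sq mult_ac)
      thus "f (scale (s i * \<eta> x (e i) ^ q) (e (\<sigma> i))) = - scale (\<eta> x (e i)) (e i)"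
        unfolding \<sigma>(3)[OF i] by simp
    qed
    also have "\<dots> = - x" unfolding sum_negf using ex[of x] by simp
    finally show ?thesis .
  qed
  have E: "f.E c = (if c = 1 then UNIV else {0})" for c
  proof -
    have "x = scale c x \<longleftrightarrow> c = 1 \<or> x = 0" for x
      using scale_cancel_right[of 1 x c] by auto
    thus ?thesis by (auto simp: f.E_def ff)
  qed
  hence d: "f.d c = (if c = 1 then m else 0)" for c by (simp add: f.d_def dimV)
  hence rt: "f.r = 0" "f.t = 0" using f.d_0 by simp_all
  have one: "1 \<in> Fq - {0}" by (simp add: Fq_def)
  have S1: "f.S1 = int q ^ m - 1"
    unfolding f.S1_def using sum.remove[OF _ one, of "\<lambda>c. int q ^ f.d c - 1"] by (simp add: d)
  have S2: "f.S2 = (- int q) ^ m - 1"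
    unfolding f.S2_def using sum.remove[OF _ one, of "\<lambda>c. (- int q) ^ f.d c - 1"] by (simp add: d)
  let ?a = "int q"
  have "card f.pairs = dmin q m * (q\<^sup>2 * (q\<^sup>2 - 1) * (q ^ 4 - 1))"
  proof (rule f.card_pairs_eqI, unfold S1 S2 rt)
    have lhs: "?a ^ 8 * (?a ^ 4 - 1) * int (dmin q m) = (?a ^ 4 - 1) * (?a ^ 8 * int (dmin q m))" by simp
    show "?a ^ 8 * (?a ^ 4 - 1) * int (dmin q m) = ?a ^ (4 * m) - ?a ^ (2 * m + 2 * 0)
      + (?a - 1) * (?a\<^sup>2 + 1) * ((- ?a) ^ (3 * m) - ?a ^ (2 * m) * (- ?a) ^ (0 + 0))
      - ?a ^ (2 * m) * (?a * (?a + 1) * (?a ^ m - 1) + ?a\<^sup>2 * (?a - 1) * ((- ?a) ^ m - 1))"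
      using m
    proof
      assume "m = 4"
      thus ?thesis unfolding lhs dmin_int[OF q2 m4]
        by (simp add: algebra_simps flip: power_Suc power_add)
    next
      assume "m = 6"
      thus ?thesis unfolding lhs dmin_int[OF q2 m4]
        by (simp add: algebra_simps flip: power_Suc power_add)
    qed
  qed
  moreover have "\<exists>x. f x \<noteq> 0"
  proof (rule ccontr)
    assume "\<not> ?thesis"
    hence "f.ker = UNIV" by (auto simp: f.ker_def)
    thus False using rt(1) dimV m4 by (simp add: f.r_def)
  qed
  ultimately have "attains_min f"
    unfolding attains_min_def f.pairs_def using f.alternating_map_axioms by blast
  thus ?thesis by blast
qed

lemma exists_attains_min: "\<exists>f. attains_min f"
proof -
  obtain e where on: "\<And>i j. i < m \<Longrightarrow> j < m \<Longrightarrow> \<eta> (e i) (e j) = (if i = j then 1 else 0)"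
    using exists_orthonormal_basis by metis
  have ij: "0 < m" "Suc 0 < m" "2 < m" "3 < m" using m4 by auto
  \<comment> \<open>A scalar of norm -1 turns two orthonormal vectors into an isotropic combination;
    it serves for both \<open>u\<close> and \<open>?v\<close>.\<close>
  have "- 1 \<in> Fq" by (simp add: Fq_def cj_minus)
  then obtain c where c: "nrm c = - 1" using exists_nrm by blast
  hence cc: "c ^ q * c = - 1" "c * c ^ q = - 1" by (simp_all add: nrm_def mult.commute)
  define u where "u = e 0 + scale c (e 1)"
  have uu: "\<eta> u u = 0" by (simp add: u_def hD on ij cc)
  have u0: "u \<noteq> 0"
  proof
    assume "u = 0"
    hence "\<eta> u (e 0) = 0" by simp
    thus False by (simp add: u_def hD on ij)
  qed
  have ns: "v \<notin> span {u}" if "\<eta> v (e 2) = 1" for v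
  proof
    assume "v \<in> span {u}"
    then obtain a where "v = scale a u" by (auto simp: span_singleton)
    hence "\<eta> v (e 2) = 0" by (simp add: u_def hD on ij)
    thus False using that by simp
  qed
  consider "m = 4 \<or> m = 6" | "even m" "m \<noteq> 4" "m \<noteq> 6" | "odd m" by blast
  thus ?thesis
  proof cases
    case 1
    thus ?thesis by (rule symplectic_attains_min)
  next
    case 2
    let ?v = "e 2 + scale c (e 3)"
    show ?thesis
      by (rule rank_two_attains_min[OF u0 ns uu, of ?v]) (use 2 in \<open>simp_all add: u_def hD on ij cc\<close>)
  next
    case 3
    show ?thesis
      by (rule rank_two_attains_min[OF u0 ns uu, of "e 2"]) (use 3 in \<open>simp_all add: u_def hD on ij cc\<close>)
  qed
qed

end

section \<open>The code\<close>

lemma card_less_pairs: "card {(i, j). i < j \<and> j < (m::nat)} = m choose 2"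
proof (induction m)
  case (Suc m)
  have "{(i, j). i < j \<and> j < Suc m} = {(i, j). i < j \<and> j < m} \<union> (\<lambda>i. (i, m)) ` {..<m}"
    by (auto simp: less_Suc_eq)
  moreover have "finite {(i, j). i < j \<and> j < m}"
    by (rule finite_subset[of _ "{..<m} \<times> {..<m}"]) auto
  moreover have "card ((\<lambda>i. (i, m)) ` {..<m}) = m" by (simp add: card_image inj_on_def)
  ultimately have "card {(i, j). i < j \<and> j < Suc m} = (m choose 2) + m"
    using Suc.IH by (simp add: card_Un_disjoint disjoint_iff image_iff)
  thus ?case by (simp add: numeral_2_eq_2)
qed simp

locale hermitian_exterior_square =
  hermitian_space scaleV q m \<eta> + ext: exterior_square scaleV scaleW wedge
  for scaleV :: "'f::{field,finite} \<Rightarrow> 'v::ab_group_add \<Rightarrow> 'v" and q m \<eta>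
    and scaleW :: "'f \<Rightarrow> 'w::ab_group_add \<Rightarrow> 'w" and wedge
begin

abbreviation functional :: "('w \<Rightarrow> 'f) \<Rightarrow> bool" where
  "functional \<phi> \<equiv> Vector_Spaces.linear scaleW (*) \<phi>"

section \<open>Functionals on the exterior square and fibres of the Pluecker embedding\<close>

lemma wedge_simps:
  "wedge (x + y) z = wedge x z + wedge y z" "wedge x (y + z) = wedge x y + wedge x z"
  "wedge (scaleV c x) y = scaleW c (wedge x y)" "wedge x (scaleV c y) = scaleW c (wedge x y)"
  "wedge x x = 0"
  using ext.wedge_alternating by (auto simp: alternating_bilinear_def Vector_Spaces.linear_iff)

lemma wedge_0 [simp]: "wedge 0 x = 0" "wedge x 0 = 0"
  using wedge_simps(3)[of 0 0 x] wedge_simps(4)[of x 0 0] by simp_all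

lemma wedge_anti: "wedge y x = - wedge x y"
proof -
  have "wedge y x + wedge x y = wedge (x + y) (x + y)"
    by (simp only: wedge_simps(1,2)) (simp add: wedge_simps(5) add.commute)
  also have "\<dots> = 0" by (rule wedge_simps(5))
  finally show ?thesis by (simp add: eq_neg_iff_add_eq_0)
qed

lemma wedge_sum: "wedge x (\<Sum>i\<in>I. z i) = (\<Sum>i\<in>I. wedge x (z i))"
  "wedge (\<Sum>i\<in>I. z i) x = (\<Sum>i\<in>I. wedge (z i) x)"
  by (induction I rule: infinite_finite_induct) (simp_all add: wedge_simps)

lemma functionalD:
  assumes "functional \<phi>"
  shows "\<phi> (x + y) = \<phi> x + \<phi> y" "\<phi> (scaleW c x) = c * \<phi> x" "\<phi> 0 = 0" "\<phi> (- x) = - \<phi> x"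
    "\<phi> (\<Sum>i\<in>I. z i) = (\<Sum>i\<in>I. \<phi> (z i))"
proof -
  interpret vector_space_pair scaleW "(*)"
    by (simp add: vector_space_pair_def ext.W.vector_space_axioms vector_space_field)
  show "\<phi> (x + y) = \<phi> x + \<phi> y" "\<phi> (scaleW c x) = c * \<phi> x" "\<phi> 0 = 0" "\<phi> (- x) = - \<phi> x"
    "\<phi> (\<Sum>i\<in>I. z i) = (\<Sum>i\<in>I. \<phi> (z i))"
    using linear_add[OF assms] linear_scale[OF assms] linear_0[OF assms] linear_neg[OF assms]
      linear_sum[OF assms] by auto
qed

lemma exists_functional:
  assumes "\<And>x y z. \<beta> (x + y) z = \<beta> x z + \<beta> y z" "\<And>x y z. \<beta> x (y + z) = \<beta> x y + \<beta> x z"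
    and "\<And>c x y. \<beta> (scaleV c x) y = c * \<beta> x y" "\<And>c x y. \<beta> x (scaleV c y) = c * \<beta> x y"
    and "\<And>x. \<beta> x x = 0"
  shows "\<exists>\<phi>. functional \<phi> \<and> (\<forall>x y. \<phi> (wedge x y) = \<beta> x y)"
proof -
  have "alternating_bilinear scaleV (*) \<beta>"
    by (simp add: alternating_bilinear_def Vector_Spaces.linear_iff assms vector_space_axioms
        vector_space_field)
  from ext.universal_form[OF this] show ?thesis by blast
qed

lemma functional_eqI:
  assumes "functional \<phi>" "functional \<psi>" "\<And>x y. \<phi> (wedge x y) = \<psi> (wedge x y)"
  shows "\<phi> = \<psi>"
proof -
  have "alternating_bilinear scaleV (*) (\<lambda>x y. \<phi> (wedge x y))"
    by (simp add: alternating_bilinear_def Vector_Spaces.linear_iff vector_space_axioms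
        vector_space_field wedge_simps functionalD[OF assms(1)])
  from ext.universal_form[OF this] show ?thesis using assms by metis
qed

lemma exists_functional_product:
  assumes "Vector_Spaces.linear scaleV (*) l" "Vector_Spaces.linear scaleV (*) k"
  shows "\<exists>\<phi>. functional \<phi> \<and> (\<forall>x y. \<phi> (wedge x y) = l x * k y - l y * k x)"
  using assms
  by (intro exists_functional) (simp_all add: Vector_Spaces.linear_iff algebra_simps)

text \<open>If \<open>x'\<close> lay outside the span, there would be a linear form \<open>l\<close>
  that is 1 at \<open>x'\<close> and 0 at \<open>x\<close> and \<open>y\<close>. Wedged with a form
  \<open>k\<close> that is 0 at \<open>x'\<close> and 1 at \<open>y'\<close>, it gives a functional
  that is 1 on \<open>wedge x' y'\<close> but 0 on \<open>wedge x y\<close>.\<close>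

lemma wedge_eq_scale_imp_mem:
  assumes xy: "x' \<noteq> 0" "y' \<notin> span {x'}" and e: "wedge x' y' = scaleW c (wedge x y)"
  shows "x' \<in> span {x, y}"
proof (rule ccontr)
  assume "x' \<notin> span {x, y}"
  then obtain l where l: "Vector_Spaces.linear scaleV (*) l" "l x = 0" "l y = 0" "l x' = 1"
    using functional_separates[OF vector_space_axioms] by (metis insert_iff)
  obtain k where k: "Vector_Spaces.linear scaleV (*) k" "k x' = 0" "k y' = 1"
    using functional_separates[OF vector_space_axioms xy(2)] by auto
  obtain \<phi> where \<phi>: "functional \<phi>" "\<And>x y. \<phi> (wedge x y) = l x * k y - l y * k x"
    using exists_functional_product[OF l(1) k(1)] by blast
  have "\<phi> (wedge x' y') = c * \<phi> (wedge x y)" unfolding e by (rule functionalD(2)[OF \<phi>(1)])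
  thus False by (simp add: \<phi>(2) l k)
qed

lemma wedge_eq_0_iff: "wedge x y = 0 \<longleftrightarrow> x = 0 \<or> y \<in> span {x}"
proof
  assume e: "wedge x y = 0"
  show "x = 0 \<or> y \<in> span {x}"
  proof (rule ccontr)
    assume n: "\<not> ?thesis"
    \<comment> \<open>A vanishing wedge is a multiple of \<open>wedge 0 0\<close>, so the previous
      lemma places \<open>x\<close> in the zero space.\<close>
    hence "x \<in> span {0, 0}" using wedge_eq_scale_imp_mem[of x y 0 0 0] e by simp
    thus False using n by simp
  qed
next
  assume "x = 0 \<or> y \<in> span {x}"
  thus "wedge x y = 0" by (auto simp: span_singleton wedge_simps)
qed

definition point :: "'v \<times> 'v \<Rightarrow> 'w set" where
  "point p = proj_point scaleW (wedge (fst p) (snd p))"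

definition indep :: "('v \<times> 'v) set" where
  "indep = {(x, y). x \<noteq> 0 \<and> y \<notin> span {x}}"

lemma indep_iff: "(x, y) \<in> indep \<longleftrightarrow> wedge x y \<noteq> 0"
  by (simp add: indep_def wedge_eq_0_iff)

lemma proj_point_eq_iff:
  assumes "a \<noteq> 0"
  shows "proj_point scaleW b = proj_point scaleW a \<longleftrightarrow> (\<exists>c. c \<noteq> 0 \<and> b = scaleW c a)"
proof
  assume e: "proj_point scaleW b = proj_point scaleW a"
  have "b \<in> ext.W.span {a}" "a \<in> ext.W.span {b}"
    using e ext.W.span_base[of b "{b}"] ext.W.span_base[of a "{a}"] by (auto simp: proj_point_def)
  then obtain c c' where "b = scaleW c a" "a = scaleW c' b"
    unfolding ext.W.span_singleton by blast
  thus "\<exists>c. c \<noteq> 0 \<and> b = scaleW c a" using assms by (intro exI[of _ c]) auto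
next
  assume "\<exists>c. c \<noteq> 0 \<and> b = scaleW c a"
  then obtain c where c: "c \<noteq> 0" "b = scaleW c a" by blast
  have "\<exists>k'. scaleW k a = scaleW k' b" for k
    using c by (intro exI[of _ "k / c"]) simp
  thus "proj_point scaleW b = proj_point scaleW a"
    using c by (auto simp: proj_point_def ext.W.span_singleton image_iff)
qed

text \<open>Injectivity of the Pluecker embedding: the fibre consists of the ordered bases of
  \<open>span {x, y}\<close>. One inclusion applies \<open>wedge_eq_scale_imp_mem\<close> to the
  pair and to the exchanged pair; the other is the determinant \<open>a * d - b * c\<close> of a
  change of basis.\<close>

lemma fiber:
  assumes "(x, y) \<in> indep"
  shows "{p \<in> indep. point p = point (x, y)} = Sigma (span {x, y} - {0}) (\<lambda>x'. span {x, y} - span {x'})"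
proof (intro equalityI subsetI)
  have nz: "wedge x y \<noteq> 0" using assms indep_iff by blast
  {
    fix p assume p: "p \<in> {p \<in> indep. point p = point (x, y)}"
    obtain x' y' where xy': "p = (x', y')" by (cases p)
    have i: "x' \<noteq> 0" "y' \<notin> span {x'}" using p by (auto simp: xy' indep_def)
    obtain c where c: "c \<noteq> 0" "wedge x' y' = scaleW c (wedge x y)"
      using p proj_point_eq_iff[OF nz] by (auto simp: xy' point_def)
    have x'L: "x' \<in> span {x, y}" by (rule wedge_eq_scale_imp_mem[OF i c(2)])
    have e: "wedge y' x' = scaleW (- c) (wedge x y)" by (simp add: wedge_anti[of y' x'] c)
    have "(y', x') \<in> indep"
      using p by (simp add: xy' indep_iff wedge_anti[of y' x'])
    hence "y' \<noteq> 0" "x' \<notin> span {y'}" by (auto simp: indep_def)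
    hence "y' \<in> span {x, y}" by (rule wedge_eq_scale_imp_mem[OF _ _ e])
    thus "p \<in> Sigma (span {x, y} - {0}) (\<lambda>x'. span {x, y} - span {x'})"
      using i x'L by (simp add: xy')
  }
  {
    fix p assume p: "p \<in> Sigma (span {x, y} - {0}) (\<lambda>x'. span {x, y} - span {x'})"
    obtain x' y' where xy': "p = (x', y')" by (cases p)
    obtain a b where ab: "x' = scaleV a x + scaleV b y"
      using p span_pair_iff[OF vector_space_axioms] by (auto simp: xy')
    obtain c d where cd: "y' = scaleV c x + scaleV d y"
      using p span_pair_iff[OF vector_space_axioms] by (auto simp: xy')
    have e: "wedge x' y' = scaleW (a * d - b * c) (wedge x y)"
      unfolding ab cd wedge_simps wedge_anti[of y x]
      by (simp add: ext.W.scale_left_diff_distrib mult_ac)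
    have i: "p \<in> indep" using p by (auto simp: xy' indep_def)
    hence "wedge x' y' \<noteq> 0" by (simp add: xy' indep_iff)
    hence "a * d - b * c \<noteq> 0" using e by auto
    hence "point p = point (x, y)"
      unfolding xy' point_def fst_conv snd_conv proj_point_eq_iff[OF nz] using e by blast
    thus "p \<in> {p \<in> indep. point p = point (x, y)}" using i by simp
  }
qed

text \<open>The order of GL_2(q^2).\<close>

definition frames :: nat where "frames = (q ^ 4 - 1) * (q ^ 4 - q\<^sup>2)"

lemma card_fiber:
  assumes "(x, y) \<in> indep"
  shows "card {p \<in> indep. point p = point (x, y)} = frames"
proof -
  let ?L = "span {x, y}"
  have "dim ?L = 2" using assms dim_span2 by (simp add: indep_def)
  hence L: "card ?L = q ^ 4" using card_sub[of ?L] by simp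
  have "card (?L - span {x'}) = q ^ 4 - q\<^sup>2" if "x' \<in> ?L - {0}" for x'
  proof -
    have "span {x'} \<subseteq> ?L" using that by (intro span_minimal) auto
    moreover have "card (span {x'}) = q\<^sup>2" using card_sub[of "span {x'}"] dim_span1[of x'] that by simp
    ultimately show ?thesis by (simp add: card_Diff_subset L)
  qed
  hence "card (Sigma (?L - {0}) (\<lambda>x'. ?L - span {x'})) = (\<Sum>x'\<in>?L - {0}. q ^ 4 - q\<^sup>2)"
    by (simp del: sum_constant)
  also have "\<dots> = card (?L - {0}) * (q ^ 4 - q\<^sup>2)" by simp
  also have "card (?L - {0}) = card ?L - 1" by (rule card_Diff_singleton) (rule span_zero)
  also have "(card ?L - 1) * (q ^ 4 - q\<^sup>2) = frames" unfolding L frames_def ..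
  finally show ?thesis by (simp add: fiber[OF assms])
qed

section \<open>Ordered bases of isotropic lines and the length of the code\<close>

definition isotropic_pairs :: "('v \<times> 'v) set" where
  "isotropic_pairs = {(x, y). x \<in> iso \<and> y \<in> iso \<and> \<eta> y x = 0 \<and> x \<noteq> 0 \<and> y \<notin> span {x}}"

lemma isotropic_pairs_indep: "isotropic_pairs \<subseteq> indep"
  by (auto simp: isotropic_pairs_def indep_def)

lemma isotropic_span:
  assumes "(x, y) \<in> isotropic_pairs" "a \<in> span {x, y}" "b \<in> span {x, y}"
  shows "\<eta> a b = 0"
proof -
  have z: "\<eta> x x = 0" "\<eta> y y = 0" "\<eta> y x = 0" "\<eta> x y = 0"
    using assms(1) hsym0 by (auto simp: isotropic_pairs_def iso_def)
  obtain c d c' d' where "a = scaleV c x + scaleV d y" "b = scaleV c' x + scaleV d' y"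
    using assms span_pair_iff[OF vector_space_axioms] by metis
  thus ?thesis by (simp add: hD z)
qed

lemma isotropic_lines_iff:
  "span {x, y} \<in> isotropic_lines scaleV \<eta> \<longleftrightarrow> (x, y) \<in> isotropic_pairs"
proof
  assume a: "span {x, y} \<in> isotropic_lines scaleV \<eta>"
  hence d: "dim (span {x, y}) = 2" and t: "\<And>u v. u \<in> span {x, y} \<Longrightarrow> v \<in> span {x, y} \<Longrightarrow> \<eta> u v = 0"
    by (auto simp: isotropic_lines_def totally_isotropic_def)
  have "x \<noteq> 0 \<and> y \<notin> span {x}"
  proof (rule ccontr)
    assume "\<not> ?thesis"
    hence "span {x, y} = span {y} \<or> span {x, y} = span {x}"
      using span_redundant[of y "{x}"] span_insert_0[of "{y}"] by (auto simp: insert_commute)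
    moreover have "dim (span {z}) \<le> 1" for z
      using dim_le_card[of "span {z}" "{z}"] by simp
    ultimately show False using d by (metis Suc_1 not_less_eq_eq order_refl)
  qed
  moreover have "x \<in> span {x, y}" "y \<in> span {x, y}" by (auto intro: span_base)
  ultimately show "(x, y) \<in> isotropic_pairs" using t by (simp add: isotropic_pairs_def iso_def)
next
  assume a: "(x, y) \<in> isotropic_pairs"
  hence "dim (span {x, y}) = 2" using dim_span2 by (simp add: isotropic_pairs_def)
  thus "span {x, y} \<in> isotropic_lines scaleV \<eta>"
    using isotropic_span[OF a] by (simp add: isotropic_lines_def totally_isotropic_def)
qed

abbreviation \<Omega> :: "'w set set" where "\<Omega> \<equiv> isotropic_line_points scaleV scaleW wedge \<eta>"

lemma \<Omega>_eq: "\<Omega> = point ` isotropic_pairs"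
  unfolding isotropic_line_points_def isotropic_lines_iff point_def by force

text \<open>Every other ordered basis of a totally isotropic line is again an isotropic pair, so
  passing to isotropic pairs keeps or drops entire fibres.\<close>

lemma isotropic_fiber:
  assumes "p \<in> isotropic_pairs"
  shows "{p' \<in> isotropic_pairs. point p' = point p} = {p' \<in> indep. point p' = point p}"
proof -
  obtain x y where p: "p = (x, y)" by (cases p)
  have i: "(x, y) \<in> indep" using assms isotropic_pairs_indep p by blast
  have "p' \<in> isotropic_pairs" if "p' \<in> indep" "point p' = point p" for p'
  proof -
    obtain x' y' where p': "p' = (x', y')" by (cases p')
    have "p' \<in> {p \<in> indep. point p = point (x, y)}" using that p by simp
    hence "p' \<in> Sigma (span {x, y} - {0}) (\<lambda>x'. span {x, y} - span {x'})"
      unfolding fiber[OF i] .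
    hence m: "x' \<in> span {x, y}" "y' \<in> span {x, y}" "x' \<noteq> 0" "y' \<notin> span {x'}" by (simp_all add: p')
    note z = isotropic_span[OF assms[unfolded p]]
    show ?thesis
      using z[OF m(1,1)] z[OF m(2,2)] z[OF m(2,1)] m(3,4) by (simp add: p' isotropic_pairs_def iso_def)
  qed
  thus ?thesis using isotropic_pairs_indep by blast
qed

text \<open>The predicate \<open>R\<close> lets one argument serve twice: the constant true gives
  the length of the code, nonvanishing of a functional gives its weight.\<close>

lemma card_points:
  "card {p \<in> isotropic_pairs. R (point p)} = card {P \<in> \<Omega>. R P} * frames"
proof -
  have fin: "finite (A :: ('v \<times> 'v) set)" for A
    by (rule finite_subset[OF _ finite_cartesian_product[OF finV[of UNIV] finV[of UNIV]]]) simp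
  let ?A = "{p \<in> isotropic_pairs. R (point p)}"
  have im: "point ` ?A = {P \<in> \<Omega>. R P}" by (auto simp: \<Omega>_eq)
  have "card ?A = (\<Sum>P\<in>point ` ?A. card {p \<in> ?A. point p = P})"
    using sum.image_gen[OF fin, of "\<lambda>_. 1::nat" ?A point] by simp
  also have "\<dots> = (\<Sum>P\<in>point ` ?A. frames)"
  proof (rule sum.cong[OF refl])
    fix P assume "P \<in> point ` ?A"
    then obtain p where p: "p \<in> isotropic_pairs" "R (point p)" "P = point p" by auto
    have "{p' \<in> ?A. point p' = P} = {p' \<in> indep. point p' = point p}"
      using isotropic_fiber[OF p(1)] p by auto
    thus "card {p' \<in> ?A. point p' = P} = frames"
      using card_fiber[of "fst p" "snd p"] p isotropic_pairs_indep by auto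
  qed
  finally show ?thesis by (simp add: im)
qed

lemma number_of_points:
  "rat_of_nat (card \<Omega>) =
     (of_nat q ^ m + (- 1) ^ (m - 1)) * (of_nat q ^ (m - 1) - (- 1) ^ (m - 1)) *
     (of_nat q ^ (m - 2) + (- 1) ^ (m - 3)) * (of_nat q ^ (m - 3) - (- 1) ^ (m - 3)) /
     ((of_nat q ^ 2 - 1) ^ 2 * (of_nat q ^ 2 + 1))"
proof -
  let ?a = "rat_of_nat q"
  have a: "2 \<le> ?a" using q2 by (metis of_nat_le_iff of_nat_numeral)
  have "m = (m - 3) + 3" using m4 by simp
  then obtain n where n: "m = n + 3" by blast
  \<comment> \<open>With n = m - 3 both signs in the claim equal \<open>e\<close>. The relation
    \<open>e * e = 1\<close> allows the isolated terms \<open>?a\<close> and \<open>?a ^ 5\<close>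
    to be rewritten so that the two quadratics in \<open>y\<close> split in \<open>f1\<close> and
    \<open>f2\<close>.\<close>
  define e where "e = (- 1 :: rat) ^ n"
  define y where "y = ?a ^ n"
  have ee: "e * e = 1" by (simp add: e_def flip: power_mult_distrib)
  have "card \<Omega> * frames = card isotropic_pairs" using card_points[of "\<lambda>_. True"] by simp
  hence "int q ^ 4 * (int (card \<Omega>) * int frames) =
   (int q ^ (2 * m) + (int q - 1) * (- int q) ^ m - int q) *
   (int q ^ (2 * m) + (int q)\<^sup>2 * (int q - 1) * (- int q) ^ m - int q ^ 5)"
    using card_isotropic_pairs unfolding isotropic_pairs_def by (simp flip: of_nat_mult)
  hence "rat_of_int (int q ^ 4 * (int (card \<Omega>) * int frames)) = rat_of_int (
   (int q ^ (2 * m) + (int q - 1) * (- int q) ^ m - int q) *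
   (int q ^ (2 * m) + (int q)\<^sup>2 * (int q - 1) * (- int q) ^ m - int q ^ 5))" by (rule arg_cong)
  hence "?a ^ 4 * (rat_of_nat (card \<Omega>) * rat_of_nat frames) =
   (?a ^ (2 * m) + (?a - 1) * (- ?a) ^ m - ?a) *
   (?a ^ (2 * m) + ?a\<^sup>2 * (?a - 1) * (- ?a) ^ m - ?a ^ 5)" by simp
  moreover have "(- ?a) ^ m = - e * y * ?a ^ 3"
    by (simp add: n e_def y_def power_add power_minus[of ?a n] eval_nat_numeral)
  moreover have "?a ^ (2 * m) = y * y * ?a ^ 6"
    by (simp add: n y_def flip: power_add)
  moreover have "q\<^sup>2 \<le> q ^ 4" using q2 by (intro power_increasing) auto
  hence "rat_of_nat frames = (?a ^ 4 - 1) * (?a ^ 4 - ?a\<^sup>2)"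
    using q2 by (simp add: frames_def of_nat_diff one_le_power)
  ultimately have eq: "?a ^ 4 * (rat_of_nat (card \<Omega>) * ((?a ^ 4 - 1) * (?a ^ 4 - ?a\<^sup>2))) =
   (y * y * ?a ^ 6 - (?a - 1) * e * y * ?a ^ 3 - ?a) *
   (y * y * ?a ^ 6 - ?a\<^sup>2 * (?a - 1) * e * y * ?a ^ 3 - ?a ^ 5)"
    by (simp add: algebra_simps)
  have f1: "y * y * ?a ^ 6 - (?a - 1) * e * y * ?a ^ 3 - ?a = ?a * ((y * ?a ^ 3 + e) * (y * ?a ^ 2 - e))"
  proof -
    have "?a * ((y * ?a ^ 3 + e) * (y * ?a ^ 2 - e)) = y * y * ?a ^ 6 - (?a - 1) * e * y * ?a ^ 3 - ?a * (e * e)"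
      by (simp add: algebra_simps eval_nat_numeral)
    thus ?thesis by (simp add: ee)
  qed
  have f2: "y * y * ?a ^ 6 - ?a\<^sup>2 * (?a - 1) * e * y * ?a ^ 3 - ?a ^ 5 = ?a ^ 5 * ((y * ?a + e) * (y - e))"
  proof -
    have "?a ^ 5 * ((y * ?a + e) * (y - e)) = y * y * ?a ^ 6 - ?a\<^sup>2 * (?a - 1) * e * y * ?a ^ 3 - ?a ^ 5 * (e * e)"
      by (simp add: algebra_simps eval_nat_numeral)
    thus ?thesis by (simp add: ee)
  qed
  have "?a ^ 6 * (rat_of_nat (card \<Omega>) * ((?a ^ 2 - 1) ^ 2 * (?a ^ 2 + 1))) =
      ?a ^ 4 * (rat_of_nat (card \<Omega>) * ((?a ^ 4 - 1) * (?a ^ 4 - ?a\<^sup>2)))"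
    by (simp add: algebra_simps eval_nat_numeral)
  also have "\<dots> = ?a ^ 6 * ((y * ?a ^ 3 + e) * (y * ?a ^ 2 - e) * (y * ?a + e) * (y - e))"
    unfolding eq f1 f2 by (simp add: eval_nat_numeral)
  finally have "rat_of_nat (card \<Omega>) * ((?a ^ 2 - 1) ^ 2 * (?a ^ 2 + 1)) =
      (y * ?a ^ 3 + e) * (y * ?a ^ 2 - e) * (y * ?a + e) * (y - e)"
    using a by simp
  moreover have "(?a ^ 2 - 1) ^ 2 * (?a ^ 2 + 1) \<noteq> 0"
  proof -
    have "1 < ?a ^ 2" using a by (intro one_less_power) auto
    thus ?thesis by auto
  qed
  ultimately have "rat_of_nat (card \<Omega>) =
      (y * ?a ^ 3 + e) * (y * ?a ^ 2 - e) * (y * ?a + e) * (y - e) / ((?a ^ 2 - 1) ^ 2 * (?a ^ 2 + 1))"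
    by (simp add: eq_divide_eq)
  moreover have "?a ^ m = y * ?a ^ 3" "?a ^ (m - 1) = y * ?a ^ 2" "?a ^ (m - 2) = y * ?a" "?a ^ (m - 3) = y"
    "(- 1 :: rat) ^ (m - 1) = e" "(- 1 :: rat) ^ (m - 3) = e"
    unfolding n y_def e_def by (simp_all add: power_add eval_nat_numeral)
  ultimately show ?thesis by simp
qed

text \<open>Riesz representation in an orthonormal basis: the q-th power on the coordinates undoes
  the semilinearity of the second argument and makes \<open>f\<close> semilinear.\<close>

lemma functional_map:
  assumes \<phi>: "functional \<phi>"
  obtains f where "alternating_map scaleV q m \<eta> f" "\<And>x y. \<eta> y (f x) = \<phi> (wedge x y)"
proof -
  obtain e where ex: "\<And>x. x = (\<Sum>i<m. scaleV (\<eta> x (e i)) (e i))"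
    using exists_orthonormal_basis by metis
  define f where "f x = (\<Sum>i<m. scaleV (\<phi> (wedge x (e i)) ^ q) (e i))" for x
  have f: "\<eta> y (f x) = \<phi> (wedge x y)" for x y
  proof -
    have "\<eta> y (f x) = (\<Sum>i<m. \<phi> (wedge x (e i)) * \<eta> y (e i))"
      by (simp add: f_def hsum hD)
    also have "\<dots> = \<phi> (wedge x (\<Sum>i<m. scaleV (\<eta> y (e i)) (e i)))"
      by (simp add: wedge_sum wedge_simps functionalD[OF \<phi>] mult.commute)
    finally show ?thesis using ex[of y] by simp
  qed
  have "alternating_map scaleV q m \<eta> f"
  proof
    show "f (x + y) = f x + f y" for x y
      by (simp add: f_def wedge_simps functionalD[OF \<phi>] cj_add scale_left_distrib sum.distrib)
    show "f (scaleV c x) = scaleV (c ^ q) (f x)" for c x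
      by (simp add: f_def wedge_simps functionalD[OF \<phi>] power_mult_distrib scale_sum_right)
    show "\<eta> x (f x) = 0" for x by (simp add: f wedge_simps functionalD[OF \<phi>])
  qed
  thus ?thesis using f that by blast
qed

text \<open>Stated on points as sets, so that it does not depend on the representatives
  \<open>\<omega>\<close> used for the code.\<close>

definition weight :: "('w \<Rightarrow> 'f) \<Rightarrow> nat" where
  "weight \<phi> = card {P \<in> \<Omega>. \<exists>w\<in>P. \<phi> w \<noteq> 0}"

lemma weight_frames:
  assumes \<phi>: "functional \<phi>"
  shows "weight \<phi> * frames =
    card {(x, y). x \<in> iso \<and> y \<in> iso \<and> \<eta> y x = 0 \<and> \<phi> (wedge x y) \<noteq> 0}"
proof -
  have "(\<exists>w\<in>point p. \<phi> w \<noteq> 0) \<longleftrightarrow> \<phi> (wedge (fst p) (snd p)) \<noteq> 0" for p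
    by (auto simp: point_def proj_point_def ext.W.span_singleton functionalD[OF \<phi>]
        intro!: exI[of _ 1])
  \<comment> \<open>A nonzero value on the wedge forces linear independence, so the pairs in the
    claim are automatically ordered bases of isotropic lines.\<close>
  moreover have "\<phi> (wedge x y) \<noteq> 0 \<Longrightarrow> x \<noteq> 0 \<and> y \<notin> span {x}" for x y
    using wedge_eq_0_iff[of x y] functionalD(3)[OF \<phi>] by auto
  ultimately have "{(x, y). x \<in> iso \<and> y \<in> iso \<and> \<eta> y x = 0 \<and> \<phi> (wedge x y) \<noteq> 0} =
      {p \<in> isotropic_pairs. \<exists>w\<in>point p. \<phi> w \<noteq> 0}"
    by (auto simp: isotropic_pairs_def functionalD(3)[OF \<phi>])
  thus ?thesis using card_points[of "\<lambda>P. \<exists>w\<in>P. \<phi> w \<noteq> 0"] by (simp add: weight_def)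
qed

lemma frames_eq: "q\<^sup>2 * (q\<^sup>2 - 1) * (q ^ 4 - 1) = frames"
proof -
  have "q ^ 4 - q\<^sup>2 = q\<^sup>2 * (q\<^sup>2 - 1)" by (simp add: right_diff_distrib' eval_nat_numeral)
  thus ?thesis by (simp add: frames_def mult.commute)
qed

lemma frames_pos: "0 < frames"
proof -
  have "q ^ 2 < q ^ 4" using q2 by (intro power_strict_increasing) auto
  moreover have "1 < q ^ 4" using q2 by (intro one_less_power) auto
  ultimately show ?thesis by (simp add: frames_def)
qed

lemma weight_ge:
  assumes \<phi>: "functional \<phi>" and nz: "\<phi> \<noteq> (\<lambda>_. 0)"
  shows "dmin q m \<le> weight \<phi>"
proof -
  obtain f where f: "alternating_map scaleV q m \<eta> f" "\<And>x y. \<eta> y (f x) = \<phi> (wedge x y)"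
    using functional_map[OF \<phi>] by blast
  interpret f: alternating_map scaleV q m \<eta> f by fact
  have "\<exists>x. f x \<noteq> 0"
  proof (rule ccontr)
    assume "\<not> ?thesis"
    hence "\<phi> (wedge x y) = 0" for x y using f(2)[of y x] by simp
    moreover have "functional (\<lambda>_. 0)"
      by (simp add: Vector_Spaces.linear_iff ext.W.vector_space_axioms vector_space_field)
    ultimately have "\<phi> = (\<lambda>_. 0)" by (intro functional_eqI[OF \<phi>]) auto
    thus False using nz by simp
  qed
  hence "dmin q m * frames \<le> card f.pairs" by (rule f.card_pairs_ge[unfolded frames_eq])
  also have "\<dots> = weight \<phi> * frames" by (simp add: weight_frames[OF \<phi>] f.pairs_def f(2))
  finally show ?thesis using frames_pos by simp
qed

lemma exists_weight_eq: "\<exists>\<phi>. functional \<phi> \<and> \<phi> \<noteq> (\<lambda>_. 0) \<and> weight \<phi> = dmin q m"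
proof -
  obtain f where f: "attains_min f" using exists_attains_min by blast
  then interpret f: alternating_map scaleV q m \<eta> f by (simp add: attains_min_def)
  have "\<exists>\<phi>. functional \<phi> \<and> (\<forall>x y. \<phi> (wedge x y) = \<eta> y (f x))"
    by (rule exists_functional) (simp_all add: hD f.f_add f.f_scale f.f_alt)
  then obtain \<phi> where \<phi>: "functional \<phi>" "\<And>x y. \<phi> (wedge x y) = \<eta> y (f x)" by blast
  have "weight \<phi> * frames = dmin q m * frames"
    using f unfolding weight_frames[OF \<phi>(1)] \<phi>(2) attains_min_def frames_eq by blast
  hence "weight \<phi> = dmin q m" using frames_pos by simp
  moreover obtain x where "f x \<noteq> 0" using f by (auto simp: attains_min_def)
  then obtain y where "\<eta> y (f x) \<noteq> 0" using nondegD' by blast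
  hence "\<phi> \<noteq> (\<lambda>_. 0)" using \<phi>(2) by metis
  ultimately show ?thesis using \<phi>(1) by blast
qed

lemma dmin_pos: "0 < dmin q m"
proof -
  have "q ^ (2 * m - 6) < q ^ (4 * m - 12)" "q ^ (3 * m - 9) < q ^ (4 * m - 12)"
    using q2 m4 by (auto intro!: power_strict_increasing)
  thus ?thesis using q2 by (simp add: dmin_def)
qed

text \<open>A functional amounts to a free choice of values on the wedges of basis vectors with i <
  j. The cardinality is what later determines the dimension of the code.\<close>

lemma card_functionals:
  "finite {\<phi>. functional \<phi>} \<and> card {\<phi>. functional \<phi>} = (q\<^sup>2) ^ (m choose 2)"
proof -
  obtain e where on: "\<And>i j. i < m \<Longrightarrow> j < m \<Longrightarrow> \<eta> (e i) (e j) = (if i = j then 1 else 0)"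
    and ex: "\<And>x. x = (\<Sum>i<m. scaleV (\<eta> x (e i)) (e i))"
    using exists_orthonormal_basis by metis
  define P where "P = {(i, j). i < j \<and> j < m}"
  have finP: "finite P" unfolding P_def
    by (rule finite_subset[of _ "{..<m} \<times> {..<m}"]) auto
  define ev where "ev \<phi> = restrict (\<lambda>p. \<phi> (wedge (e (fst p)) (e (snd p)))) P" for \<phi> :: "'w \<Rightarrow> 'f"
  have "bij_betw ev {\<phi>. functional \<phi>} (P \<rightarrow>\<^sub>E UNIV)"
    unfolding bij_betw_def
  proof
    show "inj_on ev {\<phi>. functional \<phi>}"
    proof (rule inj_onI)
      fix \<phi> \<psi> assume "\<phi> \<in> {\<phi>. functional \<phi>}" "\<psi> \<in> {\<phi>. functional \<phi>}" and eq: "ev \<phi> = ev \<psi>"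
      hence \<phi>: "functional \<phi>" and \<psi>: "functional \<psi>" by auto
      have less: "\<phi> (wedge (e i) (e j)) = \<psi> (wedge (e i) (e j))" if "i < j" "j < m" for i j
        using fun_cong[OF eq, of "(i, j)"] that by (simp add: ev_def P_def)
      have all: "\<phi> (wedge (e i) (e j)) = \<psi> (wedge (e i) (e j))" if "i < m" "j < m" for i j
      proof (cases i j rule: linorder_cases)
        case greater
        thus ?thesis using less[of j i] that wedge_anti[of "e i" "e j"]
          by (simp add: functionalD[OF \<phi>] functionalD[OF \<psi>])
      qed (use less that in \<open>auto simp: wedge_simps functionalD[OF \<phi>] functionalD[OF \<psi>]\<close>)
      show "\<phi> = \<psi>"
      proof (rule functional_eqI[OF \<phi> \<psi>])
        fix x y
        have w: "wedge x y = (\<Sum>i<m. \<Sum>j<m. scaleW (\<eta> y (e i)) (scaleW (\<eta> x (e j)) (wedge (e j) (e i))))"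
          by (subst ex[of x], subst ex[of y])
            (simp add: wedge_sum wedge_simps ext.W.scale_sum_right)
        show "\<phi> (wedge x y) = \<psi> (wedge x y)"
          unfolding w functionalD(5)[OF \<phi>] functionalD(5)[OF \<psi>] functionalD(2)[OF \<phi>] functionalD(2)[OF \<psi>]
          by (intro sum.cong refl) (simp add: all)
      qed
    qed
    show "ev ` {\<phi>. functional \<phi>} = P \<rightarrow>\<^sub>E UNIV"
    proof (intro equalityI subsetI)
      fix h assume h: "h \<in> P \<rightarrow>\<^sub>E (UNIV :: 'f set)"
      define \<beta> where "\<beta> x y = (\<Sum>p\<in>P. h p *
        (\<eta> x (e (fst p)) * \<eta> y (e (snd p)) - \<eta> x (e (snd p)) * \<eta> y (e (fst p))))" for x y
      have "\<exists>\<phi>. functional \<phi> \<and> (\<forall>x y. \<phi> (wedge x y) = \<beta> x y)"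
      proof (rule exists_functional)
        show "\<beta> (x + y) z = \<beta> x z + \<beta> y z" for x y z
          unfolding \<beta>_def sum.distrib[symmetric] by (rule sum.cong) (auto simp: hD algebra_simps)
        show "\<beta> x (y + z) = \<beta> x y + \<beta> x z" for x y z
          unfolding \<beta>_def sum.distrib[symmetric] by (rule sum.cong) (auto simp: hD algebra_simps)
        show "\<beta> (scaleV c x) y = c * \<beta> x y" for c x y
          unfolding \<beta>_def sum_distrib_left by (rule sum.cong) (auto simp: hD algebra_simps)
        show "\<beta> x (scaleV c y) = c * \<beta> x y" for c x y
          unfolding \<beta>_def sum_distrib_left by (rule sum.cong) (auto simp: hD algebra_simps)
        show "\<beta> x x = 0" for x unfolding \<beta>_def by (simp add: mult.commute)
      qed
      then obtain \<phi> where \<phi>: "functional \<phi>" "\<And>x y. \<phi> (wedge x y) = \<beta> x y" by blast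
      have "ev \<phi> = h"
      proof
        fix p
        show "ev \<phi> p = h p"
        proof (cases "p \<in> P")
          case True
          have "\<beta> (e (fst p)) (e (snd p)) = (\<Sum>p'\<in>P. if p' = p then h p' else 0)"
            unfolding \<beta>_def
          proof (rule sum.cong[OF refl])
            fix p' assume "p' \<in> P"
            thus "h p' * (\<eta> (e (fst p)) (e (fst p')) * \<eta> (e (snd p)) (e (snd p')) -
                \<eta> (e (fst p)) (e (snd p')) * \<eta> (e (snd p)) (e (fst p'))) = (if p' = p then h p' else 0)"
              using True by (auto simp: P_def on split: if_splits)
          qed
          also have "\<dots> = h p" using True finP by (simp add: sum.delta)
          finally show ?thesis using True by (simp add: ev_def \<phi>(2))
        next
          case False
          thus ?thesis using PiE_arb[OF h False] by (simp add: ev_def)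
        qed
      qed
      thus "h \<in> ev ` {\<phi>. functional \<phi>}" using \<phi>(1) by blast
    qed (auto simp: ev_def)
  qed
  moreover have "finite (P \<rightarrow>\<^sub>E (UNIV :: 'f set))" using finP by (intro finite_PiE) auto
  moreover have "card (P \<rightarrow>\<^sub>E (UNIV :: 'f set)) = (q\<^sup>2) ^ card P" using finP by (simp add: card_PiE card_f)
  ultimately show ?thesis
    using card_less_pairs[of m] by (simp add: bij_betw_finite bij_betw_same_card P_def)
qed

theorem line_hermitian_code:
  assumes \<omega>: "bij_betw (\<lambda>i. proj_point scaleW (\<omega> i)) {..<N} \<Omega>"
  shows "linear_code N (m choose 2) (dmin q m) (projective_code scaleW N \<omega>)"
proof -
  define word where "word \<phi> = (\<lambda>i. if i < N then \<phi> (\<omega> i) else 0)" for \<phi> :: "'w \<Rightarrow> 'f"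
  let ?\<Phi> = "{\<phi>. functional \<phi>}" and ?C = "projective_code scaleW N \<omega>"
  have C: "?C = word ` ?\<Phi>" by (auto simp: projective_code_def word_def)
  interpret U: vector_space word_scale by (rule vector_space_word_scale)
  have lin: "functional (\<lambda>x. \<phi> x + \<psi> x)" "functional (\<lambda>x. \<phi> x - \<psi> x)" "functional (\<lambda>x. c * \<phi> x)" "functional (\<lambda>x. 0)"
    if "functional \<phi>" "functional \<psi>" for \<phi> \<psi> c
    using that by (auto simp: Vector_Spaces.linear_iff algebra_simps)
  have diff: "{i. i < N \<and> word \<phi> i \<noteq> word \<psi> i} = {i. i < N \<and> \<phi> (\<omega> i) - \<psi> (\<omega> i) \<noteq> 0}" for \<phi> \<psi>
    by (auto simp: word_def)
  have wt: "card {i. i < N \<and> \<phi> (\<omega> i) \<noteq> 0} = weight \<phi>" if \<phi>: "functional \<phi>" for \<phi>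
  proof -
    let ?pt = "\<lambda>i. proj_point scaleW (\<omega> i)"
    have 1: "(\<exists>w\<in>?pt i. \<phi> w \<noteq> 0) \<longleftrightarrow> \<phi> (\<omega> i) \<noteq> 0" for i
      by (auto simp: proj_point_def ext.W.span_singleton functionalD[OF \<phi>] intro!: exI[of _ 1])
    have "?pt ` {i. i < N \<and> \<phi> (\<omega> i) \<noteq> 0} = {P \<in> \<Omega>. \<exists>w\<in>P. \<phi> w \<noteq> 0}"
      unfolding bij_betw_imp_surj_on[OF \<omega>, symmetric] by (auto simp: 1[symmetric])
    moreover have "inj_on ?pt {i. i < N \<and> \<phi> (\<omega> i) \<noteq> 0}"
      by (rule inj_on_subset[OF bij_betw_imp_inj_on[OF \<omega>]]) auto
    ultimately show ?thesis unfolding weight_def using card_image by fastforce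
  qed
  have dist: "hamming_distance N (word \<phi>) (word \<psi>) = weight (\<lambda>x. \<phi> x - \<psi> x)"
    if "functional \<phi>" "functional \<psi>" for \<phi> \<psi>
    unfolding hamming_distance_def diff by (rule wt[OF lin(2)[OF that]])
  have ge: "dmin q m \<le> hamming_distance N (word \<phi>) (word \<psi>)"
    if "functional \<phi>" "functional \<psi>" "\<phi> \<noteq> \<psi>" for \<phi> \<psi>
  proof -
    have "(\<lambda>x. \<phi> x - \<psi> x) \<noteq> (\<lambda>_. 0)" using that(3) by (auto simp: fun_eq_iff)
    thus ?thesis unfolding dist[OF that(1,2)] by (rule weight_ge[OF lin(2)[OF that(1,2)]])
  qed
  \<comment> \<open>Two functionals with the same codeword would have distance 0, below the positive
    \<open>dmin\<close>. So the points span the exterior square without a separate argument, and the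
    code is as large as the dual space.\<close>
  have inj: "inj_on word ?\<Phi>"
  proof (rule inj_onI, rule ccontr)
    fix \<phi> \<psi> assume "\<phi> \<in> ?\<Phi>" "\<psi> \<in> ?\<Phi>" "word \<phi> = word \<psi>" "\<phi> \<noteq> \<psi>"
    thus False using ge[of \<phi> \<psi>] dmin_pos by (simp add: hamming_distance_def)
  qed
  have words: "?C \<subseteq> words N" by (auto simp: C word_def words_def)
  have sub: "U.subspace ?C"
  proof (rule U.subspaceI)
    obtain \<phi> where "functional \<phi>" using exists_weight_eq by blast
    hence "functional (\<lambda>x. 0)" using lin(4) by blast
    moreover have "word (\<lambda>x. 0) = 0" by (auto simp: word_def)
    ultimately show "0 \<in> ?C" unfolding C by (metis image_eqI mem_Collect_eq)
    fix x y assume "x \<in> ?C" "y \<in> ?C"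
    then obtain \<phi> \<psi> where f: "functional \<phi>" "x = word \<phi>" "functional \<psi>" "y = word \<psi>" by (auto simp: C)
    have "x + y = word (\<lambda>z. \<phi> z + \<psi> z)" by (auto simp: f word_def)
    thus "x + y \<in> ?C" using lin(1)[OF f(1,3)] by (auto simp: C)
  next
    fix c x assume "x \<in> ?C"
    then obtain \<phi> where f: "functional \<phi>" "x = word \<phi>" by (auto simp: C)
    have "word_scale c x = word (\<lambda>z. c * \<phi> z)" by (auto simp: f word_def word_scale_def)
    thus "word_scale c x \<in> ?C" using lin(3)[OF f(1) f(1)] by (auto simp: C)
  qed
  have fin: "finite ?C" using card_functionals by (simp add: C)
  have "card ?C = (q\<^sup>2) ^ (m choose 2)" using card_functionals by (simp add: C card_image[OF inj])
  hence "(q\<^sup>2) ^ U.dim ?C = (q\<^sup>2) ^ (m choose 2)"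
    using card_subspace[OF vector_space_word_scale sub fin] by (simp add: card_f)
  moreover have "1 < q\<^sup>2" using q2 by (intro one_less_power) auto
  ultimately have dim: "U.dim ?C = m choose 2" by (simp only: power_inject_exp)
  let ?D = "{hamming_distance N c c' | c c'. c \<in> ?C \<and> c' \<in> ?C \<and> c \<noteq> c'}"
  have "min_distance N ?C = dmin q m"
    unfolding min_distance_def
  proof (rule Min_eqI)
    have "?D \<subseteq> (\<lambda>(c, c'). hamming_distance N c c') ` (?C \<times> ?C)" by auto
    thus "finite ?D" by (rule finite_subset) (simp add: fin)
    show "dmin q m \<le> y" if "y \<in> ?D" for y using that ge by (auto simp: C)
    obtain \<phi> where \<phi>: "functional \<phi>" "\<phi> \<noteq> (\<lambda>_. 0)" "weight \<phi> = dmin q m"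
      using exists_weight_eq by blast
    have z: "functional (\<lambda>_. 0)" using lin(4)[OF \<phi>(1) \<phi>(1)] .
    have "word \<phi> \<noteq> word (\<lambda>_. 0)" using inj \<phi> z by (auto dest: inj_onD)
    moreover have "hamming_distance N (word \<phi>) (word (\<lambda>_. 0)) = dmin q m"
      using dist[OF \<phi>(1) z] \<phi>(3) by simp
    moreover have "word \<phi> \<in> ?C" "word (\<lambda>_. 0) \<in> ?C" using \<phi>(1) z by (auto simp: C)
    ultimately show "dmin q m \<in> ?D" by (metis (mono_tags, lifting) mem_Collect_eq)
  qed
  thus ?thesis unfolding linear_code_def using words sub dim by blast
qed

end

theorem mainTheorem1:
  fixes q m N :: nat
    and scaleV :: "'f::{field, finite} \<Rightarrow> 'v::ab_group_add \<Rightarrow> 'v"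
    and scaleW :: "'f \<Rightarrow> 'w::ab_group_add \<Rightarrow> 'w"
    and wedge :: "'v \<Rightarrow> 'v \<Rightarrow> 'w"
    and \<eta> :: "'v \<Rightarrow> 'v \<Rightarrow> 'f"
    and \<omega> :: "nat \<Rightarrow> 'w"
  assumes "primepow q"
    and "CARD('f) = q ^ 2"
    and "m \<ge> 4"
    and "vector_space scaleV"
    and "vector_space.dim scaleV UNIV = m"
    and "exterior_square scaleV scaleW wedge"
    and "hermitian_form q scaleV \<eta>"
    and "nondegenerate \<eta>"
    and "bij_betw (\<lambda>i. proj_point scaleW (\<omega> i)) {..<N}
           (isotropic_line_points scaleV scaleW wedge \<eta>)"
  shows "rat_of_nat N =
           (of_nat q ^ m + (- 1) ^ (m - 1)) * (of_nat q ^ (m - 1) - (- 1) ^ (m - 1)) *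
           (of_nat q ^ (m - 2) + (- 1) ^ (m - 3)) * (of_nat q ^ (m - 3) - (- 1) ^ (m - 3)) /
           ((of_nat q ^ 2 - 1) ^ 2 * (of_nat q ^ 2 + 1)) \<and>
         linear_code N (m choose 2)
           (if m = 4 \<or> m = 6 then q ^ (4 * m - 12) - q ^ (2 * m - 6)
            else if even m then q ^ (4 * m - 12)
            else q ^ (4 * m - 12) - q ^ (3 * m - 9))
           (projective_code scaleW N \<omega>)"
proof -
  have q: "2 \<le> q" using primepow_gt_Suc_0[OF assms(1)] by simp
  interpret V: vector_space scaleV by fact
  interpret hermitian_space scaleV q m \<eta>
    by unfold_locales (use assms q in auto)
  interpret exterior_square scaleV scaleW wedge by fact
  interpret hermitian_exterior_square scaleV q m \<eta> scaleW wedge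
    by unfold_locales
  have "N = card (isotropic_line_points scaleV scaleW wedge \<eta>)"
    using bij_betw_same_card[OF assms(9)] by simp
  thus ?thesis
    using number_of_points line_hermitian_code[OF assms(9)] unfolding dmin_def by simp
qed

end
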